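(* Let $G$ be a connected graph of vertex-width at most $3$ and let $k$ be a field. Then $[\Psi_G]\in K_0(\mathrm{Var}_k)$ is a polynomial in $\mathbb{L}$ (with integer coefficients).
   Context: Graphs are finite, possibly with multiple edges and self-loops. The graph polynomial is $\Psi_G=\sum_T\prod_{e\notin T}\alpha_e\in\mathbb{Z}[\alpha_e]$, one variable $\alpha_e$ per edge $e$, summed over spanning trees $T$ of $G$. $K_0(\mathrm{Var}_k)$ is the Grothendieck ring of varieties over $k$, $\mathbb{L}=[\mathbb{A}^1_k]$, and $[\Psi_G]$ is the class of the affine hypersurface $\{\Psi_G=0\}\subset\mathbb{A}^{N_G}_k$, where $N_G$ is the number of edges of $G$. Vertex-width: an ordering $\mathcal{O}$ of the edges of $G$ gives a filtration $\emptyset=G_0\subset G_1\subset\dots\subset G_{N}=G$ ($N=N_G$) by subgraphs, where $G_i$ consists of the first $i$ edges. Let $v_i^{\mathcal{O}}$ be the number of vertices of $G_i\cap(G\setminus G_i)$, i.e. vertices which are endpoints both of an edge in $G_i$ and of an edge not in $G_i$. $G$ has vertex-width at most $n$ if there is an ordering $\mathcal{O}$ with $v_i^{\mathcal{O}}\le n$ for all $i$. *)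

theory Defs
  imports
    "HOL-Algebra.Algebraic_Closure_Type"
    "HOL-Algebra.QuotRing"
    "HOL-Analysis.Abstract_Topology"
    "HOL-Library.Poly_Mapping"
    "HOL-Library.More_List"
begin

(* free the identifier X *)
no_notation Polynomials.var (\<open>X\<index>\<close>)

section \<open>Multivariate polynomials\<close>

type_synonym ('x, 'a) mpoly = "('x \<Rightarrow>\<^sub>0 nat) \<Rightarrow>\<^sub>0 'a"

definition mvar :: "'x \<Rightarrow> ('x, 'a::comm_semiring_1) mpoly" where
  "mvar x = Poly_Mapping.single (Poly_Mapping.single x 1) 1"

definition mono_eval :: "('x \<Rightarrow> 'b::comm_ring_1) \<Rightarrow> ('x \<Rightarrow>\<^sub>0 nat) \<Rightarrow> 'b" where
  "mono_eval f m = (\<Prod>x\<in>Poly_Mapping.keys m. f x ^ Poly_Mapping.lookup m x)"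

text \<open>Coefficients are mapped by \<open>h\<close>, variables by \<open>f\<close>.\<close>

definition mpoly_eval ::
  "('a::zero \<Rightarrow> 'b::comm_ring_1) \<Rightarrow> ('x \<Rightarrow> 'b) \<Rightarrow> ('x, 'a) mpoly \<Rightarrow> 'b" where
  "mpoly_eval h f p = (\<Sum>m\<in>Poly_Mapping.keys p. h (Poly_Mapping.lookup p m) * mono_eval f m)"

lemma mono_eval_superset:
  assumes "finite A" "Poly_Mapping.keys m \<subseteq> A"
  shows "mono_eval f m = (\<Prod>x\<in>A. f x ^ Poly_Mapping.lookup m x)"
  unfolding mono_eval_def
  by (rule prod.mono_neutral_left) (use assms in \<open>auto simp: in_keys_iff\<close>)

lemma mono_eval_0 [simp]: "mono_eval f 0 = 1"
  by (simp add: mono_eval_def)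

lemma mono_eval_add: "mono_eval f (m + n) = mono_eval f m * mono_eval f n"
proof -
  let ?A = "Poly_Mapping.keys m \<union> Poly_Mapping.keys n"
  have "Poly_Mapping.keys (m + n) \<subseteq> ?A" by (rule keys_add)
  then have "mono_eval f (m + n) = (\<Prod>x\<in>?A. f x ^ Poly_Mapping.lookup (m + n) x)"
    by (intro mono_eval_superset) auto
  also have "\<dots> = (\<Prod>x\<in>?A. f x ^ Poly_Mapping.lookup m x) * (\<Prod>x\<in>?A. f x ^ Poly_Mapping.lookup n x)"
    by (simp add: lookup_add power_add prod.distrib)
  also have "\<dots> = mono_eval f m * mono_eval f n"
    by (subst (1 2) mono_eval_superset[of ?A]) auto
  finally show ?thesis .
qed

lemma mpoly_eval_superset:
  assumes "finite A" "Poly_Mapping.keys p \<subseteq> A" "h 0 = 0"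
  shows "mpoly_eval h f p = (\<Sum>m\<in>A. h (Poly_Mapping.lookup p m) * mono_eval f m)"
  unfolding mpoly_eval_def
  by (rule sum.mono_neutral_left) (use assms in \<open>auto simp: in_keys_iff\<close>)

lemma mpoly_eval_single:
  assumes "h 0 = 0"
  shows "mpoly_eval h f (Poly_Mapping.single m c) = h c * mono_eval f m"
  using assms by (subst mpoly_eval_superset[of "{m}"]) auto

lemma mpoly_eval_0 [simp]: "mpoly_eval h f 0 = 0"
  by (simp add: mpoly_eval_def)

lemma mpoly_eval_add:
  assumes "h 0 = 0" "\<And>a b. h (a + b) = h a + h b"
  shows "mpoly_eval h f (p + q) = mpoly_eval h f p + mpoly_eval h f q"
proof -
  let ?A = "Poly_Mapping.keys p \<union> Poly_Mapping.keys q"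
  have "mpoly_eval h f (p + q) = (\<Sum>m\<in>?A. h (Poly_Mapping.lookup (p + q) m) * mono_eval f m)"
    by (rule mpoly_eval_superset) (use keys_add[of p q] assms in auto)
  also have "\<dots> = (\<Sum>m\<in>?A. h (Poly_Mapping.lookup p m) * mono_eval f m)
      + (\<Sum>m\<in>?A. h (Poly_Mapping.lookup q m) * mono_eval f m)"
    by (simp add: lookup_add assms ring_distribs sum.distrib)
  also have "\<dots> = mpoly_eval h f p + mpoly_eval h f q"
    by (subst (1 2) mpoly_eval_superset[of ?A]) (use assms in auto)
  finally show ?thesis .
qed

lemma mpoly_decompose:
  "p = (\<Sum>m\<in>Poly_Mapping.keys p. Poly_Mapping.single m (Poly_Mapping.lookup p m))"
  by (rule poly_mapping_eqI) (auto simp: lookup_sum lookup_single when_def in_keys_iff sum.delta)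

lemma mpoly_eval_sum:
  assumes "h 0 = 0" "\<And>a b. h (a + b) = h a + h b"
  shows "mpoly_eval h f (sum g A) = (\<Sum>a\<in>A. mpoly_eval h f (g a))"
  by (induction A rule: infinite_finite_induct) (auto simp: mpoly_eval_add assms)

lemma mpoly_eval_mult:
  assumes "h 0 = 0" "\<And>a b. h (a + b) = h a + h b" "\<And>a b. h (a * b) = h a * h b"
  shows "mpoly_eval h f (p * q) = mpoly_eval h f p * mpoly_eval h f q"
proof -
  let ?s = "\<lambda>p m. Poly_Mapping.single m (Poly_Mapping.lookup p m)"
  have "p * q = (\<Sum>m\<in>Poly_Mapping.keys p. ?s p m) * (\<Sum>m\<in>Poly_Mapping.keys q. ?s q m)"
    using mpoly_decompose[of p] mpoly_decompose[of q] by simp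
  also have "\<dots> = (\<Sum>m\<in>Poly_Mapping.keys p. \<Sum>n\<in>Poly_Mapping.keys q.
      Poly_Mapping.single (m + n) (Poly_Mapping.lookup p m * Poly_Mapping.lookup q n))"
    by (simp add: sum_product mult_single)
  finally show ?thesis
    by (simp add: mpoly_eval_sum assms mpoly_eval_single mono_eval_add)
       (simp add: mpoly_eval_def sum_product algebra_simps)
qed

lemma mpoly_eval_mvar:
  assumes "h 0 = 0" "h 1 = 1"
  shows "mpoly_eval h f (mvar x) = f x"
  by (simp add: mvar_def mpoly_eval_single assms) (simp add: mono_eval_def)


section \<open>Varieties over a field\<close>

text \<open>
  Varieties over \<open>k\<close> are treated in the classical way, as spaces with functions: a variety is
  the set of its points over the algebraic closure of \<open>k\<close>, with the Zariski topology of sets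
  defined over \<open>k\<close> and the sheaf of functions that are locally quotients of polynomials with
  coefficients in \<open>k\<close>. These are the reduced separated schemes of finite type over \<open>k\<close>; they are
  not assumed to be irreducible or nonempty.
  As the algebraic closure is infinite, lists over it provide enough points for every variety.

  A function \<open>f \<in> regular X U\<close> is a total function of which only the values on \<open>U\<close> matter.
\<close>

record ('p, 'f) fspace =
  zar :: "'p topology"
  regular :: "'p set \<Rightarrow> ('p \<Rightarrow> 'f) set"

abbreviation points :: "('p, 'f) fspace \<Rightarrow> 'p set" where
  "points X \<equiv> topspace (zar X)"

type_synonym 'k kspace = "('k alg_closure list, 'k alg_closure) fspace"

definition is_sheaf :: "('p, 'f) fspace \<Rightarrow> bool" where
  "is_sheaf X \<longleftrightarrow>
     (\<forall>U V. openin (zar X) U \<and> openin (zar X) V \<and> V \<subseteq> U \<longrightarrow> regular X U \<subseteq> regular X V) \<and>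
     (\<forall>U f. openin (zar X) U \<longrightarrow>
        (f \<in> regular X U \<longleftrightarrow>
          (\<forall>x\<in>U. \<exists>W g. openin (zar X) W \<and> x \<in> W \<and> W \<subseteq> U \<and> g \<in> regular X W \<and> (\<forall>y\<in>W. f y = g y))))"

definition morphism :: "('p, 'f) fspace \<Rightarrow> ('q, 'f) fspace \<Rightarrow> ('p \<Rightarrow> 'q) \<Rightarrow> bool" where
  "morphism X Y \<phi> \<longleftrightarrow> continuous_map (zar X) (zar Y) \<phi> \<and>
     (\<forall>V f. openin (zar Y) V \<and> f \<in> regular Y V \<longrightarrow> f \<circ> \<phi> \<in> regular X {x \<in> points X. \<phi> x \<in> V})"

definition isomorphic :: "('p, 'f) fspace \<Rightarrow> ('q, 'f) fspace \<Rightarrow> bool" where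
  "isomorphic X Y \<longleftrightarrow> (\<exists>\<phi> \<psi>. morphism X Y \<phi> \<and> morphism Y X \<psi> \<and>
     (\<forall>x\<in>points X. \<psi> (\<phi> x) = x) \<and> (\<forall>y\<in>points Y. \<phi> (\<psi> y) = y))"

text \<open>
  For an open set the following is the open subspace, for a closed set it is the closed subspace
  with the reduced structure.
\<close>

definition subsp :: "('p, 'f) fspace \<Rightarrow> 'p set \<Rightarrow> ('p, 'f) fspace" where
  "subsp X S =
     \<lparr> zar = subtopology (zar X) S,
       regular = (\<lambda>U. {f. \<forall>x\<in>U. \<exists>W g. openin (zar X) W \<and> x \<in> W \<and> W \<inter> S \<subseteq> U \<and>
                            g \<in> regular X W \<and> (\<forall>y\<in>W \<inter> S. f y = g y)}) \<rparr>"

text \<open>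
  Polynomials over \<open>k\<close> in the variables \<open>0, 1, 2, \<dots>\<close> are evaluated at points of \<open>n\<close>-space by
  setting the variables from \<open>n\<close> on to zero.
\<close>

definition peval :: "(nat, 'k::field) mpoly \<Rightarrow> 'k alg_closure list \<Rightarrow> 'k alg_closure" where
  "peval p x = mpoly_eval to_ac (nth_default 0 x) p"

definition zero_locus :: "nat \<Rightarrow> (nat, 'k::field) mpoly set \<Rightarrow> 'k alg_closure list set" where
  "zero_locus n S = {x. length x = n \<and> (\<forall>p\<in>S. peval p x = 0)}"

definition zariski :: "nat \<Rightarrow> 'k::field alg_closure list topology" where
  "zariski n = topology (\<lambda>U. \<exists>S :: (nat, 'k) mpoly set. U = {x. length x = n} - zero_locus n S)"

definition affine_space :: "nat \<Rightarrow> 'k::field kspace" where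
  "affine_space n =
     \<lparr> zar = zariski n,
       regular = (\<lambda>U. {f. \<forall>x\<in>U. \<exists>W p q. openin (zariski n) W \<and> x \<in> W \<and> W \<subseteq> U \<and>
                            (\<forall>y\<in>W. peval q y \<noteq> 0 \<and> f y = peval p y / peval q y)}) \<rparr>"

definition affine_set :: "nat \<Rightarrow> (nat, 'k::field) mpoly set \<Rightarrow> 'k kspace" where
  "affine_set n S = subsp (affine_space n) (zero_locus n S)"

definition is_prevariety :: "'k::field kspace \<Rightarrow> bool" where
  "is_prevariety X \<longleftrightarrow> is_sheaf X \<and>
     (\<exists>\<U>. finite \<U> \<and> \<Union>\<U> = points X \<and>
        (\<forall>U\<in>\<U>. openin (zar X) U \<and> (\<exists>n S. isomorphic (subsp X U) (affine_set n S))))"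

definition is_separated :: "'k::field kspace \<Rightarrow> bool" where
  "is_separated X \<longleftrightarrow> (\<forall>n S \<phi> \<psi>. morphism (affine_set n S) X \<phi> \<and> morphism (affine_set n S) X \<psi> \<longrightarrow>
     closedin (zar (affine_set n S)) {z \<in> points (affine_set n S). \<phi> z = \<psi> z})"

definition is_variety :: "'k::field kspace \<Rightarrow> bool" where
  "is_variety X \<longleftrightarrow> is_prevariety X \<and> is_separated X"


subsection \<open>Affine varieties\<close>

lemma peval_0 [simp]: "peval 0 x = 0"
  and peval_add [simp]: "peval (p + q) x = peval p x + peval q x"
  and peval_mult [simp]: "peval (p * q) x = peval p x * peval q x"
  by (simp_all add: peval_def mpoly_eval_add mpoly_eval_mult)

lemma peval_single_0 [simp]: "peval (Poly_Mapping.single 0 c) x = to_ac c"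
  by (simp add: peval_def mpoly_eval_single)

lemma peval_1 [simp]: "peval 1 x = 1"
  using peval_single_0[of 1 x] by (simp del: peval_single_0)

lemma peval_uminus [simp]: "peval (- p) x = - peval p x"
  using peval_add[of p "- p" x] by (simp add: add_eq_0_iff del: peval_add)

lemma peval_diff [simp]: "peval (p - q) x = peval p x - peval q x"
  using peval_add[of p "- q" x] by (simp del: peval_add)

lemma peval_mvar [simp]: "peval (mvar i) x = nth_default 0 x i"
  by (simp add: peval_def mpoly_eval_mvar)

lemma istopology_zariski:
  "istopology (\<lambda>U. \<exists>S :: (nat, 'k::field) mpoly set. U = {x. length x = n} - zero_locus n S)"
  unfolding istopology_def
proof (intro conjI allI impI, goal_cases)
  case (1 U V)
  then obtain A B :: "(nat, 'k) mpoly set" where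
    U: "U = {x. length x = n} - zero_locus n A" and V: "V = {x. length x = n} - zero_locus n B"
    by blast
  have "U \<inter> V = {x. length x = n} - zero_locus n {p * q | p q. p \<in> A \<and> q \<in> B}"
    unfolding U V zero_locus_def by auto (metis no_zero_divisors peval_mult)
  then show ?case by blast
next
  case (2 \<K>)
  then obtain s :: "_ \<Rightarrow> (nat, 'k) mpoly set" where
    s: "\<And>U. U \<in> \<K> \<Longrightarrow> U = {x. length x = n} - zero_locus n (s U)"
    by metis
  have *: "\<Union>\<K> = (\<Union>U\<in>\<K>. {x. length x = n} - zero_locus n (s U))"
    using s by blast
  have "\<Union>\<K> = {x. length x = n} - zero_locus n (\<Union>(s ` \<K>))"
    unfolding * zero_locus_def by auto
  then show ?case by blast
qed

lemma openin_zariski: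
  "openin (zariski n) U \<longleftrightarrow> (\<exists>S :: (nat, 'k::field) mpoly set. U = {x. length x = n} - zero_locus n S)"
  unfolding zariski_def topology_inverse'[OF istopology_zariski] ..

lemma topspace_zariski [simp]: "topspace (zariski n :: 'k::field alg_closure list topology) = {x. length x = n}"
proof
  show "topspace (zariski n :: 'k alg_closure list topology) \<subseteq> {x. length x = n}"
    unfolding topspace_def openin_zariski by auto
  have "{x. length x = n} = {x. length x = n} - zero_locus n {1 :: (nat, 'k) mpoly}"
    by (simp add: zero_locus_def)
  then have "openin (zariski n :: 'k alg_closure list topology) {x. length x = n}"
    unfolding openin_zariski by (rule exI)
  then show "{x. length x = n} \<subseteq> topspace (zariski n :: 'k alg_closure list topology)"
    by (rule openin_subset)
qed

lemma closedin_zariski: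
  "closedin (zariski n) C \<longleftrightarrow> (\<exists>S :: (nat, 'k::field) mpoly set. C = zero_locus n S)"
proof -
  have sub: "zero_locus n S \<subseteq> {x. length x = n}" for S :: "(nat, 'k) mpoly set"
    by (auto simp: zero_locus_def)
  have "C \<subseteq> {x. length x = n} \<and> {x. length x = n} - C = {x. length x = n} - zero_locus n S
      \<longleftrightarrow> C = zero_locus n S" for S :: "(nat, 'k) mpoly set"
    using sub[of S] by blast
  then show ?thesis
    unfolding closedin_def openin_zariski topspace_zariski ex_simps(2)[symmetric] by simp
qed

lemma openin_peval: "openin (zariski n) {x. length x = n \<and> peval (p :: (nat, 'k::field) mpoly) x \<noteq> 0}"
proof -
  have "{x. length x = n \<and> peval p x \<noteq> 0} = {x. length x = n} - zero_locus n {p}"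
    by (auto simp: zero_locus_def)
  then show ?thesis unfolding openin_zariski by blast
qed

lemma zar_affine_space [simp]: "zar (affine_space n) = zariski n"
  by (simp add: affine_space_def)

lemma zar_subsp [simp]: "zar (subsp X S) = subtopology (zar X) S"
  by (simp add: subsp_def)

lemma zar_affine_set [simp]: "zar (affine_set n S) = subtopology (zariski n) (zero_locus n S)"
  by (simp add: affine_set_def)

lemma points_affine_set: "points (affine_set n S) = zero_locus n S"
  by (auto simp: zero_locus_def)

lemma regular_subsp_iff:
  "f \<in> regular (subsp X S) U \<longleftrightarrow>
     (\<forall>x\<in>U. \<exists>W g. openin (zar X) W \<and> x \<in> W \<and> W \<inter> S \<subseteq> U \<and> g \<in> regular X W \<and> (\<forall>y\<in>W \<inter> S. f y = g y))"
  by (simp add: subsp_def)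

lemma regular_affine_space_iff:
  "f \<in> regular (affine_space n :: 'k::field kspace) U \<longleftrightarrow>
     (\<forall>x\<in>U. \<exists>W (p :: (nat, 'k) mpoly) q. openin (zariski n) W \<and> x \<in> W \<and> W \<subseteq> U \<and>
        (\<forall>y\<in>W. peval q y \<noteq> 0 \<and> f y = peval p y / peval q y))"
  by (simp add: affine_space_def)

lemma is_sheafD1:
  "is_sheaf X \<Longrightarrow> f \<in> regular X U \<Longrightarrow> openin (zar X) U \<Longrightarrow> openin (zar X) V \<Longrightarrow> V \<subseteq> U \<Longrightarrow> f \<in> regular X V"
  unfolding is_sheaf_def by blast

lemma is_sheaf_affine_space: "is_sheaf (affine_space n :: 'k::field kspace)"
  unfolding is_sheaf_def zar_affine_space
proof (intro conjI allI impI subsetI)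
  fix U V :: "'k alg_closure list set" and f
  assume UV: "openin (zariski n) U \<and> openin (zariski n) V \<and> V \<subseteq> U"
    and f: "f \<in> regular (affine_space n) U"
  show "f \<in> regular (affine_space n) V"
    unfolding regular_affine_space_iff
  proof
    fix x assume "x \<in> V"
    then have "x \<in> U" using UV by auto
    from f[unfolded regular_affine_space_iff, rule_format, OF this]
    obtain W and p q :: "(nat, 'k) mpoly" where
      "openin (zariski n) W" "x \<in> W" "\<forall>y\<in>W. peval q y \<noteq> 0 \<and> f y = peval p y / peval q y"
      by blast
    then show "\<exists>W (p :: (nat, 'k) mpoly) q. openin (zariski n) W \<and> x \<in> W \<and> W \<subseteq> V \<and>
        (\<forall>y\<in>W. peval q y \<noteq> 0 \<and> f y = peval p y / peval q y)"
      using UV \<open>x \<in> V\<close> by (intro exI[of _ "W \<inter> V"] exI[of _ p] exI[of _ q]) auto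
  qed
next
  fix U :: "'k alg_closure list set" and f
  assume U: "openin (zariski n) U"
  show "f \<in> regular (affine_space n) U \<longleftrightarrow>
      (\<forall>x\<in>U. \<exists>W g. openin (zariski n) W \<and> x \<in> W \<and> W \<subseteq> U \<and> g \<in> regular (affine_space n) W \<and> (\<forall>y\<in>W. f y = g y))"
    (is "?L \<longleftrightarrow> (\<forall>x\<in>U. \<exists>W g. ?P x W g)" is "_ \<longleftrightarrow> ?R")
  proof
    assume ?L
    show ?R
    proof
      fix x assume "x \<in> U"
      then show "\<exists>W g. ?P x W g"
        using U \<open>?L\<close> by (intro exI[of _ U] exI[of _ f] conjI ballI refl subset_refl)
    qed
  next
    assume R: ?R
    show ?L unfolding regular_affine_space_iff
    proof
      fix x assume "x \<in> U"
      from bspec[OF R this]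
      obtain W g where W: "openin (zariski n) W" "x \<in> W" "W \<subseteq> U"
        "g \<in> regular (affine_space n) W" "\<forall>y\<in>W. f y = g y"
        by blast
      from W(4)[unfolded regular_affine_space_iff, rule_format, OF W(2)]
      obtain W' and p q :: "(nat, 'k) mpoly" where
        "openin (zariski n) W'" "x \<in> W'" "W' \<subseteq> W" "\<forall>y\<in>W'. peval q y \<noteq> 0 \<and> g y = peval p y / peval q y"
        by blast
      then show "\<exists>W (p :: (nat, 'k) mpoly) q. openin (zariski n) W \<and> x \<in> W \<and> W \<subseteq> U \<and>
          (\<forall>y\<in>W. peval q y \<noteq> 0 \<and> f y = peval p y / peval q y)"
        using W by (intro exI[of _ W'] exI[of _ p] exI[of _ q]) auto
    qed
  qed
qed

lemma is_sheaf_subsp: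
  assumes X: "is_sheaf X"
  shows "is_sheaf (subsp X S)"
  unfolding is_sheaf_def zar_subsp
proof (intro conjI allI impI subsetI)
  fix U V f
  assume UV: "openin (subtopology (zar X) S) U \<and> openin (subtopology (zar X) S) V \<and> V \<subseteq> U"
    and f: "f \<in> regular (subsp X S) U"
  obtain V' where V': "openin (zar X) V'" "V = V' \<inter> S"
    using UV by (auto simp: openin_subtopology)
  show "f \<in> regular (subsp X S) V"
    unfolding regular_subsp_iff
  proof
    fix x assume "x \<in> V"
    then have "x \<in> U" using UV by auto
    from f[unfolded regular_subsp_iff, rule_format, OF this]
    obtain W g where W: "openin (zar X) W" "x \<in> W" "g \<in> regular X W" "\<forall>y\<in>W \<inter> S. f y = g y"
      by blast
    have "g \<in> regular X (W \<inter> V')"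
      by (rule is_sheafD1[OF X W(3)]) (use W(1) V'(1) in auto)
    then show "\<exists>W g. openin (zar X) W \<and> x \<in> W \<and> W \<inter> S \<subseteq> V \<and> g \<in> regular X W \<and> (\<forall>y\<in>W \<inter> S. f y = g y)"
      using W V' \<open>x \<in> V\<close> by (intro exI[of _ "W \<inter> V'"] exI[of _ g]) auto
  qed
next
  fix U f
  assume U: "openin (subtopology (zar X) S) U"
  show "f \<in> regular (subsp X S) U \<longleftrightarrow>
      (\<forall>x\<in>U. \<exists>W g. openin (subtopology (zar X) S) W \<and> x \<in> W \<and> W \<subseteq> U \<and>
         g \<in> regular (subsp X S) W \<and> (\<forall>y\<in>W. f y = g y))"
    (is "?L \<longleftrightarrow> (\<forall>x\<in>U. \<exists>W g. ?P x W g)" is "_ \<longleftrightarrow> ?R")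
  proof
    assume ?L
    show ?R
    proof
      fix x assume "x \<in> U"
      then show "\<exists>W g. ?P x W g"
        using U \<open>?L\<close> by (intro exI[of _ U] exI[of _ f] conjI ballI refl subset_refl)
    qed
  next
    assume R: ?R
    show ?L unfolding regular_subsp_iff
    proof
      fix x assume "x \<in> U"
      from bspec[OF R this]
      obtain W g where W: "openin (subtopology (zar X) S) W" "x \<in> W" "W \<subseteq> U"
        "g \<in> regular (subsp X S) W" "\<forall>y\<in>W. f y = g y"
        by blast
      from W(4)[unfolded regular_subsp_iff, rule_format, OF W(2)]
      obtain W' h where W': "openin (zar X) W'" "x \<in> W'" "W' \<inter> S \<subseteq> W"
        "h \<in> regular X W'" "\<forall>y\<in>W' \<inter> S. g y = h y"
        by blast
      have "W' \<inter> S \<subseteq> U" "\<forall>y\<in>W' \<inter> S. f y = h y"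
        using W W' by auto
      with W' show "\<exists>W g. openin (zar X) W \<and> x \<in> W \<and> W \<inter> S \<subseteq> U \<and> g \<in> regular X W \<and> (\<forall>y\<in>W \<inter> S. f y = g y)"
        by blast
    qed
  qed
qed

lemma regular_subsp_topspace:
  assumes X: "is_sheaf X" and U: "openin (zar X) U"
  shows "regular (subsp X (points X)) U = regular X U"
proof (rule Set.set_eqI)
  fix f
  have *: "W \<inter> points X = W" if "openin (zar X) W" for W
    using openin_subset[OF that] by auto
  have "f \<in> regular (subsp X (points X)) U \<longleftrightarrow>
    (\<forall>x\<in>U. \<exists>W g. openin (zar X) W \<and> x \<in> W \<and> W \<subseteq> U \<and> g \<in> regular X W \<and> (\<forall>y\<in>W. f y = g y))"
    unfolding regular_subsp_iff using * by (simp cong: conj_cong)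
  also have "\<dots> \<longleftrightarrow> f \<in> regular X U"
    using X[unfolded is_sheaf_def, THEN conjunct2, rule_format, OF U, of f] by (rule sym)
  finally show "f \<in> regular (subsp X (points X)) U \<longleftrightarrow> f \<in> regular X U" .
qed

lemma isomorphic_subsp_topspace:
  assumes "is_sheaf X"
  shows "isomorphic (subsp X (points X)) X"
  unfolding isomorphic_def
proof (intro exI conjI)
  have pre: "openin (zar X) V \<Longrightarrow> {x \<in> points X. id x \<in> V} = V" for V
    using openin_subset by fastforce
  have pre': "openin (zar X) V \<Longrightarrow> {x \<in> points X. x \<in> V} = V" for V
    using openin_subset by fastforce
  show "morphism (subsp X (points X)) X id"
    unfolding morphism_def using assms
    by (auto simp: pre pre' regular_subsp_topspace)
  show "morphism X (subsp X (points X)) id"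
    unfolding morphism_def using assms
    by (auto simp: pre pre' regular_subsp_topspace)
qed auto

lemma regular_affine_set_local:
  fixes S :: "(nat, 'k::field) mpoly set"
  assumes f: "f \<in> regular (affine_set n S) U" and x: "x \<in> U"
  shows "\<exists>W (p :: (nat, 'k) mpoly) q. openin (zariski n) W \<and> x \<in> W \<and>
    (\<forall>y\<in>W \<inter> zero_locus n S. peval q y \<noteq> 0 \<and> f y = peval p y / peval q y)"
proof -
  from f[unfolded affine_set_def regular_subsp_iff zar_affine_space, rule_format, OF x]
  obtain W g where W: "openin (zariski n) W" "x \<in> W" "g \<in> regular (affine_space n) W"
    "\<forall>y\<in>W \<inter> zero_locus n S. f y = g y"
    by blast
  from W(3)[unfolded regular_affine_space_iff, rule_format, OF W(2)]
  obtain W' and p q :: "(nat, 'k) mpoly" where W': "openin (zariski n) W'" "x \<in> W'" "W' \<subseteq> W"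
      "\<forall>y\<in>W'. peval q y \<noteq> 0 \<and> g y = peval p y / peval q y"
    by blast
  show ?thesis
  proof (intro exI conjI ballI)
    show "openin (zariski n) W'" "x \<in> W'" by fact+
    fix y assume "y \<in> W' \<inter> zero_locus n S"
    then show "peval q y \<noteq> 0" "f y = peval p y / peval q y"
      using W(4) W'(3,4) by auto
  qed
qed

lemma closedin_eq_regular:
  fixes f g :: "'k::field alg_closure list \<Rightarrow> 'k alg_closure"
  assumes f: "f \<in> regular (affine_set n S) (zero_locus n S)"
    and g: "g \<in> regular (affine_set n S) (zero_locus n S)"
  shows "closedin (subtopology (zariski n) (zero_locus n S)) {z \<in> zero_locus n S. f z = g z}"
proof -
  let ?T = "subtopology (zariski n) (zero_locus n S)"
  have ts: "topspace ?T = zero_locus n S"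
    using points_affine_set[of n S] by simp
  have "openin ?T (zero_locus n S - {z \<in> zero_locus n S. f z = g z})" (is "openin _ ?D")
  proof (subst openin_subopen, intro ballI)
    fix x assume x: "x \<in> ?D"
    then have xS: "x \<in> zero_locus n S" by simp
    from regular_affine_set_local[OF f xS]
    obtain W and p q :: "(nat, 'k) mpoly" where W: "openin (zariski n) W" "x \<in> W"
      "\<forall>y\<in>W \<inter> zero_locus n S. peval q y \<noteq> 0 \<and> f y = peval p y / peval q y"
      by (elim exE conjE)
    from regular_affine_set_local[OF g xS]
    obtain W' and p' q' :: "(nat, 'k) mpoly" where W': "openin (zariski n) W'" "x \<in> W'"
      "\<forall>y\<in>W' \<inter> zero_locus n S. peval q' y \<noteq> 0 \<and> g y = peval p' y / peval q' y"
      by (elim exE conjE)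
    let ?r = "p * q' - p' * q"
    let ?N = "(W \<inter> W' \<inter> {y. length y = n \<and> peval ?r y \<noteq> 0}) \<inter> zero_locus n S"
    have *: "f y = g y \<longleftrightarrow> peval ?r y = 0" if "y \<in> W" "y \<in> W'" "y \<in> zero_locus n S" for y
      using W(3)[rule_format, of y] W'(3)[rule_format, of y] that
      by (auto simp: frac_eq_eq algebra_simps)
    have "openin ?T ?N"
      unfolding openin_subtopology
      by (rule exI[of _ "W \<inter> W' \<inter> {y. length y = n \<and> peval ?r y \<noteq> 0}"])
        (intro conjI openin_Int W(1) W'(1) openin_peval[of n ?r] refl)
    moreover have "x \<in> ?N"
      using x W(2) W'(2) *[of x] by (auto simp: zero_locus_def)
    moreover have "?N \<subseteq> ?D" using * by auto
    ultimately show "\<exists>N. openin ?T N \<and> x \<in> N \<and> N \<subseteq> ?D" by blast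
  qed
  then show ?thesis unfolding closedin_def ts by auto
qed

lemma regular_coordinate:
  "(\<lambda>x. nth_default 0 x i) \<in> regular (affine_set n S :: 'k::field kspace) (zero_locus n S)"
proof -
  have op: "openin (zariski n) {x :: 'k alg_closure list. length x = n}"
    using openin_topspace[of "zariski n :: 'k alg_closure list topology"] by simp
  have "(\<lambda>x. nth_default 0 x i) \<in> regular (affine_space n :: 'k kspace) {x. length x = n}"
    unfolding regular_affine_space_iff
  proof
    fix x :: "'k alg_closure list" assume "x \<in> {x. length x = n}"
    then show "\<exists>W (p :: (nat, 'k) mpoly) q. openin (zariski n) W \<and> x \<in> W \<and> W \<subseteq> {x. length x = n} \<and>
        (\<forall>y\<in>W. peval q y \<noteq> 0 \<and> nth_default 0 y i = peval p y / peval q y)"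
      using op by (intro exI[of _ "{x. length x = n}"] exI[of _ "mvar i"] exI[of _ 1]) auto
  qed
  then show ?thesis
    unfolding affine_set_def regular_subsp_iff zar_affine_space
    using op by (intro ballI exI[of _ "{x. length x = n}"] exI[of _ "\<lambda>x. nth_default 0 x i"])
      (auto simp: zero_locus_def)
qed

lemma is_separated_affine_set: "is_separated (affine_set n S :: 'k::field kspace)"
  unfolding is_separated_def
proof (intro allI impI)
  fix m and T :: "(nat, 'k) mpoly set" and \<phi> \<psi>
  assume "morphism (affine_set m T) (affine_set n S) \<phi> \<and> morphism (affine_set m T) (affine_set n S) \<psi>"
  then have \<phi>: "morphism (affine_set m T) (affine_set n S) \<phi>"
    and \<psi>: "morphism (affine_set m T) (affine_set n S) \<psi>" by auto
  let ?Z = "zero_locus m T"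
  let ?top = "subtopology (zariski m) ?Z"
  have maps: "\<chi> z \<in> zero_locus n S"
    if "morphism (affine_set m T) (affine_set n S) \<chi>" "z \<in> ?Z" for \<chi> z
    using that continuous_map_funspace[of "zar (affine_set m T)" "zar (affine_set n S)" \<chi>]
    unfolding morphism_def points_affine_set by auto
  have coord: "(\<lambda>z. nth_default 0 (\<chi> z) i) \<in> regular (affine_set m T) ?Z"
    if \<chi>: "morphism (affine_set m T) (affine_set n S) \<chi>" for \<chi> i
  proof -
    have "openin (zar (affine_set n S)) (zero_locus n S)"
      using openin_topspace[of "zar (affine_set n S)"] unfolding points_affine_set .
    then have "(\<lambda>x. nth_default 0 x i) \<circ> \<chi> \<in> regular (affine_set m T) {z \<in> ?Z. \<chi> z \<in> zero_locus n S}"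
      using \<chi> regular_coordinate[of i n S] unfolding morphism_def points_affine_set by blast
    moreover have "{z \<in> ?Z. \<chi> z \<in> zero_locus n S} = ?Z"
      using maps[OF \<chi>] by auto
    ultimately show ?thesis by (simp add: o_def)
  qed
  have eq: "{z \<in> ?Z. \<phi> z = \<psi> z} =
      ?Z \<inter> (\<Inter>i\<in>{..<n}. {z \<in> ?Z. nth_default 0 (\<phi> z) i = nth_default 0 (\<psi> z) i})"
  proof (intro equalityI subsetI)
    fix z assume z: "z \<in> ?Z \<inter> (\<Inter>i\<in>{..<n}. {z \<in> ?Z. nth_default 0 (\<phi> z) i = nth_default 0 (\<psi> z) i})"
    then have "length (\<phi> z) = n" "length (\<psi> z) = n"
      using maps[OF \<phi>, of z] maps[OF \<psi>, of z] by (auto simp: zero_locus_def)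
    moreover have "\<forall>i<n. nth_default 0 (\<phi> z) i = nth_default 0 (\<psi> z) i" using z by auto
    ultimately have "\<phi> z = \<psi> z"
      by (intro nth_equalityI) (auto simp: nth_default_nth)
    then show "z \<in> {z \<in> ?Z. \<phi> z = \<psi> z}" using z by auto
  qed auto
  have clZ: "closedin ?top ?Z"
    using closedin_topspace[of "zar (affine_set m T)"] unfolding points_affine_set by simp
  have cl: "closedin ?top {z \<in> ?Z. nth_default 0 (\<phi> z) i = nth_default 0 (\<psi> z) i}" for i
    by (rule closedin_eq_regular[OF coord[OF \<phi>] coord[OF \<psi>]])
  have "closedin ?top {z \<in> ?Z. \<phi> z = \<psi> z}"
  proof (cases "n = 0")
    case True
    then show ?thesis unfolding eq using clZ by simp
  next
    case False
    then show ?thesis unfolding eq using clZ cl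
      by (intro closedin_Int closedin_INT) auto
  qed
  then show "closedin (zar (affine_set m T)) {z \<in> points (affine_set m T). \<phi> z = \<psi> z}"
    unfolding points_affine_set by simp
qed

lemma is_variety_affine_set: "is_variety (affine_set n S :: 'k::field kspace)"
proof -
  let ?X = "affine_set n S :: 'k kspace"
  have sh: "is_sheaf ?X"
    unfolding affine_set_def by (rule is_sheaf_subsp[OF is_sheaf_affine_space])
  have "is_prevariety ?X"
    unfolding is_prevariety_def
    using sh isomorphic_subsp_topspace[OF sh] openin_topspace[of "zar ?X"]
    by (intro conjI exI[of _ "{points ?X}"]) blast+
  then show ?thesis
    using is_separated_affine_set is_variety_def by blast
qed

typedef (overloaded) 'k variety = "{X :: 'k::field kspace. is_variety X}"
  morphisms space_of Abs_variety
  using is_variety_affine_set by blast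

setup_lifting type_definition_variety

lift_definition affine_variety :: "nat \<Rightarrow> (nat, 'k::field) mpoly set \<Rightarrow> 'k variety"
  is affine_set
  by (rule is_variety_affine_set)


section \<open>The Grothendieck ring of varieties\<close>

definition is_product ::
  "'k::field variety \<Rightarrow> 'k variety \<Rightarrow> 'k variety \<Rightarrow> bool" where
  "is_product P X Y \<longleftrightarrow> (\<exists>\<pi>\<^sub>1 \<pi>\<^sub>2.
     morphism (space_of P) (space_of X) \<pi>\<^sub>1 \<and> morphism (space_of P) (space_of Y) \<pi>\<^sub>2 \<and>
     (\<forall>Z f g. morphism (space_of Z) (space_of X) f \<and> morphism (space_of Z) (space_of Y) g \<longrightarrow>
        (\<exists>h. morphism (space_of Z) (space_of P) h \<and>
           (\<forall>z\<in>points (space_of Z). \<pi>\<^sub>1 (h z) = f z \<and> \<pi>\<^sub>2 (h z) = g z) \<and>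
           (\<forall>h'. morphism (space_of Z) (space_of P) h' \<and>
              (\<forall>z\<in>points (space_of Z). \<pi>\<^sub>1 (h' z) = f z \<and> \<pi>\<^sub>2 (h' z) = g z) \<longrightarrow>
              (\<forall>z\<in>points (space_of Z). h' z = h z)))))"

text \<open>
  \<open>K\<^sub>0(Var\<^sub>k)\<close> is presented as a commutative ring: the polynomial ring over the integers with one
  variable for each variety, modulo the isomorphism, scissors and product relations, and
  \<open>[Spec k] = 1\<close>. As the products make every monomial equal to a single variety, this is the
  free abelian group on isomorphism classes of varieties modulo the scissors relations, with the
  multiplication induced by the product of varieties.
\<close>

definition K0_relations :: "('k::field variety, int) mpoly set" where
  "K0_relations =
     {mvar X - mvar Y | X Y. isomorphic (space_of X) (space_of Y)} \<union>
     {mvar X - mvar Z - mvar U | X Z U. \<exists>C. closedin (zar (space_of X)) C \<and>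
        space_of Z = subsp (space_of X) C \<and> space_of U = subsp (space_of X) (points (space_of X) - C)} \<union>
     {mvar P - mvar X * mvar Y | P X Y. is_product P X Y} \<union>
     {mvar (affine_variety 0 {}) - 1}"

definition K0 :: "('k::field variety, int) mpoly set ring" where
  "K0 = ring_of_type_algebra Quot (genideal ring_of_type_algebra K0_relations)"

definition K0_class :: "'k::field variety \<Rightarrow> ('k variety, int) mpoly set" where
  "K0_class X = genideal ring_of_type_algebra K0_relations +>\<^bsub>ring_of_type_algebra\<^esub> mvar X"

definition lefschetz :: "('k::field variety, int) mpoly set" where
  "lefschetz = K0_class (affine_variety 1 {})"

lemma cring_K0: "cring (K0 :: ('k::field variety, int) mpoly set ring)"
proof -
  interpret R: cring "ring_of_type_algebra :: ('k variety, int) mpoly ring"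
    by (rule cring_from_type_algebra)
  show ?thesis
    unfolding K0_def
    by (intro ideal.quotient_is_cring R.genideal_ideal R.is_cring)
       (auto simp: ring_of_type_algebra_def)
qed

lemma K0_class_closed: "K0_class X \<in> carrier K0"
  unfolding K0_class_def K0_def FactRing_def
  by (auto simp: A_RCOSETS_def' ring_of_type_algebra_def)


section \<open>Graphs\<close>

text \<open>
  The set \<open>ends G e\<close> of endpoints of an edge has two elements, or one if \<open>e\<close> is a self-loop.
\<close>

record ('v, 'e) multigraph =
  verts :: "'v set"
  edges :: "'e set"
  ends :: "'e \<Rightarrow> 'v set"

definition finite_multigraph :: "('v, 'e) multigraph \<Rightarrow> bool" where
  "finite_multigraph G \<longleftrightarrow> finite (verts G) \<and> finite (edges G) \<and>
     (\<forall>e\<in>edges G. ends G e \<subseteq> verts G \<and> card (ends G e) \<in> {1, 2})"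

inductive walk :: "('v, 'e) multigraph \<Rightarrow> 'e set \<Rightarrow> 'v \<Rightarrow> 'e list \<Rightarrow> 'v \<Rightarrow> bool"
  for G F where
  Nil: "u \<in> verts G \<Longrightarrow> walk G F u [] u"
| Cons: "e \<in> F \<Longrightarrow> ends G e = {u, v} \<Longrightarrow> walk G F v es w \<Longrightarrow> walk G F u (e # es) w"

definition connected_by :: "('v, 'e) multigraph \<Rightarrow> 'e set \<Rightarrow> bool" where
  "connected_by G F \<longleftrightarrow> verts G \<noteq> {} \<and> (\<forall>u\<in>verts G. \<forall>v\<in>verts G. \<exists>es. walk G F u es v)"

definition connected_graph :: "('v, 'e) multigraph \<Rightarrow> bool" where
  "connected_graph G \<longleftrightarrow> connected_by G (edges G)"

definition acyclic_edges :: "('v, 'e) multigraph \<Rightarrow> 'e set \<Rightarrow> bool" where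
  "acyclic_edges G F \<longleftrightarrow> \<not> (\<exists>u es. es \<noteq> [] \<and> distinct es \<and> walk G F u es u)"

definition spanning_tree :: "('v, 'e) multigraph \<Rightarrow> 'e set \<Rightarrow> bool" where
  "spanning_tree G T \<longleftrightarrow> T \<subseteq> edges G \<and> connected_by G T \<and> acyclic_edges G T"

definition graph_poly :: "('v, 'e) multigraph \<Rightarrow> ('e, int) mpoly" where
  "graph_poly G = (\<Sum>T | spanning_tree G T. \<Prod>e\<in>edges G - T. mvar e)"

text \<open>
  The bijection \<open>idx\<close> from the edges of \<open>G\<close> onto \<open>{0, \<dots>, N - 1}\<close> says which coordinate of affine
  \<open>N\<close>-space belongs to which edge.
\<close>

definition graph_hypersurface :: "('e \<Rightarrow> nat) \<Rightarrow> ('v, 'e) multigraph \<Rightarrow> 'k::field variety" where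
  "graph_hypersurface idx G =
     affine_variety (card (edges G)) {mpoly_eval of_int (\<lambda>e. mvar (idx e)) (graph_poly G)}"

definition vertex_width_le :: "('v, 'e) multigraph \<Rightarrow> nat \<Rightarrow> bool" where
  "vertex_width_le G n \<longleftrightarrow> (\<exists>es. distinct es \<and> set es = edges G \<and>
     (\<forall>i\<le>length es. card ((\<Union>e\<in>set (take i es). ends G e) \<inter> (\<Union>e\<in>set (drop i es). ends G e)) \<le> n))"

end

theory Submission imports Defs
begin

text \<open>
  Add the edges of a width-three ordering one at a time, starting from the last one. The subgraph
  \<open>H\<close> formed by the edges present at some stage meets the remaining edges in at most three vertices,
  so the rest of the computation of \<open>\<Psi>\<^sub>G\<close> sees \<open>H\<close> only through the graph polynomials of the five
  graphs obtained by identifying three marked vertices of \<open>H\<close> in all possible ways. These are linear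
  combinations of five forest polynomials \<open>f\<^sub>0, \<dots>, f\<^sub>4\<close>, the \<^emph>\<open>state\<close> of \<open>H\<close>, which satisfy
  \<open>f\<^sub>0 f\<^sub>4 = f\<^sub>1 f\<^sub>2 + f\<^sub>1 f\<^sub>3 + f\<^sub>2 f\<^sub>3\<close>. The projective quadric with this equation is the
  Grassmannian of Lagrangian planes in a symplectic space of dimension four: a state \<open>f\<close> is encoded
  by an alternating form \<open>om f\<close>, and the Lagrangian plane is its radical.

  In these terms a new edge with variable \<open>\<alpha>\<close> acts very simply. Up to permutations of the marked
  vertices, the new form is \<open>\<alpha> \<omega> + N \<omega>\<close> (the edge joins two marked vertices) or \<open>\<omega> + \<alpha> N \<omega>\<close> (the
  edge leads from a marked vertex to a new one that takes its place), where \<open>N\<close> is the action on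
  alternating forms of an infinitesimal symplectic transvection \<open>x \<mapsto> sp v x \<cdot> v\<close>; or it is \<open>\<alpha> \<omega>\<close> (a
  self-loop) or \<open>\<omega>\<close> (a bridge). When a vertex ceases to be on the boundary, \<open>\<omega>\<close> is replaced by
  \<open>N \<omega>\<close>.

  Consider the closed conditions on a state that its form vanishes on a given pair of vectors, that
  the radical contains a given vector, that it contains a given Lagrangian plane, or that the form
  is zero. Imposing one of them on a pencil gives a system of linear equations in \<open>\<alpha>\<close>, whose
  solutions are a line, a point or empty. The key fact is that the set of parameters with exactly
  one solution and the set of parameters where every \<open>\<alpha>\<close> is a solution are integer combinations of
  loci of conditions of the same four kinds (\<open>pencil_pieces\<close>). Integrating over \<open>\<alpha>\<close> multiplies the
  second contribution by the class \<open>L\<close> of the affine line and the first one by 1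
  (\<open>poly_int_linear_system\<close>), so by induction all these loci have classes that are polynomials in
  \<open>L\<close>. At the end, \<open>\<Psi>\<^sub>G = 0\<close> is a condition of the first kind (\<open>poly_int_psi\<close>).

  Two further ingredients are needed. Integer combinations of loci are handled as integrals of
  constructible functions; the integral is well defined because the scissors relation allows one to
  cut along one equation after the other (\<open>cls_combination_eq_0\<close>). And the recursion by deletion and
  contraction has to be compared with the sum over spanning trees, which is the correctness of
  Kruskal's algorithm (\<open>psi_eq_sum_spanning_trees\<close>).
\<close>

section \<open>Polynomial and rational functions on subsets of affine space\<close>

definition polyfun :: "nat \<Rightarrow> ('k::field alg_closure list \<Rightarrow> 'k alg_closure) \<Rightarrow> bool" where
  "polyfun n \<phi> \<longleftrightarrow> (\<exists>p :: (nat, 'k) mpoly. \<forall>x. length x = n \<longrightarrow> \<phi> x = peval p x)"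

lemma polyfun_cong: "(\<And>x. length x = n \<Longrightarrow> \<phi> x = \<psi> x) \<Longrightarrow> polyfun n \<phi> \<longleftrightarrow> polyfun n \<psi>"
  unfolding polyfun_def by simp

lemma polyfun_peval: "polyfun n (peval p)"
  unfolding polyfun_def by blast

lemma polyfun_const: "polyfun n (\<lambda>_. to_ac c)"
  unfolding polyfun_def by (rule exI[of _ "Poly_Mapping.single 0 c"]) simp

lemma polyfun_0: "polyfun n (\<lambda>_. 0)" and polyfun_1: "polyfun n (\<lambda>_. 1)"
  using polyfun_const[of n 0] polyfun_const[of n 1] by simp_all

lemma polyfun_coord: "polyfun n (\<lambda>x. nth_default 0 x i)"
  unfolding polyfun_def by (rule exI[of _ "mvar i"]) simp

lemma polyfun_nth: "i < n \<Longrightarrow> polyfun n (\<lambda>x. x ! i)"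
  using polyfun_coord[of n i] by (rule iffD1[OF polyfun_cong, rotated]) (simp add: nth_default_nth)

lemma polyfun_add: "polyfun n \<phi> \<Longrightarrow> polyfun n \<psi> \<Longrightarrow> polyfun n (\<lambda>x. \<phi> x + \<psi> x)"
  unfolding polyfun_def by (metis peval_add)

lemma polyfun_mult: "polyfun n \<phi> \<Longrightarrow> polyfun n \<psi> \<Longrightarrow> polyfun n (\<lambda>x. \<phi> x * \<psi> x)"
  unfolding polyfun_def by (metis peval_mult)

lemma polyfun_diff: "polyfun n \<phi> \<Longrightarrow> polyfun n \<psi> \<Longrightarrow> polyfun n (\<lambda>x. \<phi> x - \<psi> x)"
  unfolding polyfun_def by (metis peval_diff)

lemma polyfun_uminus: "polyfun n \<phi> \<Longrightarrow> polyfun n (\<lambda>x. - \<phi> x)"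
  unfolding polyfun_def by (metis peval_uminus)

lemma polyfun_sum: "(\<And>i. i \<in> A \<Longrightarrow> polyfun n (\<phi> i)) \<Longrightarrow> polyfun n (\<lambda>x. \<Sum>i\<in>A. \<phi> i x)"
  by (induction A rule: infinite_finite_induct) (auto intro: polyfun_0 polyfun_add)

lemma polyfun_prod: "(\<And>i. i \<in> A \<Longrightarrow> polyfun n (\<phi> i)) \<Longrightarrow> polyfun n (\<lambda>x. \<Prod>i\<in>A. \<phi> i x)"
  by (induction A rule: infinite_finite_induct) (auto intro: polyfun_1 polyfun_mult)

lemma polyfun_power: "polyfun n \<phi> \<Longrightarrow> polyfun n (\<lambda>x. \<phi> x ^ m)"
  by (induction m) (auto intro: polyfun_1 polyfun_mult)

lemma polyfun_mpoly_eval: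
  assumes "\<And>i. polyfun n (\<lambda>x. f x i)"
  shows "polyfun n (\<lambda>x. mpoly_eval to_ac (f x) p)"
  unfolding mpoly_eval_def mono_eval_def
  by (intro polyfun_sum polyfun_mult polyfun_const polyfun_prod polyfun_power assms)

lemma polyfun_compose:
  assumes p: "polyfun m \<phi>" and h: "\<And>i. i < m \<Longrightarrow> polyfun n (\<lambda>x. nth_default 0 (h x) i)"
    and len: "\<And>x. length x = n \<Longrightarrow> length (h x) = m"
  shows "polyfun n (\<lambda>x. \<phi> (h x))"
proof -
  obtain p where p: "length x = m \<Longrightarrow> \<phi> x = peval p x" for x
    using p unfolding polyfun_def by blast
  have "polyfun n (\<lambda>x. nth_default 0 (h x) i)" for i
  proof (cases "i < m")
    case False
    show ?thesis
      by (rule iffD2[OF polyfun_cong polyfun_0]) (use False len in \<open>auto simp: nth_default_def\<close>)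
  qed (use h in auto)
  then have "polyfun n (\<lambda>x. mpoly_eval to_ac (nth_default 0 (h x)) p)"
    by (rule polyfun_mpoly_eval)
  then show ?thesis
    by (rule iffD1[OF polyfun_cong, rotated]) (simp add: p len peval_def)
qed

lemma polyfun_butlast: "polyfun n \<phi> \<Longrightarrow> polyfun (Suc n) (\<lambda>x. \<phi> (butlast x))"
proof (erule polyfun_compose)
  show "polyfun (Suc n) (\<lambda>x. nth_default 0 (butlast x) i)" if "i < n" for i
    by (rule iffD1[OF polyfun_cong polyfun_coord[of _ i]])
       (use that in \<open>auto simp: nth_default_def nth_butlast\<close>)
qed auto

lemma polyfun_last: "polyfun (Suc n) last"
  by (rule iffD1[OF polyfun_cong polyfun_nth[of n]]) (metis Zero_not_Suc diff_Suc_1 last_conv_nth list.size(3), simp)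

text \<open>
  Not only closed sets \<open>Y\<close> occur: for a principal open subset this is the open subvariety.
\<close>

definition aff :: "nat \<Rightarrow> 'k::field alg_closure list set \<Rightarrow> 'k kspace" where
  "aff n Y = subsp (affine_space n) Y"

lemma affine_set_eq_aff: "affine_set n S = aff n (zero_locus n S)"
  by (simp add: affine_set_def aff_def)

lemma zar_aff [simp]: "zar (aff n Y) = subtopology (zariski n) Y"
  by (simp add: aff_def)

lemma points_aff: "Y \<subseteq> {x. length x = n} \<Longrightarrow> points (aff n Y) = Y"
  by auto

lemma is_sheaf_aff: "is_sheaf (aff n Y)"
  unfolding aff_def by (rule is_sheaf_subsp[OF is_sheaf_affine_space])

text \<open>
  Sections on a subspace are locally restrictions of sections on open sets of affine space, which in
  turn are locally quotients. This predicate contracts the two stages into one.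
\<close>

definition rational_at ::
  "nat \<Rightarrow> 'k::field alg_closure list set \<Rightarrow> 'k alg_closure list \<Rightarrow> ('k alg_closure list \<Rightarrow> 'k alg_closure) \<Rightarrow> bool" where
  "rational_at n Y x f \<longleftrightarrow> (\<exists>W (p :: (nat, 'k) mpoly) q. openin (zariski n) W \<and> x \<in> W \<and>
     (\<forall>y\<in>W \<inter> Y. peval q y \<noteq> 0 \<and> f y = peval p y / peval q y))"

lemma rational_at_polyfun:
  assumes "polyfun n f" "length x = n"
  shows "rational_at n Y x f"
proof -
  obtain p where p: "length x = n \<Longrightarrow> f x = peval p x" for x
    using assms unfolding polyfun_def by blast
  have "openin (zariski n) {x :: 'a alg_closure list. length x = n}"
    by (metis openin_topspace topspace_zariski)
  then show ?thesis unfolding rational_at_def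
    by (intro exI[of _ "{x. length x = n}"] exI[of _ p] exI[of _ 1]) (use p assms in auto)
qed

lemma rational_at_binop:
  assumes f: "rational_at n Y x f" and g: "rational_at n Y x g"
    and h: "\<And>p q p' q' :: (nat, 'k::field) mpoly. \<exists>r s. \<forall>y. peval q y \<noteq> 0 \<and> peval q' y \<noteq> 0 \<longrightarrow>
       peval s y \<noteq> 0 \<and> H (peval p y / peval q y) (peval p' y / peval q' y) = peval r y / peval s y"
  shows "rational_at n Y x (\<lambda>y. H (f y) (g y))"
proof -
  from f obtain W and p q :: "(nat, 'k) mpoly" where 1: "openin (zariski n) W" "x \<in> W"
     "\<forall>y\<in>W \<inter> Y. peval q y \<noteq> 0 \<and> f y = peval p y / peval q y"
    unfolding rational_at_def by (elim exE conjE)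
  from g obtain W' and p' q' :: "(nat, 'k) mpoly" where 2: "openin (zariski n) W'" "x \<in> W'"
     "\<forall>y\<in>W' \<inter> Y. peval q' y \<noteq> 0 \<and> g y = peval p' y / peval q' y"
    unfolding rational_at_def by (elim exE conjE)
  obtain r s where rs: "\<forall>y. peval q y \<noteq> 0 \<and> peval q' y \<noteq> 0 \<longrightarrow>
       peval s y \<noteq> 0 \<and> H (peval p y / peval q y) (peval p' y / peval q' y) = peval r y / peval s y"
    using h[of q q' p p'] by blast
  show ?thesis unfolding rational_at_def
    by (rule exI[of _ "W \<inter> W'"], rule exI[of _ r], rule exI[of _ s]) (use 1 2 rs in auto)
qed

lemma rational_at_add: "rational_at n Y x f \<Longrightarrow> rational_at n Y x g \<Longrightarrow> rational_at n Y x (\<lambda>y. f y + g y)"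
proof (erule rational_at_binop, assumption)
  fix p q p' q' :: "(nat, 'a) mpoly"
  show "\<exists>r s. \<forall>y. peval q y \<noteq> 0 \<and> peval q' y \<noteq> 0 \<longrightarrow> peval s y \<noteq> 0 \<and>
           peval p y / peval q y + peval p' y / peval q' y = peval r y / peval s y"
    by (rule exI[of _ "p * q' + p' * q"], rule exI[of _ "q * q'"]) (simp add: add_frac_eq)
qed

lemma rational_at_mult: "rational_at n Y x f \<Longrightarrow> rational_at n Y x g \<Longrightarrow> rational_at n Y x (\<lambda>y. f y * g y)"
proof (erule rational_at_binop, assumption)
  fix p q p' q' :: "(nat, 'a) mpoly"
  show "\<exists>r s. \<forall>y. peval q y \<noteq> 0 \<and> peval q' y \<noteq> 0 \<longrightarrow> peval s y \<noteq> 0 \<and>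
           peval p y / peval q y * (peval p' y / peval q' y) = peval r y / peval s y"
    by (rule exI[of _ "p * p'"], rule exI[of _ "q * q'"]) simp
qed

lemma rational_at_const: "length x = n \<Longrightarrow> rational_at n Y x (\<lambda>_. to_ac c)"
  by (rule rational_at_polyfun[OF polyfun_const])

lemma rational_at_0: "length x = n \<Longrightarrow> rational_at n Y x (\<lambda>_. 0)"
  by (rule rational_at_polyfun[OF polyfun_0])

lemma rational_at_1: "length x = n \<Longrightarrow> rational_at n Y x (\<lambda>_. 1)"
  by (rule rational_at_polyfun[OF polyfun_1])

lemma rational_at_inverse:
  fixes f :: "'k::field alg_closure list \<Rightarrow> 'k alg_closure"
  assumes f: "rational_at n Y x f" and nz: "f x \<noteq> 0" and x: "x \<in> Y" "length x = n"
  shows "rational_at n Y x (\<lambda>y. inverse (f y))"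
proof -
  from f obtain W and p q :: "(nat, 'k) mpoly" where 1: "openin (zariski n) W" "x \<in> W"
     "\<forall>y\<in>W \<inter> Y. peval q y \<noteq> 0 \<and> f y = peval p y / peval q y"
    unfolding rational_at_def by (elim exE conjE)
  have "openin (zariski n) (W \<inter> {y. length y = n \<and> peval p y \<noteq> 0})"
    by (intro openin_Int 1 openin_peval)
  moreover have "peval p x \<noteq> 0"
    using 1 x nz by auto
  ultimately show ?thesis unfolding rational_at_def
    by (intro exI[of _ "W \<inter> {y. length y = n \<and> peval p y \<noteq> 0}"] exI[of _ q] exI[of _ p])
       (use 1 x in auto)
qed

lemma rational_at_sum:
  assumes "length x = n" "\<And>i. i \<in> A \<Longrightarrow> rational_at n Y x (f i)"
  shows "rational_at n Y x (\<lambda>y. \<Sum>i\<in>A. f i y)"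
  using assms(2) by (induction A rule: infinite_finite_induct)
    (auto intro: rational_at_0[OF assms(1)] rational_at_add)

lemma rational_at_prod:
  assumes "length x = n" "\<And>i. i \<in> A \<Longrightarrow> rational_at n Y x (f i)"
  shows "rational_at n Y x (\<lambda>y. \<Prod>i\<in>A. f i y)"
  using assms(2) by (induction A rule: infinite_finite_induct)
    (auto intro: rational_at_1[OF assms(1)] rational_at_mult)

lemma rational_at_power:
  assumes "length x = n" "rational_at n Y x f"
  shows "rational_at n Y x (\<lambda>y. f y ^ m)"
  by (induction m) (auto intro: assms rational_at_1 rational_at_mult)

lemma rational_at_peval_compose:
  assumes len: "length x = n" and h: "\<And>i. rational_at n Y x (\<lambda>y. nth_default 0 (h y) i)"
  shows "rational_at n Y x (\<lambda>y. peval p (h y))"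
  unfolding peval_def mpoly_eval_def mono_eval_def
  by (intro rational_at_sum rational_at_prod rational_at_mult rational_at_const rational_at_power len h)

lemma rational_at_cong:
  assumes "openin (zariski n) W" "x \<in> W" "\<And>y. y \<in> W \<inter> Y \<Longrightarrow> f y = g y" "rational_at n Y x f"
  shows "rational_at n Y x g"
proof -
  from assms(4) obtain V and p q :: "(nat, 'a) mpoly" where 1: "openin (zariski n) V" "x \<in> V"
     "\<forall>y\<in>V \<inter> Y. peval q y \<noteq> 0 \<and> f y = peval p y / peval q y"
    unfolding rational_at_def by (elim exE conjE)
  show ?thesis unfolding rational_at_def
    by (rule exI[of _ "V \<inter> W"], rule exI[of _ p], rule exI[of _ q])
      (use 1 assms(1,2) assms(3)[symmetric] in auto)
qed

lemma regular_aff_iff: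
  assumes Y: "Y \<subseteq> {x. length x = n}" and U: "openin (subtopology (zariski n) Y) U"
  shows "f \<in> regular (aff n Y :: 'k::field kspace) U \<longleftrightarrow> (\<forall>x\<in>U. rational_at n Y x f)"
proof
  assume f: "f \<in> regular (aff n Y) U"
  show "\<forall>x\<in>U. rational_at n Y x f"
  proof
    fix x assume "x \<in> U"
    from f[unfolded aff_def regular_subsp_iff zar_affine_space, rule_format, OF this]
    obtain W g where W: "openin (zariski n) W" "x \<in> W" "g \<in> regular (affine_space n) W"
      "\<forall>y\<in>W \<inter> Y. f y = g y"
      by blast
    from W(3)[unfolded regular_affine_space_iff, rule_format, OF W(2)]
    obtain W' and p q :: "(nat, 'k) mpoly" where W': "openin (zariski n) W'" "x \<in> W'" "W' \<subseteq> W"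
        "\<forall>y\<in>W'. peval q y \<noteq> 0 \<and> g y = peval p y / peval q y"
      by blast
    show "rational_at n Y x f" unfolding rational_at_def
      by (rule exI[of _ W'], rule exI[of _ p], rule exI[of _ q]) (use W W' in auto)
  qed
next
  assume f: "\<forall>x\<in>U. rational_at n Y x f"
  obtain V where V: "openin (zariski n) V" "U = V \<inter> Y"
    using U unfolding openin_subtopology by blast
  show "f \<in> regular (aff n Y) U"
    unfolding aff_def regular_subsp_iff zar_affine_space
  proof
    fix x assume x: "x \<in> U"
    from bspec[OF f x] obtain W and p q :: "(nat, 'k) mpoly" where 1: "openin (zariski n) W" "x \<in> W"
      "\<forall>y\<in>W \<inter> Y. peval q y \<noteq> 0 \<and> f y = peval p y / peval q y"
      unfolding rational_at_def by (elim exE conjE)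
    let ?W = "W \<inter> V \<inter> {y. length y = n \<and> peval q y \<noteq> 0}"
    have op: "openin (zariski n) ?W"
      by (intro openin_Int 1 V openin_peval)
    have "(\<lambda>y. peval p y / peval q y) \<in> regular (affine_space n) ?W"
      unfolding regular_affine_space_iff
      by (intro ballI exI[of _ ?W] exI[of _ p] exI[of _ q]) (use op in auto)
    then show "\<exists>W g. openin (zariski n) W \<and> x \<in> W \<and> W \<inter> Y \<subseteq> U \<and>
        g \<in> regular (affine_space n) W \<and> (\<forall>y\<in>W \<inter> Y. f y = g y)"
      by (intro exI[of _ ?W] exI[of _ "\<lambda>y. peval p y / peval q y"]) (use op V Y x 1 in auto)
  qed
qed

lemma openin_aff_iff:
  assumes Y: "Y \<subseteq> {x. length x = n}"
  shows "openin (subtopology (zariski n) Y) U \<longleftrightarrow>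
    U \<subseteq> Y \<and> (\<forall>x\<in>U. \<exists>W. openin (zariski n) W \<and> x \<in> W \<and> W \<inter> Y \<subseteq> U)" (is "?L \<longleftrightarrow> ?R")
proof
  assume ?L then show ?R unfolding openin_subtopology by blast
next
  assume R: ?R
  show ?L
  proof (subst openin_subopen, intro ballI)
    fix x assume "x \<in> U"
    then obtain W where "openin (zariski n) W \<and> x \<in> W \<and> W \<inter> Y \<subseteq> U" using R by blast
    then show "\<exists>T. openin (subtopology (zariski n) Y) T \<and> x \<in> T \<and> T \<subseteq> U"
      using R \<open>x \<in> U\<close> by (intro exI[of _ "W \<inter> Y"]) (auto simp: openin_subtopology)
  qed
qed

text \<open>
  A polynomial in locally rational functions is locally rational, and the quotient \<open>r / s\<close> that
  represents it vanishes only where \<open>r\<close> does. This gives continuity; regular functions pull back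
  because quotients of rational functions are rational.
\<close>

lemma morphism_rational:
  fixes h :: "'k::field alg_closure list \<Rightarrow> 'k alg_closure list"
  assumes Y: "Y \<subseteq> {x. length x = n}" and Y': "Y' \<subseteq> {x. length x = m}"
    and hY: "\<And>x. x \<in> Y \<Longrightarrow> h x \<in> Y'"
    and rat: "\<And>x i. x \<in> Y \<Longrightarrow> i < m \<Longrightarrow> rational_at n Y x (\<lambda>x. nth_default 0 (h x) i)"
  shows "morphism (aff n Y) (aff m Y') h"
proof -
  have len: "length (h x) = m" if "x \<in> Y" for x using hY[OF that] Y' by auto
  have lenx: "length x = n" if "x \<in> Y" for x using that Y by auto
  have tsn: "openin (zariski n) {x :: 'k alg_closure list. length x = n}"
    by (metis openin_topspace topspace_zariski)
  have rat': "rational_at n Y x (\<lambda>x. nth_default 0 (h x) i)" if x: "x \<in> Y" for x i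
  proof (cases "i < m")
    case False
    show ?thesis
      by (rule rational_at_cong[OF tsn _ _ rational_at_0[of x n Y]])
         (use False len lenx x in \<open>auto simp: nth_default_def\<close>)
  qed (use rat x in auto)
  have ratp: "rational_at n Y x (\<lambda>y. peval p (h y))" if "x \<in> Y" for x and p :: "(nat, 'k) mpoly"
    by (rule rational_at_peval_compose[OF lenx[OF that] rat'[OF that]])
  have ts: "topspace (subtopology (zariski n) Y) = Y" "topspace (subtopology (zariski m) Y') = Y'"
    using Y Y' by auto
  have pre: "\<exists>W. openin (zariski n) W \<and> x \<in> W \<and> (\<forall>y\<in>W \<inter> Y. h y \<in> V)"
    if V: "openin (zariski m) V" and x: "x \<in> Y" "h x \<in> V" for V x
  proof -
    obtain S :: "(nat, 'k) mpoly set" where S: "V = {x. length x = m} - zero_locus m S"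
      using V openin_zariski by blast
    obtain p where p: "p \<in> S" "peval p (h x) \<noteq> 0"
      using x S by (auto simp: zero_locus_def)
    obtain W and r s :: "(nat, 'k) mpoly" where 1: "openin (zariski n) W" "x \<in> W"
      "\<forall>y\<in>W \<inter> Y. peval s y \<noteq> 0 \<and> peval p (h y) = peval r y / peval s y"
      using ratp[OF x(1), of p] unfolding rational_at_def by (elim exE conjE)
    show ?thesis
    proof (intro exI conjI ballI)
      show "openin (zariski n) (W \<inter> {y. length y = n \<and> peval r y \<noteq> 0})"
        by (intro openin_Int 1 openin_peval)
      show "x \<in> W \<inter> {y. length y = n \<and> peval r y \<noteq> 0}"
        using 1(2) 1(3)[rule_format, of x] p x(1) lenx[OF x(1)] by auto
      fix y assume y: "y \<in> W \<inter> {y. length y = n \<and> peval r y \<noteq> 0} \<inter> Y"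
      then have "peval p (h y) \<noteq> 0" using 1(3)[rule_format, of y] by auto
      then show "h y \<in> V" using p(1) len[of y] y unfolding S zero_locus_def by blast
    qed
  qed
  have op: "openin (subtopology (zariski n) Y) {x \<in> Y. h x \<in> U}"
    if U: "openin (subtopology (zariski m) Y') U" for U
  proof -
    obtain V where V: "openin (zariski m) V" "U = V \<inter> Y'" using U openin_subtopology by metis
    show ?thesis unfolding openin_aff_iff[OF Y]
    proof (intro conjI ballI)
      fix x assume "x \<in> {x \<in> Y. h x \<in> U}"
      then obtain W where "openin (zariski n) W" "x \<in> W" "\<forall>y\<in>W \<inter> Y. h y \<in> V"
        using pre[OF V(1), of x] V(2) by auto
      then show "\<exists>W. openin (zariski n) W \<and> x \<in> W \<and> W \<inter> Y \<subseteq> {x \<in> Y. h x \<in> U}"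
        by (intro exI[of _ W]) (use V(2) hY in auto)
    qed auto
  qed
  show ?thesis
    unfolding morphism_def zar_aff ts
  proof (intro conjI allI impI)
    show "continuous_map (subtopology (zariski n) Y) (subtopology (zariski m) Y') h"
      unfolding continuous_map ts using op hY by auto
  next
    fix U f assume "openin (subtopology (zariski m) Y') U \<and> f \<in> regular (aff m Y') U"
    then have U: "openin (subtopology (zariski m) Y') U" and f: "f \<in> regular (aff m Y') U" by auto
    have f: "\<forall>x\<in>U. rational_at m Y' x f"
      using f regular_aff_iff[OF Y' U] by blast
    show "f \<circ> h \<in> regular (aff n Y) {x \<in> Y. h x \<in> U}"
      unfolding regular_aff_iff[OF Y op[OF U]]
    proof
      fix x assume x: "x \<in> {x \<in> Y. h x \<in> U}"
      then have "rational_at m Y' (h x) f" using f by simp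
      then obtain W and p q :: "(nat, 'k) mpoly" where W: "openin (zariski m) W" "h x \<in> W"
        "\<forall>y\<in>W \<inter> Y'. peval q y \<noteq> 0 \<and> f y = peval p y / peval q y"
        unfolding rational_at_def by (elim exE conjE)
      obtain V where V: "openin (zariski n) V" "x \<in> V" "\<forall>y\<in>V \<inter> Y. h y \<in> W"
        using pre[OF W(1), of x] x W(2) by auto
      have "rational_at n Y x (\<lambda>y. peval p (h y) * inverse (peval q (h y)))"
        using x W hY lenx by (intro rational_at_mult rational_at_inverse ratp) auto
      then show "rational_at n Y x (f \<circ> h)"
        by (rule rational_at_cong[OF V(1,2), rotated])
           (use V W hY in \<open>auto simp: divide_inverse\<close>)
    qed
  qed
qed

section \<open>Morphisms between subsets of affine space\<close>

lemma morphism_points: "morphism X Y \<phi> \<Longrightarrow> x \<in> points X \<Longrightarrow> \<phi> x \<in> points Y"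
  unfolding morphism_def continuous_map by auto

lemma morphismD:
  assumes "morphism X Y \<phi>" "openin (zar Y) V"
  shows "openin (zar X) {x \<in> points X. \<phi> x \<in> V}"
    and "f \<in> regular Y V \<Longrightarrow> f \<circ> \<phi> \<in> regular X {x \<in> points X. \<phi> x \<in> V}"
  using assms unfolding morphism_def continuous_map by blast+

lemma morphismI:
  assumes "\<And>x. x \<in> points X \<Longrightarrow> \<phi> x \<in> points Y"
    and "\<And>V. openin (zar Y) V \<Longrightarrow> openin (zar X) {x \<in> points X. \<phi> x \<in> V}"
    and "\<And>V f. openin (zar Y) V \<Longrightarrow> f \<in> regular Y V \<Longrightarrow> f \<circ> \<phi> \<in> regular X {x \<in> points X. \<phi> x \<in> V}"
  shows "morphism X Y \<phi>"
  using assms unfolding morphism_def continuous_map by blast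

lemma morphism_compose:
  assumes \<phi>: "morphism X Y \<phi>" and \<psi>: "morphism Y Z \<psi>"
  shows "morphism X Z (\<lambda>x. \<psi> (\<phi> x))"
proof (rule morphismI)
  fix x assume "x \<in> points X"
  then show "\<psi> (\<phi> x) \<in> points Z" by (intro morphism_points[OF \<psi>] morphism_points[OF \<phi>])
next
  fix V f assume V: "openin (zar Z) V"
  let ?W = "{y \<in> points Y. \<psi> y \<in> V}"
  have eq: "{x \<in> points X. \<phi> x \<in> ?W} = {x \<in> points X. \<psi> (\<phi> x) \<in> V}"
    using morphism_points[OF \<phi>] by blast
  note W = morphismD[OF \<phi> morphismD(1)[OF \<psi> V], unfolded eq]
  show "openin (zar X) {x \<in> points X. \<psi> (\<phi> x) \<in> V}" by (rule W(1))
  show "f \<circ> (\<lambda>x. \<psi> (\<phi> x)) \<in> regular X {x \<in> points X. \<psi> (\<phi> x) \<in> V}" if "f \<in> regular Z V"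
    using W(2)[OF morphismD(2)[OF \<psi> V that]] unfolding o_def .
qed

lemma regular_cong:
  assumes X: "is_sheaf X" and U: "openin (zar X) U" and eq: "\<And>x. x \<in> U \<Longrightarrow> f x = g x"
    and g: "g \<in> regular X U"
  shows "f \<in> regular X U"
  using X[unfolded is_sheaf_def, THEN conjunct2, rule_format, OF U, of f] U eq g by blast

lemma morphism_cong:
  assumes X: "is_sheaf X" and eq: "\<And>x. x \<in> points X \<Longrightarrow> \<phi> x = \<psi> x" and \<psi>: "morphism X Y \<psi>"
  shows "morphism X Y \<phi>"
  unfolding morphism_def
proof (intro conjI allI impI)
  show "continuous_map (zar X) (zar Y) \<phi>"
    using continuous_map_eq[of "zar X" "zar Y" \<psi> \<phi>] \<psi> eq unfolding morphism_def by auto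
next
  fix V f assume V: "openin (zar Y) V \<and> f \<in> regular Y V"
  have *: "{x \<in> points X. \<phi> x \<in> V} = {x \<in> points X. \<psi> x \<in> V}" using eq by auto
  have "f \<circ> \<psi> \<in> regular X {x \<in> points X. \<psi> x \<in> V}" "openin (zar X) {x \<in> points X. \<psi> x \<in> V}"
    using \<psi> V unfolding morphism_def continuous_map by blast+
  then show "f \<circ> \<phi> \<in> regular X {x \<in> points X. \<phi> x \<in> V}"
    unfolding * by (intro regular_cong[OF X, of _ "f \<circ> \<phi>" "f \<circ> \<psi>"]) (auto simp: eq)
qed

lemma isomorphic_trans:
  assumes "isomorphic X Y" "isomorphic Y Z"
  shows "isomorphic X Z"
proof -
  obtain \<phi> \<psi> where 1: "morphism X Y \<phi>" "morphism Y X \<psi>" "\<forall>x\<in>points X. \<psi> (\<phi> x) = x" "\<forall>y\<in>points Y. \<phi> (\<psi> y) = y"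
    using assms(1) unfolding isomorphic_def by blast
  obtain \<alpha> \<beta> where 2: "morphism Y Z \<alpha>" "morphism Z Y \<beta>" "\<forall>x\<in>points Y. \<beta> (\<alpha> x) = x" "\<forall>y\<in>points Z. \<alpha> (\<beta> y) = y"
    using assms(2) unfolding isomorphic_def by blast
  show ?thesis unfolding isomorphic_def
    by (rule exI[of _ "\<lambda>x. \<alpha> (\<phi> x)"], rule exI[of _ "\<lambda>z. \<psi> (\<beta> z)"])
       (use 1 2 morphism_points[OF 1(1)] morphism_points[OF 2(2)] in
         \<open>auto intro: morphism_compose[OF 1(1) 2(1)] morphism_compose[OF 2(2) 1(2)]\<close>)
qed

text \<open>
  The scissors relation speaks about a closed subspace and its complement as varieties. Both will be
  isomorphic to closed subsets of affine spaces, and separatedness is inherited by composition with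
  the isomorphism.
\<close>

lemma is_variety_of_isomorphic_affine:
  fixes X :: "'k::field kspace"
  assumes X: "is_sheaf X" and iso: "isomorphic X (affine_set n S)"
  shows "is_variety X"
proof -
  have "is_prevariety X"
    unfolding is_prevariety_def
  proof (intro conjI exI[of _ "{points X}"] ballI)
    fix U assume "U \<in> {points X}"
    then show "openin (zar X) U" "\<exists>n S. isomorphic (subsp X U) (affine_set n S)"
      using isomorphic_trans[OF isomorphic_subsp_topspace[OF X] iso] by auto
  qed (use X in auto)
  moreover have "is_separated X"
    unfolding is_separated_def
  proof (intro allI impI)
    fix m and T :: "(nat, 'k) mpoly set" and \<phi> \<psi>
    assume *: "morphism (affine_set m T) X \<phi> \<and> morphism (affine_set m T) X \<psi>"
    obtain \<alpha> \<beta> where 1: "morphism X (affine_set n S) \<alpha>" "\<forall>x\<in>points X. \<beta> (\<alpha> x) = x"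
      using iso unfolding isomorphic_def by blast
    have "closedin (zar (affine_set m T)) {z \<in> points (affine_set m T). \<alpha> (\<phi> z) = \<alpha> (\<psi> z)}"
      using is_separated_affine_set[of n S, unfolded is_separated_def, rule_format, of m T]
        morphism_compose[OF _ 1(1)] * by blast
    moreover have "{z \<in> points (affine_set m T). \<alpha> (\<phi> z) = \<alpha> (\<psi> z)} = {z \<in> points (affine_set m T). \<phi> z = \<psi> z}"
      using * 1(2) morphism_points[of "affine_set m T" X] by metis
    ultimately show "closedin (zar (affine_set m T)) {z \<in> points (affine_set m T). \<phi> z = \<psi> z}"
      by (simp only:)
  qed
  ultimately show ?thesis by (simp add: is_variety_def)
qed

lemma morphism_subsp:
  assumes U: "openin (zar X) U" and X: "is_sheaf X" and h: "morphism X Y h"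
  shows "morphism (subsp X U) Y h"
proof -
  have ts: "points (subsp X U) = U" using openin_subset[OF U] by auto
  show ?thesis unfolding morphism_def ts
  proof (intro conjI allI impI)
    show "continuous_map (zar (subsp X U)) (zar Y) h"
      using h unfolding morphism_def zar_subsp by (blast intro: continuous_map_from_subtopology)
  next
    fix V f assume V: "openin (zar Y) V \<and> f \<in> regular Y V"
    then have 1: "f \<circ> h \<in> regular X {x \<in> points X. h x \<in> V}" "openin (zar X) {x \<in> points X. h x \<in> V}"
      using h unfolding morphism_def continuous_map by blast+
    show "f \<circ> h \<in> regular (subsp X U) {x \<in> U. h x \<in> V}"
      unfolding regular_subsp_iff
      by (intro ballI exI[of _ "{x \<in> points X. h x \<in> V}"] exI[of _ "f \<circ> h"])
         (use 1 openin_subset[OF U] in auto)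
  qed
qed

text \<open>
  The universal property of a product quantifies over all varieties. Their charts are affine, so
  maps out of them are built chart by chart.
\<close>

lemma morphism_glue:
  assumes X: "is_sheaf X" and cover: "\<Union>\<U> = points X" and op: "\<And>U. U \<in> \<U> \<Longrightarrow> openin (zar X) U"
    and h: "\<And>U. U \<in> \<U> \<Longrightarrow> morphism (subsp X U) Y h"
  shows "morphism X Y h"
proof -
  have ts: "points (subsp X U) = U" if "U \<in> \<U>" for U using openin_subset[OF op[OF that]] by auto
  have pre: "openin (zar X) {x \<in> U. h x \<in> V}" if U: "U \<in> \<U>" and V: "openin (zar Y) V" for U V
  proof -
    have "openin (zar (subsp X U)) {x \<in> points (subsp X U). h x \<in> V}"
      using h[OF U] V unfolding morphism_def continuous_map by blast
    then have "openin (subtopology (zar X) U) {x \<in> U. h x \<in> V}"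
      unfolding ts[OF U] unfolding zar_subsp .
    then show ?thesis using op[OF U] openin_open_subtopology by blast
  qed
  have pre': "openin (zar X) {x \<in> points X. h x \<in> V}" if V: "openin (zar Y) V" for V
  proof -
    have "{x \<in> points X. h x \<in> V} = (\<Union>U\<in>\<U>. {x \<in> U. h x \<in> V})" using cover by auto
    moreover have "openin (zar X) (\<Union>U\<in>\<U>. {x \<in> U. h x \<in> V})"
      by (rule openin_Union) (use pre[OF _ V] in blast)
    ultimately show ?thesis by (simp only:)
  qed
  show ?thesis unfolding morphism_def
  proof (intro conjI allI impI)
    have "h x \<in> points Y" if x: "x \<in> points X" for x
    proof -
      obtain U where "U \<in> \<U>" "x \<in> U" using x unfolding cover[symmetric] by blast
      then show ?thesis using morphism_points[OF h] ts by blast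
    qed
    then show "continuous_map (zar X) (zar Y) h"
      unfolding continuous_map using pre' by auto
  next
    fix V f assume V: "openin (zar Y) V \<and> f \<in> regular Y V"
    show "f \<circ> h \<in> regular X {x \<in> points X. h x \<in> V}"
    proof (rule iffD2[OF X[unfolded is_sheaf_def, THEN conjunct2, rule_format, OF pre']], use V in simp, intro ballI)
      fix x assume x: "x \<in> {x \<in> points X. h x \<in> V}"
      then obtain U where U: "U \<in> \<U>" "x \<in> U" unfolding cover[symmetric] by blast
      have "f \<circ> h \<in> regular (subsp X U) {x \<in> points (subsp X U). h x \<in> V}"
        using h[OF U(1)] V unfolding morphism_def by blast
      then have "f \<circ> h \<in> regular (subsp X U) {x \<in> U. h x \<in> V}"
        unfolding ts[OF U(1)] .
      moreover have "x \<in> {x \<in> U. h x \<in> V}" using U x by simp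
      ultimately obtain W g where W: "openin (zar X) W" "x \<in> W" "W \<inter> U \<subseteq> {x \<in> U. h x \<in> V}"
        "g \<in> regular X W" "\<forall>y\<in>W \<inter> U. (f \<circ> h) y = g y"
        unfolding regular_subsp_iff by blast
      have "g \<in> regular X (W \<inter> U)"
        by (rule is_sheafD1[OF X W(4,1)]) (use W(1) op[OF U(1)] in auto)
      then show "\<exists>W g. openin (zar X) W \<and> x \<in> W \<and> W \<subseteq> {x \<in> points X. h x \<in> V} \<and> g \<in> regular X W \<and>
          (\<forall>y\<in>W. (f \<circ> h) y = g y)"
        by (intro exI[of _ "W \<inter> U"] exI[of _ g]) (use W U op[OF U(1)] openin_subset[OF op[OF U(1)]] in auto)
    qed
  qed
qed

text \<open>
  Sections on \<open>Y\<close> extend locally to open sets of affine space, whether or not they pass through \<open>Z\<close>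
  on the way; hence the identity map is an isomorphism.
\<close>

lemma isomorphic_subsp_aff:
  fixes Y :: "'k::field alg_closure list set"
  assumes Z: "Z \<subseteq> {x. length x = n}" and Y: "Y \<subseteq> Z"
  shows "isomorphic (subsp (aff n Z) Y) (aff n Y)"
proof -
  let ?A = "affine_space n :: 'k kspace"
  have YZ: "Z \<inter> Y = Y" using Y by auto
  have zar: "zar (subsp (aff n Z) Y) = zar (aff n Y)"
    by (simp add: subtopology_subtopology YZ)
  have ts: "points (aff n Y) = Y" using Y Z by auto
  have reg: "regular (subsp (aff n Z) Y) U = regular (aff n Y) U" if U: "U \<subseteq> Y" for U
  proof (intro Set.set_eqI iffI)
    fix f assume f: "f \<in> regular (subsp (aff n Z) Y) U"
    show "f \<in> regular (aff n Y) U"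
      unfolding aff_def regular_subsp_iff
    proof
      fix x assume x: "x \<in> U"
      from f[unfolded regular_subsp_iff zar_aff, rule_format, OF x]
      obtain W g where W: "openin (subtopology (zariski n) Z) W" "x \<in> W" "W \<inter> Y \<subseteq> U"
        "g \<in> regular (aff n Z) W" "\<forall>y\<in>W \<inter> Y. f y = g y" by (elim exE conjE)
      from W(4)[unfolded aff_def regular_subsp_iff, rule_format, OF W(2)]
      obtain W' g' where W': "openin (zar ?A) W'" "x \<in> W'" "W' \<inter> Z \<subseteq> W" "g' \<in> regular ?A W'"
        "\<forall>y\<in>W' \<inter> Z. g y = g' y" by (elim exE conjE)
      show "\<exists>W g. openin (zar ?A) W \<and> x \<in> W \<and> W \<inter> Y \<subseteq> U \<and> g \<in> regular ?A W \<and> (\<forall>y\<in>W \<inter> Y. f y = g y)"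
      proof (intro exI[of _ W'] exI[of _ g'] conjI W' ballI)
        show "W' \<inter> Y \<subseteq> U" using W(3) W'(3) Y by blast
        fix y assume "y \<in> W' \<inter> Y"
        then have "y \<in> W \<inter> Y" "y \<in> W' \<inter> Z" using W'(3) Y by auto
        then show "f y = g' y" using W(5) W'(5) by simp
      qed
    qed
  next
    fix f assume f: "f \<in> regular (aff n Y) U"
    show "f \<in> regular (subsp (aff n Z) Y) U"
      unfolding regular_subsp_iff
    proof
      fix x assume x: "x \<in> U"
      from f[unfolded aff_def regular_subsp_iff, rule_format, OF x]
      obtain W g where W: "openin (zar ?A) W" "x \<in> W" "W \<inter> Y \<subseteq> U" "g \<in> regular ?A W"
        "\<forall>y\<in>W \<inter> Y. f y = g y" by (elim exE conjE)
      have "g \<in> regular (aff n Z) (W \<inter> Z)"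
        unfolding aff_def regular_subsp_iff
        by (intro ballI exI[of _ W] exI[of _ g]) (use W in auto)
      then show "\<exists>W g. openin (zar (aff n Z)) W \<and> x \<in> W \<and> W \<inter> Y \<subseteq> U \<and> g \<in> regular (aff n Z) W \<and> (\<forall>y\<in>W \<inter> Y. f y = g y)"
        by (intro exI[of _ "W \<inter> Z"] exI[of _ g]) (use W x U Y in \<open>auto simp: openin_subtopology\<close>)
    qed
  qed
  have "morphism (subsp (aff n Z) Y) (aff n Y) id" "morphism (aff n Y) (subsp (aff n Z) Y) id"
    unfolding morphism_def zar ts
    using openin_subset[where U = "zar (aff n Y)", unfolded ts] reg
    by (auto simp: Collect_conj_eq Int_absorb1 simp del: zar_aff)
  then show ?thesis unfolding isomorphic_def by (intro exI[of _ id]) auto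
qed

text \<open>
  The coordinates are regular functions, and regular functions pull back. This is the converse of
  \<open>morphism_rational\<close>.
\<close>

lemma morphism_coordinate:
  fixes h :: "'k::field alg_closure list \<Rightarrow> 'k alg_closure list"
  assumes T: "T \<subseteq> {x. length x = a}" and Y: "Y \<subseteq> {x. length x = n}" and h: "morphism (aff a T) (aff n Y) h"
    and x: "x \<in> T"
  shows "rational_at a T x (\<lambda>x. nth_default 0 (h x) i)"
proof -
  have opY: "openin (subtopology (zariski n) Y) Y"
    by (metis Y openin_topspace points_aff zar_aff)
  have opT: "openin (subtopology (zariski a) T) T"
    by (metis T openin_topspace points_aff zar_aff)
  have "(\<lambda>x. nth_default 0 x i) \<in> regular (aff n Y) Y"
    unfolding regular_aff_iff[OF Y opY] using Y by (auto intro!: rational_at_polyfun polyfun_coord)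
  then have "(\<lambda>x. nth_default 0 x i) \<circ> h \<in> regular (aff a T) {x \<in> points (aff a T). h x \<in> Y}"
    using h opY unfolding morphism_def zar_aff by blast
  also have "{x \<in> points (aff a T). h x \<in> Y} = T"
    using morphism_points[OF h] unfolding points_aff[OF T] points_aff[OF Y] by auto
  finally show ?thesis
    using x unfolding regular_aff_iff[OF T opT] o_def by blast
qed

text \<open>
  Two maps into \<open>Z\<close> and into the line are combined by appending the value of the second one. On an
  affine chart of the source the coordinates of this map are locally rational by
  \<open>morphism_coordinate\<close>, so it is a morphism there, and the charts glue.
\<close>

lemma is_product_line:
  fixes Z :: "'k::field alg_closure list set"
  assumes P: "space_of P = aff (Suc n) {x. length x = Suc n \<and> butlast x \<in> Z}"
    and X: "space_of X = aff n Z" and Z: "Z \<subseteq> {x. length x = n}"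
    and Y: "space_of Y = aff 1 {x. length x = 1}"
  shows "is_product P X Y"
proof -
  let ?P = "{x. length x = Suc n \<and> butlast x \<in> Z}"
  have P': "?P \<subseteq> {x. length x = Suc n}" by auto
  have Y': "{x. length x = 1} \<subseteq> {x. length x = 1}" by auto
  have pr1: "morphism (space_of P) (space_of X) butlast"
    unfolding P X
  proof (rule morphism_rational[OF P' Z])
    fix x :: "'k alg_closure list" and i assume x: "x \<in> ?P" "i < n"
    show "rational_at (Suc n) ?P x (\<lambda>x. nth_default 0 (butlast x) i)"
      by (rule rational_at_polyfun[OF polyfun_butlast[OF polyfun_coord]]) (use x in auto)
  qed auto
  have pr2: "morphism (space_of P) (space_of Y) (\<lambda>x. [last x])"
    unfolding P Y
  proof (rule morphism_rational[OF P' Y'])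
    fix x :: "'k alg_closure list" and i :: nat assume x: "x \<in> ?P" "i < 1"
    show "rational_at (Suc n) ?P x (\<lambda>x. nth_default 0 [last x] i)"
      using rational_at_polyfun[OF polyfun_last[of n], of x ?P] x by simp
  qed auto
  show ?thesis unfolding is_product_def
  proof (rule exI[of _ butlast], rule exI[of _ "\<lambda>x. [last x]"], intro conjI pr1 pr2, intro allI impI)
    fix V :: "'k variety" and f g
    assume "morphism (space_of V) (space_of X) f \<and> morphism (space_of V) (space_of Y) g"
    then have f: "morphism (space_of V) (space_of X) f" and g: "morphism (space_of V) (space_of Y) g" by auto
    let ?V = "space_of V"
    let ?h = "\<lambda>v. f v @ [hd (g v)]"
    have fZ: "f v \<in> Z" if "v \<in> points ?V" for v
      using morphism_points[OF f that] unfolding X points_aff[OF Z] .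
    have g1: "g v = [hd (g v)]" if "v \<in> points ?V" for v
    proof -
      have "g v \<in> {x. length x = 1}"
        using morphism_points[OF g that] unfolding Y points_aff[OF Y'] .
      then show ?thesis by (cases "g v") auto
    qed
    have "is_variety ?V" using space_of[of V] by (rule CollectD)
    then have V: "is_prevariety ?V" unfolding is_variety_def by blast
    then have Vsh: "is_sheaf ?V" unfolding is_prevariety_def by blast
    from V[unfolded is_prevariety_def] obtain \<U> where \<U>0: "\<Union>\<U> = points ?V"
      "\<forall>U\<in>\<U>. openin (zar ?V) U \<and> (\<exists>n S. isomorphic (subsp ?V U) (affine_set n S))"
      by (elim exE conjE)
    have \<U>: "openin (zar ?V) U" "\<exists>n S. isomorphic (subsp ?V U) (affine_set n S)" if "U \<in> \<U>" for U
      by (rule conjunct1[OF bspec[OF \<U>0(2) that]], rule conjunct2[OF bspec[OF \<U>0(2) that]])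
    have hmor: "morphism ?V (space_of P) ?h"
    proof (rule morphism_glue[OF Vsh \<U>0(1) \<U>(1)])
      fix U assume U: "U \<in> \<U>"
      let ?U = "subsp ?V U"
      have ptU: "points ?U = U" using openin_subset[OF \<U>(1)[OF U]] by auto
      have U_sub: "U \<subseteq> points ?V" using openin_subset[OF \<U>(1)[OF U]] .
      from \<U>(2)[OF U] obtain a T where "isomorphic ?U (affine_set a T)" by blast
      then obtain \<alpha> \<beta> where iso: "morphism ?U (affine_set a T) \<alpha>" "morphism (affine_set a T) ?U \<beta>"
         "\<forall>x\<in>points ?U. \<beta> (\<alpha> x) = x"
        unfolding isomorphic_def by blast
      let ?T = "zero_locus a T"
      have T: "?T \<subseteq> {x. length x = a}" by (auto simp: zero_locus_def)
      have fb: "morphism (aff a ?T) (aff n Z) (\<lambda>x. f (\<beta> x))"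
        using morphism_compose[OF iso(2) morphism_subsp[OF \<U>(1)[OF U] Vsh f]]
        unfolding X affine_set_eq_aff .
      have gb: "morphism (aff a ?T) (aff 1 {x. length x = 1}) (\<lambda>x. g (\<beta> x))"
        using morphism_compose[OF iso(2) morphism_subsp[OF \<U>(1)[OF U] Vsh g]]
        unfolding Y affine_set_eq_aff .
      have bU: "\<beta> x \<in> points ?V" if "x \<in> ?T" for x
        using morphism_points[OF iso(2), of x] that U_sub unfolding ptU points_affine_set by auto
      have "morphism (aff a ?T) (aff (Suc n) ?P) (\<lambda>x. ?h (\<beta> x))"
      proof (rule morphism_rational[OF T P'])
        fix x assume x: "x \<in> ?T"
        show "?h (\<beta> x) \<in> ?P" using fZ[OF bU[OF x]] Z by auto
        fix i assume i: "i < Suc n"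
        have op: "openin (zariski a) {x :: 'k alg_closure list. length x = a}"
          by (metis openin_topspace topspace_zariski)
        have len: "length (f (\<beta> y)) = n" if "y \<in> ?T" for y using fZ[OF bU[OF that]] Z by auto
        show "rational_at a ?T x (\<lambda>x. nth_default 0 (?h (\<beta> x)) i)"
        proof (cases "i < n")
          case True
          show ?thesis
            by (rule rational_at_cong[OF op _ _ morphism_coordinate[OF T Z fb x, of i]])
               (use x T True len in \<open>auto simp: nth_default_def nth_append\<close>)
        next
          case False
          have "nth_default 0 (g (\<beta> y)) 0 = hd (g (\<beta> y))" if "y \<in> ?T" for y
            using arg_cong[OF g1[OF bU[OF that]], of "\<lambda>l. nth_default 0 l 0"] by simp
          then show ?thesis
            by (intro rational_at_cong[OF op _ _ morphism_coordinate[OF T Y' gb x, of 0]])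
               (use x T i False len in \<open>auto simp: nth_default_append\<close>)
        qed
      qed
      then have "morphism ?U (space_of P) (\<lambda>x. ?h (\<beta> (\<alpha> x)))"
        unfolding P using morphism_compose[OF iso(1)] unfolding affine_set_eq_aff by blast
      then show "morphism ?U (space_of P) ?h"
        by (rule morphism_cong[OF is_sheaf_subsp[OF Vsh], rotated]) (use iso(3) in auto)
    qed
    have hpr: "butlast (?h v) = f v \<and> [last (?h v)] = g v" if "v \<in> points ?V" for v
      using g1[OF that] by (metis butlast_snoc last_snoc)
    have uniq: "h' v = ?h v"
      if h': "morphism ?V (space_of P) h'" and *: "\<forall>z\<in>points ?V. butlast (h' z) = f z \<and> [last (h' z)] = g z"
        and v: "v \<in> points ?V" for h' v
    proof -
      have "h' v \<in> ?P" using morphism_points[OF h' v] unfolding P points_aff[OF P'] .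
      then have "h' v \<noteq> []" by auto
      then have "butlast (h' v) @ [last (h' v)] = h' v" by (rule append_butlast_last_id)
      moreover have "butlast (h' v) = f v" using *[rule_format, OF v] by blast
      moreover have "last (h' v) = hd (g v)"
        using arg_cong[OF conjunct2[OF *[rule_format, OF v]], of hd] unfolding list.sel .
      ultimately show ?thesis by (simp only:)
    qed
    show "\<exists>h. morphism ?V (space_of P) h \<and>
           (\<forall>z\<in>points ?V. butlast (h z) = f z \<and> [last (h z)] = g z) \<and>
           (\<forall>h'. morphism ?V (space_of P) h' \<and> (\<forall>z\<in>points ?V. butlast (h' z) = f z \<and> [last (h' z)] = g z) \<longrightarrow>
                 (\<forall>z\<in>points ?V. h' z = h z))"
    proof (rule exI[of _ ?h], intro conjI ballI allI impI)
      show "morphism ?V (space_of P) ?h" by (rule hmor)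
    next
      fix v assume v: "v \<in> points ?V"
      show "butlast (?h v) = f v" "[last (?h v)] = g v" using hpr[OF v] by blast+
    next
      fix h' v
      assume "morphism ?V (space_of P) h' \<and> (\<forall>z\<in>points ?V. butlast (h' z) = f z \<and> [last (h' z)] = g z)"
        and v: "v \<in> points ?V"
      then show "h' v = ?h v" using uniq[OF _ _ v, of h'] by blast
    qed
  qed
qed

section \<open>Congruence modulo the relations of the Grothendieck ring\<close>

definition K0_ideal :: "('k::field variety, int) mpoly set" where
  "K0_ideal = genideal ring_of_type_algebra K0_relations"

text \<open>
  Computations in the Grothendieck ring are carried out with integer polynomials in varieties,
  modulo its defining ideal. They take place in a commutative ring type, which the quotient ring is
  not.
\<close>

definition k0_eq :: "('k::field variety, int) mpoly \<Rightarrow> ('k variety, int) mpoly \<Rightarrow> bool"  (infix "\<approx>" 50) where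
  "a \<approx> b \<longleftrightarrow> a - b \<in> K0_ideal"

lemma K0_ideal_ideal: "ideal K0_ideal (ring_of_type_algebra :: ('k::field variety, int) mpoly ring)"
proof -
  interpret R: cring "ring_of_type_algebra :: ('k variety, int) mpoly ring"
    by (rule cring_from_type_algebra)
  show ?thesis
    unfolding K0_ideal_def by (rule R.genideal_ideal) (auto simp: ring_of_type_algebra_def)
qed

lemma K0_relations_ideal: "K0_relations \<subseteq> (K0_ideal :: ('k::field variety, int) mpoly set)"
proof -
  interpret R: cring "ring_of_type_algebra :: ('k variety, int) mpoly ring"
    by (rule cring_from_type_algebra)
  show ?thesis
    unfolding K0_ideal_def by (rule R.genideal_self) (auto simp: ring_of_type_algebra_def)
qed

lemma type_algebra_simps:
  "carrier ring_of_type_algebra = UNIV" "x \<oplus>\<^bsub>ring_of_type_algebra\<^esub> y = x + y"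
  "x \<otimes>\<^bsub>ring_of_type_algebra\<^esub> y = x * y" "\<zero>\<^bsub>ring_of_type_algebra\<^esub> = 0" "\<one>\<^bsub>ring_of_type_algebra\<^esub> = 1"
  by (simp_all add: ring_of_type_algebra_def)

lemma K0_ideal_0: "0 \<in> (K0_ideal :: ('k::field variety, int) mpoly set)"
  and K0_ideal_add: "a \<in> K0_ideal \<Longrightarrow> b \<in> K0_ideal \<Longrightarrow> a + b \<in> (K0_ideal :: ('k::field variety, int) mpoly set)"
  and K0_ideal_mult: "a \<in> K0_ideal \<Longrightarrow> c * a \<in> (K0_ideal :: ('k::field variety, int) mpoly set)"
proof -
  interpret I: ideal K0_ideal "ring_of_type_algebra :: ('k variety, int) mpoly ring"
    by (rule K0_ideal_ideal)
  show "0 \<in> (K0_ideal :: ('k variety, int) mpoly set)"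
    using additive_subgroup.zero_closed[OF ideal.axioms(1)[OF K0_ideal_ideal]]
    by (simp add: type_algebra_simps)
  show "a \<in> K0_ideal \<Longrightarrow> b \<in> K0_ideal \<Longrightarrow> a + b \<in> (K0_ideal :: ('k variety, int) mpoly set)"
    using additive_subgroup.a_closed[OF ideal.axioms(1)[OF K0_ideal_ideal], of a b] by (simp add: type_algebra_simps)
  show "a \<in> K0_ideal \<Longrightarrow> c * a \<in> (K0_ideal :: ('k variety, int) mpoly set)"
    using I.I_l_closed[of a c] by (simp add: type_algebra_simps)
qed

lemma k0_eq_refl [simp]: "a \<approx> a"
  by (simp add: k0_eq_def K0_ideal_0)

lemma k0_eq_sym: "a \<approx> b \<Longrightarrow> b \<approx> a"
  using K0_ideal_mult[of "a - b" "- 1"] by (simp add: k0_eq_def)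

lemma k0_eq_trans [trans]: "a \<approx> b \<Longrightarrow> b \<approx> c \<Longrightarrow> a \<approx> c"
  using K0_ideal_add[of "a - b" "b - c"] by (simp add: k0_eq_def)

lemma k0_eq_add: "a \<approx> b \<Longrightarrow> c \<approx> d \<Longrightarrow> a + c \<approx> b + d"
  using K0_ideal_add[of "a - b" "c - d"] by (simp add: k0_eq_def algebra_simps)

lemma k0_eq_mult: "a \<approx> b \<Longrightarrow> c \<approx> d \<Longrightarrow> a * c \<approx> b * d"
  using K0_ideal_add[OF K0_ideal_mult[of "a - b" c] K0_ideal_mult[of "c - d" b]]
  by (simp add: k0_eq_def algebra_simps)

lemma k0_eq_uminus: "a \<approx> b \<Longrightarrow> - a \<approx> - b"
  using k0_eq_mult[of "-1" "-1" a b] by simp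

lemma k0_eq_diff: "a \<approx> b \<Longrightarrow> c \<approx> d \<Longrightarrow> a - c \<approx> b - d"
  using k0_eq_add[OF _ k0_eq_uminus] by fastforce

lemma k0_eq_0I: "a + b \<approx> a \<Longrightarrow> b \<approx> 0"
  by (simp add: k0_eq_def)

lemma k0_eq_isomorphic:
  assumes "isomorphic (space_of X) (space_of Y)"
  shows "mvar X \<approx> mvar Y"
proof -
  have "mvar X - mvar Y \<in> K0_relations"
    unfolding K0_relations_def using assms by (intro UnI1 CollectI exI[of _ X] exI[of _ Y]) simp
  then show ?thesis unfolding k0_eq_def using K0_relations_ideal by (rule subsetD[rotated])
qed

lemma k0_eq_scissors:
  assumes "closedin (zar (space_of X)) C" "space_of Z = subsp (space_of X) C"
    "space_of U = subsp (space_of X) (points (space_of X) - C)"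
  shows "mvar X \<approx> mvar Z + mvar U"
proof -
  have "mvar X - mvar Z - mvar U \<in> K0_relations"
    unfolding K0_relations_def
    by (rule UnI1, rule UnI1, rule UnI2, rule CollectI, rule exI[of _ X], rule exI[of _ Z], rule exI[of _ U])
       (use assms in \<open>intro conjI refl exI[of _ C]\<close>)
  then have "mvar X - mvar Z - mvar U \<in> K0_ideal" using K0_relations_ideal by (rule subsetD[rotated])
  then show ?thesis unfolding k0_eq_def diff_diff_eq .
qed

lemma k0_eq_product:
  assumes "is_product P X Y"
  shows "mvar P \<approx> mvar X * mvar Y"
proof -
  have "mvar P - mvar X * mvar Y \<in> K0_relations"
    unfolding K0_relations_def
    by (rule UnI1, rule UnI2, rule CollectI, rule exI[of _ P], rule exI[of _ X], rule exI[of _ Y])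
       (use assms in \<open>intro conjI refl\<close>)
  then show ?thesis unfolding k0_eq_def using K0_relations_ideal by (rule subsetD[rotated])
qed

lemma k0_eq_point: "mvar (affine_variety 0 {}) \<approx> 1"
proof -
  have "mvar (affine_variety 0 {}) - 1 \<in> K0_relations"
    unfolding K0_relations_def by (rule UnI2) simp
  then show ?thesis unfolding k0_eq_def using K0_relations_ideal by (rule subsetD[rotated])
qed

text \<open>
  The quotient map is a ring homomorphism, so it takes a polynomial expression in the line to the
  same expression in its class.
\<close>

lemma K0_class_eqI:
  fixes X :: "'k::field variety"
  assumes "mvar X \<approx> (\<Sum>i\<le>d. of_int (c i) * mvar (affine_variety 1 {}) ^ i)"
  shows "K0_class X = (\<Oplus>\<^bsub>K0\<^esub>i\<in>{..d}. [c i] \<cdot>\<^bsub>K0\<^esub> (lefschetz [^]\<^bsub>K0\<^esub> i))"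
proof -
  let ?R = "ring_of_type_algebra :: ('k variety, int) mpoly ring"
  let ?h = "\<lambda>a. K0_ideal +>\<^bsub>?R\<^esub> a"
  interpret R: cring ?R by (rule cring_from_type_algebra)
  interpret I: ideal K0_ideal ?R by (rule K0_ideal_ideal)
  have K: "K0 = ?R Quot K0_ideal" by (simp add: K0_def K0_ideal_def)
  interpret K: cring "K0 :: ('k variety, int) mpoly set ring" by (rule cring_K0)
  have h: "ring_hom_cring ?R K0 ?h"
    unfolding K by (rule I.rcos_ring_hom_cring[OF R.is_cring])
  interpret h: ring_hom_cring ?R K0 ?h by (rule h)
  have hc: "?h a \<in> carrier K0" for a by (rule h.hom_closed) (simp add: type_algebra_simps)
  have hadd: "?h (a + b) = ?h a \<oplus>\<^bsub>K0\<^esub> ?h b" for a b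
    using h.hom_add[of a b] by (simp add: type_algebra_simps)
  have hmult: "?h (a * b) = ?h a \<otimes>\<^bsub>K0\<^esub> ?h b" for a b
    using h.hom_mult[of a b] by (simp add: type_algebra_simps)
  have h0: "?h 0 = \<zero>\<^bsub>K0\<^esub>" and h1: "?h 1 = \<one>\<^bsub>K0\<^esub>"
    using h.hom_zero h.hom_one by (simp_all add: type_algebra_simps)
  have hpow: "?h (a ^ n) = ?h a [^]\<^bsub>K0\<^esub> n" for a and n :: nat
    by (induction n) (simp_all add: h1 hmult hc K.m_comm mult.commute)
  have hneg: "?h (- a) = \<ominus>\<^bsub>K0\<^esub> ?h a" for a
    by (rule K.minus_equality[symmetric]) (use hadd[of "- a" a] h0 hc in auto)
  have hnat: "?h (of_nat n * a) = [n] \<cdot>\<^bsub>K0\<^esub> ?h a" for a and n :: nat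
    by (induction n) (simp_all add: h0 hadd hc ring_distribs K.a_comm)
  have hint: "?h (of_int n * a) = [n] \<cdot>\<^bsub>K0\<^esub> ?h a" for a and n :: int
  proof (cases "n \<ge> 0")
    case True
    then show ?thesis using hnat[of "nat n" a] by (simp add: add_pow_int_ge)
  next
    case False
    have "?h (of_int n * a) = \<ominus>\<^bsub>K0\<^esub> ?h (of_nat (nat (- n)) * a)"
      unfolding hneg[symmetric] using False by simp
    also have "\<dots> = [n] \<cdot>\<^bsub>K0\<^esub> ?h a"
      unfolding hnat using False by (simp add: add_pow_int_lt)
    finally show ?thesis .
  qed
  have hsum: "?h (\<Sum>i\<le>d. f i) = (\<Oplus>\<^bsub>K0\<^esub>i\<in>{..d}. ?h (f i))" for f and d :: nat
  proof (induction d)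
    case 0
    show ?case by (simp add: K.finsum_0 hc)
  next
    case (Suc d)
    have "(\<Oplus>\<^bsub>K0\<^esub>i\<in>{..Suc d}. ?h (f i)) = ?h (f (Suc d)) \<oplus>\<^bsub>K0\<^esub> (\<Oplus>\<^bsub>K0\<^esub>i\<in>{..d}. ?h (f i))"
      by (rule K.finsum_Suc) (simp add: hc)
    then show ?case
      using Suc by (simp add: hadd hc K.a_comm)
  qed
  have "?h a = ?h b" if "a \<approx> b" for a b
  proof -
    have "a - b \<in> K0_ideal" using that by (simp add: k0_eq_def)
    then have "?h (a - b) = \<zero>\<^bsub>K0\<^esub>"
      by (metis I.Icarr I.a_rcos_const K FactRing_def ring.simps(1) partial_object.simps(1) monoid.simps(2))
    then have "?h (a - b + b) = ?h b" unfolding hadd by (simp add: hc)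
    then show ?thesis by simp
  qed
  from this[OF assms] show ?thesis
    by (simp add: hsum hint hpow K0_class_def lefschetz_def flip: K0_ideal_def)
qed

section \<open>Classes of closed subsets of affine space\<close>

text \<open>
  Finitely many equations are required because the proof that motivic integrals are well defined is
  an induction on the equations of all sets involved.
\<close>

definition affine_closed :: "nat \<Rightarrow> 'k::field alg_closure list set \<Rightarrow> bool" where
  "affine_closed n Z \<longleftrightarrow> (\<exists>S :: (nat, 'k) mpoly set. finite S \<and> Z = zero_locus n S)"

text \<open>
  The chosen equations do not matter, since the variety depends only on their common zeros.
\<close>

definition cls :: "nat \<Rightarrow> 'k::field alg_closure list set \<Rightarrow> ('k variety, int) mpoly" where
  "cls n Z = mvar (affine_variety n (SOME S. Z = zero_locus n S))"

lemma affine_closed_subset: "affine_closed n Z \<Longrightarrow> Z \<subseteq> {x. length x = n}"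
  by (auto simp: affine_closed_def zero_locus_def)

lemma cls_rep:
  assumes "affine_closed n Z"
  obtains X where "space_of X = aff n Z" "cls n Z = mvar X"
proof -
  have "Z = zero_locus n (SOME S. Z = zero_locus n S)"
    using assms unfolding affine_closed_def by (intro someI_ex[of "\<lambda>S. Z = zero_locus n S"]) blast
  then show ?thesis using that[of "affine_variety n (SOME S. Z = zero_locus n S)"]
    by (simp add: affine_variety.rep_eq affine_set_eq_aff cls_def)
qed

lemma zero_locus_eq_affine_variety:
  fixes S :: "(nat, 'k::field) mpoly set"
  assumes "finite S"
  shows "cls n (zero_locus n S) = mvar (affine_variety n S)"
proof -
  obtain X :: "'k variety" where "space_of X = aff n (zero_locus n S)" "cls n (zero_locus n S) = mvar X"
    by (rule cls_rep[of n "zero_locus n S"]) (use assms in \<open>auto simp: affine_closed_def\<close>)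
  moreover have "space_of (affine_variety n S) = aff n (zero_locus n S)"
    by (simp add: affine_variety.rep_eq affine_set_eq_aff)
  ultimately show ?thesis by (metis space_of_inject)
qed

lemma affine_closed_UNIV: "affine_closed n {x. length x = n}"
  unfolding affine_closed_def by (rule exI[of _ "{}"]) (simp add: zero_locus_def)

lemma affine_closed_polyfun:
  assumes Z: "affine_closed n Z" and g: "polyfun n g"
  shows "affine_closed n {x \<in> Z. g x = 0}"
proof -
  obtain p where p: "\<And>x. length x = n \<Longrightarrow> g x = peval p x" using g unfolding polyfun_def by blast
  obtain S where S: "Z = zero_locus n S" "finite S" using Z unfolding affine_closed_def by blast
  have "{x \<in> Z. g x = 0} = zero_locus n (insert p S)" using p by (auto simp: S zero_locus_def)
  then show ?thesis unfolding affine_closed_def using S(2) by (intro exI[of _ "insert p S"]) simp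
qed

lemma affine_closed_preimage:
  assumes Z: "affine_closed m Z" and h: "\<And>i. i < m \<Longrightarrow> polyfun n (\<lambda>x. nth_default 0 (h x) i)"
    and len: "\<And>x. length x = n \<Longrightarrow> length (h x) = m"
  shows "affine_closed n {x. length x = n \<and> h x \<in> Z}"
proof -
  obtain S where S: "Z = zero_locus m S" "finite S" using Z unfolding affine_closed_def by blast
  have "\<exists>q. \<forall>x. length x = n \<longrightarrow> peval p (h x) = peval q x" for p :: "(nat, 'a) mpoly"
    using polyfun_compose[OF polyfun_peval[of m p] h len] unfolding polyfun_def .
  then obtain q :: "(nat, 'a) mpoly \<Rightarrow> (nat, 'a) mpoly"
    where q: "\<And>p x. length x = n \<Longrightarrow> peval p (h x) = peval (q p) x" by metis
  have "{x. length x = n \<and> h x \<in> Z} = zero_locus n (q ` S)"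
  proof (intro Set.set_eqI iffI)
    fix x assume "x \<in> {x. length x = n \<and> h x \<in> Z}"
    then show "x \<in> zero_locus n (q ` S)" by (simp add: S zero_locus_def q[symmetric])
  next
    fix x assume "x \<in> zero_locus n (q ` S)"
    then show "x \<in> {x. length x = n \<and> h x \<in> Z}" using len by (simp add: S zero_locus_def q)
  qed
  then show ?thesis unfolding affine_closed_def using S(2) by (intro exI[of _ "q ` S"]) simp
qed

lemma affine_closed_butlast:
  assumes "affine_closed n Z"
  shows "affine_closed (Suc n) {x. length x = Suc n \<and> butlast x \<in> Z}"
  by (rule affine_closed_preimage[OF assms]) (rule polyfun_butlast[OF polyfun_coord], simp)

lemma affine_closed_principal_open:
  assumes "affine_closed n X" "polyfun n g"
  shows "affine_closed (Suc n) {y. length y = Suc n \<and> butlast y \<in> X \<and> g (butlast y) * last y = 1}"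
proof -
  have "affine_closed (Suc n) {y \<in> {y. length y = Suc n \<and> butlast y \<in> X}. g (butlast y) * last y - 1 = 0}"
    by (intro affine_closed_polyfun[OF affine_closed_butlast] polyfun_diff polyfun_mult
          polyfun_butlast polyfun_last polyfun_1 assms)
  also have "{y \<in> {y. length y = Suc n \<and> butlast y \<in> X}. g (butlast y) * last y - 1 = 0}
     = {y. length y = Suc n \<and> butlast y \<in> X \<and> g (butlast y) * last y = 1}" by auto
  finally show ?thesis .
qed

lemma cls_isomorphic:
  fixes Z :: "'k::field alg_closure list set"
  assumes Z: "affine_closed n Z" and Z': "affine_closed m Z'"
    and h: "\<And>i. i < m \<Longrightarrow> polyfun n (\<lambda>x. nth_default 0 (h x) i)" "\<And>x. x \<in> Z \<Longrightarrow> h x \<in> Z'"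
    and g: "\<And>i. i < n \<Longrightarrow> polyfun m (\<lambda>x. nth_default 0 (g x) i)" "\<And>x. x \<in> Z' \<Longrightarrow> g x \<in> Z"
    and inv: "\<And>x. x \<in> Z \<Longrightarrow> g (h x) = x" "\<And>y. y \<in> Z' \<Longrightarrow> h (g y) = y"
  shows "cls n Z \<approx> cls m Z'"
proof -
  note Zs = affine_closed_subset[OF Z] note Zs' = affine_closed_subset[OF Z']
  obtain X where X: "space_of X = aff n Z" "cls n Z = mvar X" by (rule cls_rep[OF Z])
  obtain X' where X': "space_of X' = aff m Z'" "cls m Z' = mvar X'" by (rule cls_rep[OF Z'])
  have "morphism (aff n Z) (aff m Z') h"
    by (rule morphism_rational[OF Zs Zs' h(2)]) (use Zs in \<open>auto intro!: rational_at_polyfun h\<close>)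
  moreover have "morphism (aff m Z') (aff n Z) g"
    by (rule morphism_rational[OF Zs' Zs g(2)]) (use Zs' in \<open>auto intro!: rational_at_polyfun g\<close>)
  ultimately have "isomorphic (aff n Z) (aff m Z')"
    unfolding isomorphic_def points_aff[OF Zs] points_aff[OF Zs'] using inv by blast
  then show ?thesis
    unfolding X(2) X'(2) by (intro k0_eq_isomorphic) (simp only: X(1) X'(1))
qed

lemma cls_point: "cls 0 {[] :: 'k::field alg_closure list} \<approx> 1"
proof -
  have "{[]} = zero_locus 0 ({} :: (nat, 'k) mpoly set)" by (auto simp: zero_locus_def)
  then have "cls 0 {[] :: 'k alg_closure list} = mvar (affine_variety 0 {})"
    by (simp add: zero_locus_eq_affine_variety)
  then show ?thesis using k0_eq_point by simp
qed

abbreviation (input) lef :: "('k::field variety, int) mpoly" where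
  "lef \<equiv> mvar (affine_variety 1 {})"

text \<open>
  The class of the line enters only here, through the product relation.
\<close>

lemma cls_times_line:
  fixes Z :: "'k::field alg_closure list set"
  assumes Z: "affine_closed n Z"
  shows "cls (Suc n) {x. length x = Suc n \<and> butlast x \<in> Z} \<approx> cls n Z * lef"
proof -
  obtain X where X: "space_of X = aff n Z" "cls n Z = mvar X" by (rule cls_rep[OF Z])
  obtain P where P: "space_of P = aff (Suc n) {x. length x = Suc n \<and> butlast x \<in> Z}"
     "cls (Suc n) {x. length x = Suc n \<and> butlast x \<in> Z} = mvar P"
    by (rule cls_rep[OF affine_closed_butlast[OF Z]])
  have "space_of (affine_variety 1 {} :: 'k variety) = aff 1 {x. length x = 1}"
    by (simp add: affine_variety.rep_eq affine_set_eq_aff zero_locus_def)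
  then have "is_product P X (affine_variety 1 {})"
    by (rule is_product_line[OF P(1) X(1) affine_closed_subset[OF Z]])
  then show ?thesis unfolding X(2) P(2) by (rule k0_eq_product)
qed

text \<open>
  The open subset of \<open>Z\<close> where \<open>g\<close> is nonzero is isomorphic to the closed set \<open>g t = 1\<close> in one
  dimension more, by \<open>t = 1 / g\<close>. In this form the scissors relation involves only closed subsets of
  affine spaces.
\<close>

lemma cls_scissors:
  fixes Z :: "'k::field alg_closure list set"
  assumes Z: "affine_closed n Z" and g: "polyfun n g"
  shows "cls n Z \<approx> cls n {x \<in> Z. g x = 0}
    + cls (Suc n) {x. length x = Suc n \<and> butlast x \<in> Z \<and> g (butlast x) * last x = 1}"
proof -
  let ?C = "{x \<in> Z. g x = 0}" and ?U = "{x \<in> Z. g x \<noteq> 0}"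
  let ?V = "{x. length x = Suc n \<and> butlast x \<in> Z \<and> g (butlast x) * last x = 1}"
  note Zs = affine_closed_subset[OF Z]
  have Vs: "?V \<subseteq> {x. length x = Suc n}" by auto
  have Us: "?U \<subseteq> {x. length x = n}" using Zs by auto
  have C: "affine_closed n ?C" by (rule affine_closed_polyfun[OF Z g])
  have V: "affine_closed (Suc n) ?V" by (rule affine_closed_principal_open[OF Z g])
  obtain X where X: "space_of X = aff n Z" "cls n Z = mvar X" by (rule cls_rep[OF Z])
  obtain XC where XC: "space_of XC = aff n ?C" "cls n ?C = mvar XC" by (rule cls_rep[OF C])
  obtain XV where XV: "space_of XV = aff (Suc n) ?V" "cls (Suc n) ?V = mvar XV" by (rule cls_rep[OF V])
  obtain SC where SC: "?C = zero_locus n (SC :: (nat, 'k) mpoly set)" using C unfolding affine_closed_def by blast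
  obtain SV where SV: "?V = zero_locus (Suc n) (SV :: (nat, 'k) mpoly set)" using V unfolding affine_closed_def by blast
  have isoC: "isomorphic (subsp (aff n Z) ?C) (aff n ?C)"
    by (rule isomorphic_subsp_aff[OF Zs]) auto
  have UV: "isomorphic (aff n ?U) (aff (Suc n) ?V)"
  proof -
    have "morphism (aff n ?U) (aff (Suc n) ?V) (\<lambda>x. x @ [inverse (g x)])"
    proof (rule morphism_rational[OF Us Vs])
      fix x assume x: "x \<in> ?U"
      then show "x @ [inverse (g x)] \<in> ?V" using Zs by auto
      fix i assume "i < Suc n"
      have op: "openin (zariski n) {x :: 'k alg_closure list. length x = n}"
        by (metis openin_topspace topspace_zariski)
      have lx: "length x = n" using x Us by auto
      show "rational_at n ?U x (\<lambda>x. nth_default 0 (x @ [inverse (g x)]) i)"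
      proof (cases "i < n")
        case True
        show ?thesis
          by (rule rational_at_cong[OF op _ _ rational_at_polyfun[OF polyfun_coord[of n i] lx]])
             (use lx True in \<open>auto simp: nth_default_def nth_append\<close>)
      next
        case False
        have "rational_at n ?U x (\<lambda>x. inverse (g x))"
          by (rule rational_at_inverse[OF rational_at_polyfun[OF g lx] _ x lx]) (use x in auto)
        then show ?thesis
          by (rule rational_at_cong[OF op, rotated 2])
             (use lx False \<open>i < Suc n\<close> in \<open>auto simp: nth_default_def nth_append\<close>)
      qed
    qed
    moreover have "morphism (aff (Suc n) ?V) (aff n ?U) butlast"
    proof (rule morphism_rational[OF Vs Us])
      fix x :: "'k alg_closure list" and i assume "x \<in> ?V"
      then show "butlast x \<in> ?U" by auto
      show "rational_at (Suc n) ?V x (\<lambda>x. nth_default 0 (butlast x) i)"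
        by (rule rational_at_polyfun[OF polyfun_butlast[OF polyfun_coord]]) (use \<open>x \<in> ?V\<close> in auto)
    qed
    moreover have "butlast x @ [inverse (g (butlast x))] = x" if "x \<in> ?V" for x
    proof -
      have "inverse (g (butlast x)) = last x" using that by (auto intro!: inverse_unique)
      moreover have "x \<noteq> []" using that by auto
      ultimately show ?thesis by (metis append_butlast_last_id)
    qed
    ultimately show ?thesis
      unfolding isomorphic_def points_aff[OF Us] points_aff[OF Vs]
      by (intro exI[of _ "\<lambda>x. x @ [inverse (g x)]"] exI[of _ butlast]) simp
  qed
  have isoU: "isomorphic (subsp (aff n Z) ?U) (aff (Suc n) ?V)"
    by (rule isomorphic_trans[OF isomorphic_subsp_aff[OF Zs] UV]) auto
  have shZ: "is_sheaf (subsp (aff n Z) S)" for S by (rule is_sheaf_subsp[OF is_sheaf_aff])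
  obtain C' :: "'k variety" where C': "space_of C' = subsp (aff n Z) ?C"
    using is_variety_of_isomorphic_affine[OF shZ isoC[unfolded SC, folded affine_set_eq_aff, folded SC]]
    by (metis Abs_variety_inverse CollectI)
  obtain U' :: "'k variety" where U': "space_of U' = subsp (aff n Z) ?U"
    using is_variety_of_isomorphic_affine[OF shZ isoU[unfolded SV, folded affine_set_eq_aff]]
    by (metis Abs_variety_inverse CollectI)
  have "closedin (zar (space_of X)) ?C"
  proof -
    have "closedin (zariski n) ?C" using SC closedin_zariski by blast
    then show ?thesis unfolding X zar_aff by (rule closedin_subset_topspace) auto
  qed
  moreover have "points (space_of X) - ?C = ?U" unfolding X points_aff[OF Zs] by auto
  ultimately have "mvar X \<approx> mvar C' + mvar U'"
    by (intro k0_eq_scissors[of X ?C]) (simp_all only: C' U' X(1))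
  also have "\<dots> \<approx> mvar XC + mvar XV" by (intro k0_eq_add k0_eq_isomorphic) (simp_all only: C' U' XC(1) XV(1) isoC isoU)
  finally show ?thesis unfolding X(2) XC(2) XV(2) .
qed

section \<open>Motivic integrals of constructible functions\<close>

lemma affine_closed_empty: "affine_closed n {}"
  unfolding affine_closed_def by (rule exI[of _ "{1}"]) (simp add: zero_locus_def)

text \<open>
  Cutting the empty set gives twice the empty set, in two different affine spaces.
\<close>

lemma cls_empty: "cls n {} \<approx> 0"
proof -
  have "cls n {} \<approx> cls (Suc n) {}"
    by (rule cls_isomorphic[OF affine_closed_empty affine_closed_empty, where h = "\<lambda>_. []" and g = "\<lambda>_. []"])
       (simp_all add: polyfun_0)
  moreover have "cls (Suc n) {} \<approx> 0"
    using cls_scissors[OF affine_closed_empty polyfun_1, of n]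
    by (intro k0_eq_0I[OF k0_eq_sym]) simp
  ultimately show ?thesis by (rule k0_eq_trans)
qed

lemma k0_eq_sum_list:
  "(\<And>z. z \<in> set zs \<Longrightarrow> F z \<approx> G z) \<Longrightarrow> (\<Sum>z\<leftarrow>zs. F z) \<approx> (\<Sum>z\<leftarrow>zs. G z)"
  by (induction zs) (auto intro: k0_eq_add)

lemma affine_closed_conditions:
  assumes "affine_closed n X" "finite J" "\<And>f. f \<in> J \<Longrightarrow> polyfun n f"
  shows "affine_closed n {x \<in> X. \<forall>f\<in>J. f x = 0}"
  using assms(2,3)
proof (induction J rule: finite_induct)
  case empty
  show ?case using assms(1) by simp
next
  case (insert f J)
  then have "affine_closed n {x \<in> {x \<in> X. \<forall>f\<in>J. f x = 0}. f x = 0}"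
    by (intro affine_closed_polyfun) auto
  also have "{x \<in> {x \<in> X. \<forall>f\<in>J. f x = 0}. f x = 0} = {x \<in> X. \<forall>f\<in>insert f J. f x = 0}" by auto
  finally show ?case .
qed

text \<open>
  An integer combination of indicator functions of closed subsets of \<open>X\<close> that vanishes everywhere
  also gives the relation between the classes. The proof cuts \<open>X\<close> along the first equation \<open>f\<close>. On
  \<open>f = 0\<close> the equation can be dropped from every set; on \<open>f \<noteq> 0\<close> the sets that use it are empty.
  Once no equation is left all sets are equal to \<open>X\<close>, so that either \<open>X\<close> is empty or the
  coefficients add up to zero.
\<close>

lemma cls_combination_eq_0:
  fixes zs :: "(int \<times> ('k::field alg_closure list \<Rightarrow> 'k alg_closure) set) list"
  assumes "affine_closed n X" "\<And>f. f \<in> set fs \<Longrightarrow> polyfun n f"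
    and "\<And>z. z \<in> set zs \<Longrightarrow> snd z \<subseteq> set fs"
    and "\<And>x. x \<in> X \<Longrightarrow> (\<Sum>z\<leftarrow>zs. fst z * of_bool (\<forall>f\<in>snd z. f x = 0)) = 0"
  shows "(\<Sum>z\<leftarrow>zs. of_int (fst z) * cls n {x \<in> X. \<forall>f\<in>snd z. f x = 0}) \<approx> 0"
  using assms
proof (induction "length fs" arbitrary: fs n X zs)
  case 0
  have sub: "snd z = {}" if "z \<in> set zs" for z using "0.prems"(3)[OF that] "0.hyps" by simp
  have "(\<Sum>z\<leftarrow>zs. of_int (fst z) * cls n {x \<in> X. \<forall>f\<in>snd z. f x = 0}) = (\<Sum>z\<leftarrow>zs. of_int (fst z) * cls n X)"
    by (intro arg_cong[of _ _ sum_list] map_cong refl) (simp add: sub)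
  also have "\<dots> = of_int (\<Sum>z\<leftarrow>zs. fst z) * cls n X"
    by (induction zs) (simp_all add: algebra_simps)
  also have "\<dots> \<approx> 0"
  proof (cases "X = {}")
    case True
    show ?thesis using k0_eq_mult[OF k0_eq_refl cls_empty] unfolding True by fastforce
  next
    case False
    then obtain x where "x \<in> X" by blast
    have "(\<Sum>z\<leftarrow>zs. fst z) = (\<Sum>z\<leftarrow>zs. fst z * of_bool (\<forall>f\<in>snd z. f x = 0))"
      by (intro arg_cong[of _ _ sum_list] map_cong refl) (simp add: sub)
    also have "\<dots> = 0" by (rule "0.prems"(4)[OF \<open>x \<in> X\<close>])
    finally show ?thesis by simp
  qed
  finally show ?case .
next
  case (Suc k)
  then obtain f fs' where fs: "fs = f # fs'" and k: "k = length fs'" by (cases fs) auto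
  note IH = Suc.hyps(1) and prems = Suc.prems[unfolded fs]
  note X = prems(1)
  have f: "polyfun n f" using prems(2) by simp
  let ?X0 = "{x \<in> X. f x = 0}"
  let ?X1 = "{y. length y = Suc n \<and> butlast y \<in> X \<and> f (butlast y) * last y = 1}"
  let ?lift = "\<lambda>g y. g (butlast y)"
  let ?c1 = "\<lambda>z. if f \<in> snd z then 0 else fst z"
  let ?zs0 = "map (\<lambda>z. (fst z, snd z - {f})) zs"
  let ?zs1 = "map (\<lambda>z. (?c1 z, if f \<in> snd z then {} else ?lift ` snd z)) zs"
  let ?A = "\<lambda>z. {x \<in> ?X0. \<forall>g\<in>snd z - {f}. g x = 0}"
  let ?B = "\<lambda>z. {y \<in> ?X1. \<forall>g\<in>(if f \<in> snd z then {} else ?lift ` snd z). g y = 0}"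
  have 0: "(\<Sum>z\<leftarrow>zs. of_int (fst z) * cls n (?A z)) \<approx> 0"
  proof -
    have "(\<Sum>z\<leftarrow>?zs0. of_int (fst z) * cls n {x \<in> ?X0. \<forall>g\<in>snd z. g x = 0}) \<approx> 0"
    proof (rule IH[of fs'])
      show "k = length fs'" by (rule k)
      show "affine_closed n ?X0" by (rule affine_closed_polyfun[OF X f])
      show "polyfun n g" if "g \<in> set fs'" for g using prems(2) that by simp
      show "snd z \<subseteq> set fs'" if "z \<in> set ?zs0" for z
        using that prems(3) by fastforce
      fix x assume x: "x \<in> ?X0"
      have "(\<Sum>z\<leftarrow>?zs0. fst z * of_bool (\<forall>g\<in>snd z. g x = 0)) = (\<Sum>z\<leftarrow>zs. fst z * of_bool (\<forall>g\<in>snd z. g x = 0))"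
        unfolding map_map o_def
        by (intro arg_cong[of _ _ sum_list] map_cong refl arg_cong2[of _ _ _ _ "(*)"] arg_cong[of _ _ of_bool])
           (use x in auto)
      also have "\<dots> = 0" using x by (intro prems(4)) simp
      finally show "(\<Sum>z\<leftarrow>?zs0. fst z * of_bool (\<forall>g\<in>snd z. g x = 0)) = 0" .
    qed
    then show ?thesis unfolding map_map o_def fst_conv snd_conv .
  qed
  have 1: "(\<Sum>z\<leftarrow>zs. of_int (?c1 z) * cls (Suc n) (?B z)) \<approx> 0"
  proof -
    have "(\<Sum>z\<leftarrow>?zs1. of_int (fst z) * cls (Suc n) {y \<in> ?X1. \<forall>g\<in>snd z. g y = 0}) \<approx> 0"
    proof (rule IH[of "map ?lift fs'" "Suc n"])
      show "k = length (map ?lift fs')" by (simp add: k)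
      show "affine_closed (Suc n) ?X1" by (rule affine_closed_principal_open[OF X f])
      show "snd z \<subseteq> set (map ?lift fs')" if "z \<in> set ?zs1" for z
        using that prems(3) by (fastforce split: if_splits)
    next
      fix g assume "g \<in> set (map ?lift fs')"
      then obtain g' where "g' \<in> set fs'" "g = ?lift g'" by auto
      then show "polyfun (Suc n) g" using prems(2)[of g'] polyfun_butlast[of n g'] by simp
    next
      fix y assume y: "y \<in> ?X1"
      then have nz: "f (butlast y) \<noteq> 0" by auto
      have "(\<Sum>z\<leftarrow>?zs1. fst z * of_bool (\<forall>g\<in>snd z. g y = 0)) = (\<Sum>z\<leftarrow>zs. fst z * of_bool (\<forall>g\<in>snd z. g (butlast y) = 0))"
        unfolding map_map o_def
        by (intro arg_cong[of _ _ sum_list] map_cong refl) (use nz in auto)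
      also have "\<dots> = 0" using y by (intro prems(4)) simp
      finally show "(\<Sum>z\<leftarrow>?zs1. fst z * of_bool (\<forall>g\<in>snd z. g y = 0)) = 0" .
    qed
    then show ?thesis unfolding map_map o_def fst_conv snd_conv .
  qed
  have "(\<Sum>z\<leftarrow>zs. of_int (fst z) * cls n {x \<in> X. \<forall>f\<in>snd z. f x = 0}) \<approx>
      (\<Sum>z\<leftarrow>zs. of_int (fst z) * cls n (?A z) + of_int (?c1 z) * cls (Suc n) (?B z))"
  proof (rule k0_eq_sum_list)
    fix z assume z: "z \<in> set zs"
    let ?Z = "{x \<in> X. \<forall>f\<in>snd z. f x = 0}"
    have Z: "affine_closed n ?Z"
      using prems(2) prems(3)[OF z]
      by (intro affine_closed_conditions[OF X] finite_subset[of "snd z" "set (f # fs')"]) auto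
    have A: "{x \<in> ?Z. f x = 0} = ?A z" by auto
    have *: "cls n ?Z \<approx> cls n (?A z) + cls (Suc n) {y. length y = Suc n \<and> butlast y \<in> ?Z \<and> f (butlast y) * last y = 1}"
      using cls_scissors[OF Z f] unfolding A .
    show "of_int (fst z) * cls n ?Z \<approx> of_int (fst z) * cls n (?A z) + of_int (?c1 z) * cls (Suc n) (?B z)"
    proof (cases "f \<in> snd z")
      case True
      have "f (butlast y) * last y \<noteq> 1" if "butlast y \<in> ?Z" for y
      proof -
        have "f (butlast y) = 0" using that True by blast
        then show ?thesis by simp
      qed
      then have eq: "{y. length y = Suc n \<and> butlast y \<in> ?Z \<and> f (butlast y) * last y = 1} = {}"
        by blast
      have "cls n ?Z \<approx> cls n (?A z) + cls (Suc n) {}" using *[unfolded eq] .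
      also have "\<dots> \<approx> cls n (?A z) + 0" by (intro k0_eq_add k0_eq_refl cls_empty)
      finally have "cls n ?Z \<approx> cls n (?A z)" by simp
      then show ?thesis using True by (simp add: k0_eq_mult)
    next
      case False
      then have eq: "{y. length y = Suc n \<and> butlast y \<in> ?Z \<and> f (butlast y) * last y = 1} = ?B z" by auto
      have "cls n ?Z \<approx> cls n (?A z) + cls (Suc n) (?B z)" using *[unfolded eq] .
      from k0_eq_mult[OF k0_eq_refl this, of "of_int (fst z)"] show ?thesis
        using False by (simp add: ring_distribs)
    qed
  qed
  also have "\<dots> = (\<Sum>z\<leftarrow>zs. of_int (fst z) * cls n (?A z)) + (\<Sum>z\<leftarrow>zs. of_int (?c1 z) * cls (Suc n) (?B z))"
    by (rule sum_list_addf)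
  also have "\<dots> \<approx> 0 + 0" by (intro k0_eq_add 0 1)
  finally show ?case by simp
qed

text \<open>
  The motivic integral of a constructible function \<open>\<phi>\<close> on affine \<open>n\<close>-space: linear in \<open>\<phi>\<close>, with the
  class of \<open>Z\<close> as integral of the indicator function of a closed set \<open>Z\<close>.
\<close>

definition has_int :: "nat \<Rightarrow> ('k::field alg_closure list \<Rightarrow> int) \<Rightarrow> ('k variety, int) mpoly \<Rightarrow> bool" where
  "has_int n \<phi> \<kappa> \<longleftrightarrow> (\<exists>zs. (\<forall>z\<in>set zs. affine_closed n (snd z)) \<and>
     (\<forall>x. length x = n \<longrightarrow> \<phi> x = (\<Sum>z\<leftarrow>zs. fst z * of_bool (x \<in> snd z))) \<and>
     \<kappa> \<approx> (\<Sum>z\<leftarrow>zs. of_int (fst z) * cls n (snd z)))"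

lemma has_int_closed: "affine_closed n Z \<Longrightarrow> has_int n (\<lambda>x. of_bool (x \<in> Z)) (cls n Z)"
  unfolding has_int_def by (rule exI[of _ "[(1, Z)]"]) simp

lemma has_int_0: "has_int n (\<lambda>_. 0) 0"
  unfolding has_int_def by (rule exI[of _ "[]"]) simp

lemma has_int_cong:
  "has_int n \<phi> \<kappa> \<Longrightarrow> (\<And>x. length x = n \<Longrightarrow> \<phi> x = \<psi> x) \<Longrightarrow> has_int n \<psi> \<kappa>"
  unfolding has_int_def by auto

lemma has_int_add:
  assumes "has_int n \<phi> \<kappa>" "has_int n \<psi> \<mu>"
  shows "has_int n (\<lambda>x. \<phi> x + \<psi> x) (\<kappa> + \<mu>)"
proof -
  obtain zs where 1: "\<forall>z\<in>set zs. affine_closed n (snd z)"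
     "\<forall>x. length x = n \<longrightarrow> \<phi> x = (\<Sum>z\<leftarrow>zs. fst z * of_bool (x \<in> snd z))"
     "\<kappa> \<approx> (\<Sum>z\<leftarrow>zs. of_int (fst z) * cls n (snd z))" using assms(1) unfolding has_int_def by blast
  obtain ws where 2: "\<forall>z\<in>set ws. affine_closed n (snd z)"
     "\<forall>x. length x = n \<longrightarrow> \<psi> x = (\<Sum>z\<leftarrow>ws. fst z * of_bool (x \<in> snd z))"
     "\<mu> \<approx> (\<Sum>z\<leftarrow>ws. of_int (fst z) * cls n (snd z))" using assms(2) unfolding has_int_def by blast
  show ?thesis unfolding has_int_def
    by (rule exI[of _ "zs @ ws"]) (use 1 2 in \<open>auto intro: k0_eq_add\<close>)
qed

lemma has_int_scale:
  assumes "has_int n \<phi> \<kappa>"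
  shows "has_int n (\<lambda>x. c * \<phi> x) (of_int c * \<kappa>)"
proof -
  obtain zs where 1: "\<forall>z\<in>set zs. affine_closed n (snd z)"
     "\<forall>x. length x = n \<longrightarrow> \<phi> x = (\<Sum>z\<leftarrow>zs. fst z * of_bool (x \<in> snd z))"
     "\<kappa> \<approx> (\<Sum>z\<leftarrow>zs. of_int (fst z) * cls n (snd z))" using assms(1) unfolding has_int_def by blast
  have "of_int c * (\<Sum>z\<leftarrow>zs. of_int (fst z) * cls n (snd z)) =
     (\<Sum>z\<leftarrow>zs. of_int (c * fst z) * cls n (snd z))"
    by (induction zs) (simp_all add: algebra_simps)
  with k0_eq_mult[OF k0_eq_refl 1(3), of "of_int c"]
  have "of_int c * \<kappa> \<approx> (\<Sum>z\<leftarrow>zs. of_int (c * fst z) * cls n (snd z))" by simp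
  moreover have "c * (\<Sum>z\<leftarrow>zs. fst z * of_bool (x \<in> snd z)) = (\<Sum>z\<leftarrow>zs. c * fst z * of_bool (x \<in> snd z))" for x
    by (induction zs) (simp_all add: algebra_simps)
  ultimately show ?thesis unfolding has_int_def
    by (intro exI[of _ "map (\<lambda>z. (c * fst z, snd z)) zs"]) (use 1 in \<open>auto simp: o_def\<close>)
qed

lemma has_int_diff:
  assumes "has_int n \<phi> \<kappa>" "has_int n \<psi> \<mu>"
  shows "has_int n (\<lambda>x. \<phi> x - \<psi> x) (\<kappa> - \<mu>)"
  using has_int_add[OF assms(1) has_int_scale[OF assms(2), of "-1"]] by simp

lemma has_int_eq_0:
  fixes \<kappa> :: "('k::field variety, int) mpoly"
  assumes "has_int n (\<lambda>_. 0) \<kappa>"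
  shows "\<kappa> \<approx> 0"
proof -
  obtain zs :: "(int \<times> 'k alg_closure list set) list" where 1: "\<forall>z\<in>set zs. affine_closed n (snd z)"
     "\<forall>x. length x = n \<longrightarrow> 0 = (\<Sum>z\<leftarrow>zs. fst z * of_bool (x \<in> snd z))"
     "\<kappa> \<approx> (\<Sum>z\<leftarrow>zs. of_int (fst z) * cls n (snd z))" using assms(1) unfolding has_int_def by blast
  have "\<forall>Z. \<exists>S :: (nat, 'k) mpoly set. affine_closed n Z \<longrightarrow> finite S \<and> Z = zero_locus n S"
    unfolding affine_closed_def by blast
  then obtain S :: "'k alg_closure list set \<Rightarrow> (nat, 'k) mpoly set" where
    S: "\<And>Z. affine_closed n Z \<Longrightarrow> finite (S Z)" "\<And>Z. affine_closed n Z \<Longrightarrow> zero_locus n (S Z) = Z" by metis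
  let ?U = "{x :: 'k alg_closure list. length x = n}"
  let ?zs = "map (\<lambda>z. (fst z, peval ` S (snd z))) zs"
  obtain fs where fs: "set fs = (\<Union>z\<in>set zs. peval ` S (snd z))"
    using finite_list[of "\<Union>z\<in>set zs. peval ` S (snd z)"] 1(1) S(1) by auto
  have Z: "{x \<in> ?U. \<forall>f\<in>peval ` S (snd z). f x = 0} = snd z" if "z \<in> set zs" for z
    using S(2)[of "snd z"] 1(1) that by (auto simp: zero_locus_def)
  have "(\<Sum>z\<leftarrow>?zs. of_int (fst z) * cls n {x \<in> ?U. \<forall>f\<in>snd z. f x = 0}) \<approx> 0"
  proof (rule cls_combination_eq_0[OF affine_closed_UNIV, of fs])
    show "polyfun n f" if "f \<in> set fs" for f using that fs by (auto intro: polyfun_peval)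
    show "snd z \<subseteq> set fs" if "z \<in> set ?zs" for z using that fs by auto
    fix x assume x: "x \<in> ?U"
    have "(\<Sum>z\<leftarrow>?zs. fst z * of_bool (\<forall>f\<in>snd z. f x = 0)) = (\<Sum>z\<leftarrow>zs. fst z * of_bool (x \<in> snd z))"
      unfolding map_map o_def
      by (intro arg_cong[of _ _ sum_list] map_cong refl) (use Z x in \<open>auto simp: of_bool_def\<close>)
    then show "(\<Sum>z\<leftarrow>?zs. fst z * of_bool (\<forall>f\<in>snd z. f x = 0)) = 0" using 1(2) x by simp
  qed
  also have "(\<Sum>z\<leftarrow>?zs. of_int (fst z) * cls n {x \<in> ?U. \<forall>f\<in>snd z. f x = 0}) = (\<Sum>z\<leftarrow>zs. of_int (fst z) * cls n (snd z))"
    unfolding map_map o_def by (intro arg_cong[of _ _ sum_list] map_cong refl) (simp only: fst_conv snd_conv Z)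
  finally show ?thesis using 1(3) k0_eq_trans by blast
qed

text \<open>
  By this lemma the class of a closed set can be computed from any expression of its indicator
  function through other closed sets.
\<close>

lemma has_int_unique: "has_int n \<phi> \<kappa> \<Longrightarrow> has_int n \<phi> \<mu> \<Longrightarrow> \<kappa> \<approx> \<mu>"
  using has_int_eq_0[of n "\<kappa> - \<mu>"] has_int_diff[of n \<phi> \<kappa> \<phi> \<mu>] by (simp add: k0_eq_def)

section \<open>Linear equations in one new variable\<close>

text \<open>
  The solutions \<open>t\<close> over a point \<open>x\<close> form a line, a point or nothing. The induction removes the
  first equation \<open>a t + b = 0\<close>. Where \<open>a\<close> vanishes it is the condition \<open>b = 0\<close> on \<open>x\<close>. Where \<open>a\<close>
  does not vanish it determines \<open>t = - b / a\<close>, and the other equations become the vanishing of the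
  minors \<open>a b\<^sub>i - a\<^sub>i b\<close>; the locus is the difference of the closed sets \<open>?R\<close> and \<open>?Ra\<close> below.
\<close>

lemma cls_linear_system:
  fixes ps :: "(('k::field alg_closure list \<Rightarrow> 'k alg_closure) \<times> ('k alg_closure list \<Rightarrow> 'k alg_closure)) list"
  assumes "affine_closed n X" "\<And>p. p \<in> set ps \<Longrightarrow> polyfun n (fst p) \<and> polyfun n (snd p)"
  shows "\<exists>\<kappa>. has_int n (\<lambda>x. of_bool (x \<in> X \<and> (\<exists>!t. \<forall>p\<in>set ps. fst p x * t + snd p x = 0))) \<kappa> \<and>
     cls (Suc n) {y. length y = Suc n \<and> butlast y \<in> X \<and> (\<forall>p\<in>set ps. fst p (butlast y) * last y + snd p (butlast y) = 0)}
       \<approx> \<kappa> + cls n {x \<in> X. \<forall>p\<in>set ps. fst p x = 0 \<and> snd p x = 0} * lef"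
  using assms
proof (induction ps arbitrary: X)
  case Nil
  have "\<not> (\<exists>!t :: 'k alg_closure. True)" using zero_neq_one by blast
  then show ?case
    using cls_times_line[OF Nil.prems(1)] by (intro exI[of _ 0]) (auto intro: has_int_0)
next
  case (Cons p ps)
  obtain a b where p: "p = (a, b)" by (cases p)
  note X = Cons.prems(1)
  have a: "polyfun n a" and b: "polyfun n b" using Cons.prems(2)[of p] by (auto simp: p)
  let ?X0 = "{x \<in> {x \<in> X. a x = 0}. b x = 0}"
  let ?R = "{x \<in> X. \<forall>f\<in>(\<lambda>q x. a x * snd q x - fst q x * b x) ` set ps. f x = 0}"
  let ?Ra = "{x \<in> ?R. a x = 0}"
  have X0: "affine_closed n ?X0" by (intro affine_closed_polyfun X a b)
  have R: "affine_closed n ?R"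
    using Cons.prems(2) by (intro affine_closed_conditions X) (auto intro!: polyfun_diff polyfun_mult a b)
  have Ra: "affine_closed n ?Ra" by (intro affine_closed_polyfun R a)
  from Cons.IH[OF X0] Cons.prems(2) obtain \<kappa> where
    \<kappa>: "has_int n (\<lambda>x. of_bool (x \<in> ?X0 \<and> (\<exists>!t. \<forall>p\<in>set ps. fst p x * t + snd p x = 0))) \<kappa>"
    "cls (Suc n) {y. length y = Suc n \<and> butlast y \<in> ?X0 \<and> (\<forall>p\<in>set ps. fst p (butlast y) * last y + snd p (butlast y) = 0)}
       \<approx> \<kappa> + cls n {x \<in> ?X0. \<forall>p\<in>set ps. fst p x = 0 \<and> snd p x = 0} * lef"
    by auto
  let ?W = "{y. length y = Suc n \<and> butlast y \<in> X \<and> (\<forall>p\<in>set (p # ps). fst p (butlast y) * last y + snd p (butlast y) = 0)}"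
  have W: "affine_closed (Suc n) ?W"
  proof -
    have "affine_closed (Suc n) {y \<in> {y. length y = Suc n \<and> butlast y \<in> X}.
       \<forall>f\<in>(\<lambda>q y. fst q (butlast y) * last y + snd q (butlast y)) ` set (p # ps). f y = 0}"
    proof (intro affine_closed_conditions affine_closed_butlast X)
      fix f assume "f \<in> (\<lambda>q y. fst q (butlast y) * last y + snd q (butlast y)) ` set (p # ps)"
      then obtain q where q: "q \<in> set (p # ps)" "f = (\<lambda>y. fst q (butlast y) * last y + snd q (butlast y))"
        by blast
      show "polyfun (Suc n) f"
        unfolding q(2) using Cons.prems(2)[OF q(1)]
        by (intro polyfun_add polyfun_mult polyfun_butlast polyfun_last) blast+
    qed simp
    also have "{y \<in> {y. length y = Suc n \<and> butlast y \<in> X}.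
       \<forall>f\<in>(\<lambda>q y. fst q (butlast y) * last y + snd q (butlast y)) ` set (p # ps). f y = 0} = ?W" by auto
    finally show ?thesis .
  qed
  have W0: "{y \<in> ?W. a (butlast y) = 0} =
     {y. length y = Suc n \<and> butlast y \<in> ?X0 \<and> (\<forall>p\<in>set ps. fst p (butlast y) * last y + snd p (butlast y) = 0)}"
    by (auto simp: p)
  let ?W1 = "{z. length z = Suc (Suc n) \<and> butlast z \<in> ?W \<and> a (butlast (butlast z)) * last z = 1}"
  let ?V = "{y. length y = Suc n \<and> butlast y \<in> ?R \<and> a (butlast y) * last y = 1}"
  have a': "polyfun (Suc n) (\<lambda>y. a (butlast y))" by (rule polyfun_butlast[OF a])
  have W1: "cls (Suc (Suc n)) ?W1 \<approx> cls (Suc n) ?V"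
  proof (rule cls_isomorphic[OF affine_closed_principal_open[OF W a'] affine_closed_principal_open[OF R a],
      where h = "\<lambda>z. butlast (butlast z) @ [last z]" and g = "\<lambda>y. butlast y @ [- b (butlast y) * last y, last y]"])
    fix i assume i: "i < Suc n"
    show "polyfun (Suc (Suc n)) (\<lambda>x. nth_default 0 (butlast (butlast x) @ [last x]) i)"
    proof (cases "i < n")
      case True
      show ?thesis
        by (rule iffD1[OF polyfun_cong polyfun_coord[of _ i]])
           (use True in \<open>auto simp: nth_default_def nth_append nth_butlast\<close>)
    next
      case False
      show ?thesis
        by (rule iffD1[OF polyfun_cong polyfun_last])
           (use False i in \<open>auto simp: nth_default_def nth_append\<close>)
    qed
  next
    fix i assume i: "i < Suc (Suc n)"
    show "polyfun (Suc n) (\<lambda>y. nth_default 0 (butlast y @ [- b (butlast y) * last y, last y]) i)"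
    proof (cases "i < n")
      case True
      show ?thesis
        by (rule iffD1[OF polyfun_cong polyfun_coord[of _ i]])
           (use True in \<open>auto simp: nth_default_def nth_append nth_butlast\<close>)
    next
      case False
      then consider "i = n" | "i = Suc n" using i by linarith
      then show ?thesis
      proof cases
        case 1
        have "polyfun (Suc n) (\<lambda>y. - b (butlast y) * last y)"
          by (intro polyfun_mult polyfun_uminus polyfun_butlast b polyfun_last)
        then show ?thesis
          by (rule iffD1[OF polyfun_cong, rotated]) (use 1 in \<open>auto simp: nth_default_def nth_append\<close>)
      next
        case 2
        show ?thesis
          by (rule iffD1[OF polyfun_cong polyfun_last]) (use 2 in \<open>auto simp: nth_default_def nth_append\<close>)
      qed
    qed
  next
    fix z assume z: "z \<in> ?W1"
    let ?x = "butlast (butlast z)" let ?t = "last (butlast z)" let ?s = "last z"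
    have z1: "length z = Suc (Suc n)" "?x \<in> X" "a ?x * ?s = 1" and
      z2: "\<And>q. q \<in> set (p # ps) \<Longrightarrow> fst q ?x * ?t + snd q ?x = 0" using z by auto
    have ab: "a ?x * ?t + b ?x = 0" using z2[of p] by (simp add: p)
    have "a ?x * snd q ?x - fst q ?x * b ?x = 0" if "q \<in> set ps" for q
    proof -
      have q: "fst q ?x * ?t + snd q ?x = 0" using z2[of q] that by simp
      have "a ?x * snd q ?x - fst q ?x * b ?x =
         a ?x * (fst q ?x * ?t + snd q ?x) - fst q ?x * (a ?x * ?t + b ?x)"
        by (simp add: algebra_simps)
      then show ?thesis unfolding q ab by simp
    qed
    then show "butlast (butlast z) @ [last z] \<in> ?V" using z1 by auto
    have t: "- b ?x * ?s = ?t"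
    proof -
      have "- b ?x = a ?x * ?t" using ab by (simp add: add_eq_0_iff)
      then have "- b ?x * ?s = (a ?x * ?s) * ?t" by (simp add: algebra_simps)
      then show ?thesis unfolding z1 by simp
    qed
    have "0 < length (butlast z)" "0 < length z" by (simp_all add: z1(1))
    then have nonempty: "butlast z \<noteq> []" "z \<noteq> []" unfolding length_greater_0_conv .
    have "?x @ [?t, ?s] = (?x @ [?t]) @ [?s]" by (simp only: append_assoc append_Cons append_Nil)
    also have "\<dots> = z" unfolding append_butlast_last_id[OF nonempty(1)] append_butlast_last_id[OF nonempty(2)] ..
    finally have "?x @ [?t, ?s] = z" .
    then show "butlast (butlast (butlast z) @ [last z]) @
         [- b (butlast (butlast (butlast z) @ [last z])) * last (butlast (butlast z) @ [last z]),
          last (butlast (butlast z) @ [last z])] = z"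
      unfolding butlast_snoc last_snoc t .
  next
    fix y assume y: "y \<in> ?V"
    let ?x = "butlast y" let ?s = "last y"
    let ?g = "?x @ [- b ?x * ?s, ?s]"
    have y1: "length y = Suc n" "?x \<in> X" "a ?x * ?s = 1" using y by auto
    have y2: "a ?x * snd q ?x = fst q ?x * b ?x" if "q \<in> set ps" for q using y that by auto
    have g: "butlast ?g = ?x @ [- b ?x * ?s]" "last ?g = ?s" by (simp_all add: butlast_append)
    have "fst q ?x * (- b ?x * ?s) + snd q ?x = 0" if "q \<in> set (p # ps)" for q
    proof (cases "q = p")
      case True
      have "a ?x * (- b ?x * ?s) + b ?x = b ?x * (1 - a ?x * ?s)" by (simp add: algebra_simps)
      then show ?thesis unfolding y1 True p by simp
    next
      case False
      then have q: "q \<in> set ps" using that by simp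
      have "fst q ?x * (- b ?x * ?s) + snd q ?x = - (fst q ?x * b ?x) * ?s + snd q ?x" by simp
      also have "\<dots> = snd q ?x * (1 - a ?x * ?s)" unfolding y2[OF q, symmetric] by (simp add: algebra_simps)
      finally show ?thesis unfolding y1 by simp
    qed
    then show "?g \<in> ?W1" using y1 unfolding mem_Collect_eq g butlast_snoc last_snoc by simp
    have "y \<noteq> []" using y1 by auto
    then show "butlast (butlast ?g) @ [last ?g] = y" unfolding g butlast_snoc by simp
  qed
  let ?\<kappa> = "\<kappa> + (cls n ?R - cls n ?Ra)"
  have "cls (Suc n) ?W \<approx> cls (Suc n) {y \<in> ?W. a (butlast y) = 0} + cls (Suc (Suc n)) ?W1"
    by (rule cls_scissors[OF W a'])
  also have "\<dots> \<approx> (\<kappa> + cls n {x \<in> ?X0. \<forall>p\<in>set ps. fst p x = 0 \<and> snd p x = 0} * lef) + (cls n ?R - cls n ?Ra)"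
  proof (rule k0_eq_add)
    show "cls (Suc n) {y \<in> ?W. a (butlast y) = 0} \<approx> \<kappa> + cls n {x \<in> ?X0. \<forall>p\<in>set ps. fst p x = 0 \<and> snd p x = 0} * lef"
      unfolding W0 by (rule \<kappa>(2))
    have "cls n ?R - cls n ?Ra \<approx> (cls n ?Ra + cls (Suc n) ?V) - cls n ?Ra"
      by (rule k0_eq_diff[OF cls_scissors[OF R a] k0_eq_refl])
    then have "cls n ?R - cls n ?Ra \<approx> cls (Suc n) ?V" unfolding add_diff_cancel_left' .
    from k0_eq_trans[OF W1 k0_eq_sym[OF this]]
    show "cls (Suc (Suc n)) ?W1 \<approx> cls n ?R - cls n ?Ra" .
  qed
  also have "\<dots> = ?\<kappa> + cls n {x \<in> X. \<forall>p\<in>set (p # ps). fst p x = 0 \<and> snd p x = 0} * lef"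
  proof -
    have "{x \<in> ?X0. \<forall>p\<in>set ps. fst p x = 0 \<and> snd p x = 0} = {x \<in> X. \<forall>p\<in>set (p # ps). fst p x = 0 \<and> snd p x = 0}"
      by (auto simp: p)
    then show ?thesis by (simp only: add.assoc add.commute add.left_commute)
  qed
  finally have *: "cls (Suc n) ?W \<approx> ?\<kappa> + cls n {x \<in> X. \<forall>p\<in>set (p # ps). fst p x = 0 \<and> snd p x = 0} * lef" .
  have "has_int n (\<lambda>x. of_bool (x \<in> X \<and> (\<exists>!t. \<forall>p\<in>set (p # ps). fst p x * t + snd p x = 0))) ?\<kappa>"
  proof (rule has_int_cong[OF has_int_add[OF \<kappa>(1) has_int_diff[OF has_int_closed[OF R] has_int_closed[OF Ra]]]])
    fix x :: "'k alg_closure list" assume "length x = n"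
    show "of_bool (x \<in> ?X0 \<and> (\<exists>!t. \<forall>p\<in>set ps. fst p x * t + snd p x = 0)) + (of_bool (x \<in> ?R) - of_bool (x \<in> ?Ra)) =
       (of_bool (x \<in> X \<and> (\<exists>!t. \<forall>p\<in>set (p # ps). fst p x * t + snd p x = 0)) :: int)"
    proof (cases "a x = 0")
      case True
      show ?thesis
      proof (cases "b x = 0")
        case True
        then show ?thesis using \<open>a x = 0\<close> by (simp add: p)
      next
        case False
        then have "\<not> (\<exists>!t. \<forall>p\<in>set (p # ps). fst p x * t + snd p x = 0)" using \<open>a x = 0\<close> by (auto simp: p)
        then show ?thesis using \<open>a x = 0\<close> False by simp
      qed
    next
      case False
      have "(\<exists>!t. \<forall>p\<in>set (p # ps). fst p x * t + snd p x = 0) \<longleftrightarrow> (\<forall>q\<in>set ps. a x * snd q x - fst q x * b x = 0)"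
      proof -
        have t: "a x * t + b x = 0 \<longleftrightarrow> t = - b x / a x" for t
          using False by (auto simp: field_simps add_eq_0_iff)
        have "(\<exists>!t. \<forall>p\<in>set (p # ps). fst p x * t + snd p x = 0) \<longleftrightarrow>
           (\<forall>q\<in>set ps. fst q x * (- b x / a x) + snd q x = 0)"
          by (auto simp: p t)
        also have "\<dots> \<longleftrightarrow> (\<forall>q\<in>set ps. a x * snd q x - fst q x * b x = 0)"
          using False by (intro ball_cong refl) (auto simp: field_simps)
        finally show ?thesis .
      qed
      then show ?thesis using False by simp
    qed
  qed
  with * show ?case by blast
qed

definition polyL :: "('k::field variety, int) mpoly \<Rightarrow> bool" where
  "polyL \<kappa> \<longleftrightarrow> (\<exists>d c. \<kappa> \<approx> (\<Sum>i<d. of_int (c i) * lef ^ i))"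

lemma polyL_cong: "\<kappa> \<approx> \<mu> \<Longrightarrow> polyL \<mu> \<Longrightarrow> polyL \<kappa>"
  unfolding polyL_def using k0_eq_trans by blast

lemma polyL_0: "polyL 0"
  unfolding polyL_def by (rule exI[of _ 0]) simp

lemma polyL_1: "polyL 1"
  unfolding polyL_def by (rule exI[of _ 1], rule exI[of _ "\<lambda>_. 1"]) simp

lemma polyL_add:
  assumes "polyL \<kappa>" "polyL \<mu>"
  shows "polyL (\<kappa> + \<mu>)"
proof -
  obtain d c where 1: "\<kappa> \<approx> (\<Sum>i<d. of_int (c i) * lef ^ i)" using assms(1) unfolding polyL_def by blast
  obtain d' c' where 2: "\<mu> \<approx> (\<Sum>i<d'. of_int (c' i) * lef ^ i)" using assms(2) unfolding polyL_def by blast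
  have ext: "(\<Sum>i<d. of_int (c i) * lef ^ i) = (\<Sum>i<max d d'. of_int (if i < d then c i else 0) * (lef :: ('a variety, int) mpoly) ^ i)"
    for d d' :: nat and c by (rule sum.mono_neutral_cong_left) auto
  have "\<kappa> + \<mu> \<approx> (\<Sum>i<d. of_int (c i) * lef ^ i) + (\<Sum>i<d'. of_int (c' i) * lef ^ i)"
    by (rule k0_eq_add[OF 1 2])
  also have "\<dots> = (\<Sum>i<max d d'. of_int ((if i < d then c i else 0) + (if i < d' then c' i else 0)) * lef ^ i)"
    unfolding ext[of c d d'] ext[of c' d' d] max.commute[of d' d]
    by (simp add: sum.distrib[symmetric] ring_distribs)
  finally show ?thesis unfolding polyL_def by (intro exI)
qed

lemma polyL_scale: "polyL \<kappa> \<Longrightarrow> polyL (of_int a * \<kappa>)"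
proof -
  assume "polyL \<kappa>"
  then obtain d c where 1: "\<kappa> \<approx> (\<Sum>i<d. of_int (c i) * lef ^ i)" unfolding polyL_def by blast
  have "of_int a * \<kappa> \<approx> of_int a * (\<Sum>i<d. of_int (c i) * lef ^ i)" by (intro k0_eq_mult k0_eq_refl 1)
  also have "\<dots> = (\<Sum>i<d. of_int (a * c i) * lef ^ i)" by (simp add: sum_distrib_left mult.assoc)
  finally show ?thesis unfolding polyL_def by (intro exI)
qed

lemma polyL_lef: "polyL \<kappa> \<Longrightarrow> polyL (\<kappa> * lef)"
proof -
  assume "polyL \<kappa>"
  then obtain d c where 1: "\<kappa> \<approx> (\<Sum>i<d. of_int (c i) * lef ^ i)" unfolding polyL_def by blast
  have "\<kappa> * lef \<approx> (\<Sum>i<d. of_int (c i) * lef ^ i) * lef" by (intro k0_eq_mult k0_eq_refl 1)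
  also have "\<dots> = (\<Sum>i<Suc d. of_int (case i of 0 \<Rightarrow> 0 | Suc i \<Rightarrow> c i) * lef ^ i)"
    by (simp add: sum.lessThan_Suc_shift sum_distrib_right sum_distrib_left mult_ac del: sum.lessThan_Suc)
  finally show ?thesis unfolding polyL_def by (intro exI)
qed

definition poly_int :: "nat \<Rightarrow> ('k::field alg_closure list \<Rightarrow> int) \<Rightarrow> bool" where
  "poly_int n \<phi> \<longleftrightarrow> (\<exists>\<kappa>. has_int n \<phi> \<kappa> \<and> polyL \<kappa>)"

lemma poly_int_cong: "poly_int n \<phi> \<Longrightarrow> (\<And>x. length x = n \<Longrightarrow> \<phi> x = \<psi> x) \<Longrightarrow> poly_int n \<psi>"
  unfolding poly_int_def using has_int_cong by blast

lemma poly_int_add: "poly_int n \<phi> \<Longrightarrow> poly_int n \<psi> \<Longrightarrow> poly_int n (\<lambda>x. \<phi> x + \<psi> x)"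
  unfolding poly_int_def using has_int_add polyL_add by blast

lemma poly_int_scale: "poly_int n \<phi> \<Longrightarrow> poly_int n (\<lambda>x. c * \<phi> x)"
  unfolding poly_int_def using has_int_scale polyL_scale by blast

lemma poly_int_diff: "poly_int n \<phi> \<Longrightarrow> poly_int n \<psi> \<Longrightarrow> poly_int n (\<lambda>x. \<phi> x - \<psi> x)"
  using poly_int_add[OF _ poly_int_scale[of n \<psi> "-1"]] by fastforce

lemma poly_int_0: "poly_int n (\<lambda>_. 0)"
  unfolding poly_int_def using has_int_0 polyL_0 by blast

text \<open>
  Integration over the last variable: a fibre that is a point contributes 1, a fibre that is a line
  contributes the class of the line.
\<close>

lemma poly_int_linear_system:
  fixes ps :: "(('k::field alg_closure list \<Rightarrow> 'k alg_closure) \<times> ('k alg_closure list \<Rightarrow> 'k alg_closure)) list"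
  assumes ps: "\<And>p. p \<in> set ps \<Longrightarrow> polyfun n (fst p) \<and> polyfun n (snd p)"
    and unique: "poly_int n (\<lambda>x. of_bool (\<exists>!t. \<forall>p\<in>set ps. fst p x * t + snd p x = 0))"
    and full: "poly_int n (\<lambda>x. of_bool (\<forall>p\<in>set ps. fst p x = 0 \<and> snd p x = 0))"
  shows "poly_int (Suc n) (\<lambda>y. of_bool (\<forall>p\<in>set ps. fst p (butlast y) * last y + snd p (butlast y) = 0))"
proof -
  let ?X = "{x :: 'k alg_closure list. length x = n}"
  let ?F = "{x \<in> ?X. \<forall>p\<in>set ps. fst p x = 0 \<and> snd p x = 0}"
  let ?W = "{y. length y = Suc n \<and> butlast y \<in> ?X \<and> (\<forall>p\<in>set ps. fst p (butlast y) * last y + snd p (butlast y) = 0)}"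
  obtain \<kappa> where \<kappa>: "has_int n (\<lambda>x. of_bool (x \<in> ?X \<and> (\<exists>!t. \<forall>p\<in>set ps. fst p x * t + snd p x = 0))) \<kappa>"
     "cls (Suc n) ?W \<approx> \<kappa> + cls n ?F * lef"
    using cls_linear_system[OF affine_closed_UNIV ps] by blast
  obtain \<mu> where \<mu>: "has_int n (\<lambda>x. of_bool (\<exists>!t. \<forall>p\<in>set ps. fst p x * t + snd p x = 0)) \<mu>" "polyL \<mu>"
    using unique unfolding poly_int_def by blast
  have "has_int n (\<lambda>x. of_bool (\<exists>!t. \<forall>p\<in>set ps. fst p x * t + snd p x = 0)) \<kappa>"
    by (rule has_int_cong[OF \<kappa>(1)]) simp
  then have \<kappa>L: "polyL \<kappa>" using has_int_unique[OF _ \<mu>(1)] polyL_cong \<mu>(2) by blast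
  obtain \<nu> where \<nu>: "has_int n (\<lambda>x. of_bool (\<forall>p\<in>set ps. fst p x = 0 \<and> snd p x = 0)) \<nu>" "polyL \<nu>"
    using full unfolding poly_int_def by blast
  have "affine_closed n {x \<in> ?X. \<forall>f\<in>fst ` set ps \<union> snd ` set ps. f x = 0}"
    using ps by (intro affine_closed_conditions affine_closed_UNIV) auto
  also have "{x \<in> ?X. \<forall>f\<in>fst ` set ps \<union> snd ` set ps. f x = 0} = ?F" by auto
  finally have F: "affine_closed n ?F" .
  have "has_int n (\<lambda>x. of_bool (\<forall>p\<in>set ps. fst p x = 0 \<and> snd p x = 0)) (cls n ?F)"
    by (rule has_int_cong[OF has_int_closed[OF F]]) simp
  then have "polyL (cls n ?F)" using has_int_unique[OF _ \<nu>(1)] polyL_cong \<nu>(2) by blast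
  then have "polyL (cls (Suc n) ?W)"
    using \<kappa>(2) \<kappa>L polyL_cong polyL_add polyL_lef by blast
  have "affine_closed (Suc n) {y \<in> {y. length y = Suc n}.
       \<forall>f\<in>(\<lambda>q y. fst q (butlast y) * last y + snd q (butlast y)) ` set ps. f y = 0}"
    using ps
    by (intro affine_closed_conditions affine_closed_UNIV)
       (auto intro!: polyfun_add polyfun_mult polyfun_butlast polyfun_last)
  also have "{y \<in> {y. length y = Suc n}.
       \<forall>f\<in>(\<lambda>q y. fst q (butlast y) * last y + snd q (butlast y)) ` set ps. f y = 0} = ?W" by auto
  finally have W: "affine_closed (Suc n) ?W" .
  have "has_int (Suc n) (\<lambda>y. of_bool (\<forall>p\<in>set ps. fst p (butlast y) * last y + snd p (butlast y) = 0)) (cls (Suc n) ?W)"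
    by (rule has_int_cong[OF has_int_closed[OF W]]) simp
  then show ?thesis using \<open>polyL (cls (Suc n) ?W)\<close> unfolding poly_int_def by blast
qed

text \<open>
  Affine \<open>(n + 1)\<close>-space is the solution set of the empty system of equations over affine \<open>n\<close>-space.
\<close>

lemma poly_int_1: "poly_int n (\<lambda>_. 1)"
proof (induction n)
  case 0
  have "{x :: 'a alg_closure list. length x = 0} = {[]}" by auto
  then have "has_int 0 (\<lambda>x :: 'a alg_closure list. of_bool (x \<in> {[]})) (cls 0 {[]})"
    using has_int_closed[OF affine_closed_UNIV[of 0]] by metis
  then have "has_int 0 (\<lambda>_. 1) (cls 0 {[] :: 'a alg_closure list})"
    by (rule has_int_cong) simp
  then show ?case unfolding poly_int_def using polyL_cong[OF cls_point polyL_1] by blast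
next
  case (Suc n)
  have "\<not> (\<exists>!t :: 'a alg_closure. True)" using zero_neq_one by blast
  then have "poly_int n (\<lambda>x :: 'a alg_closure list. of_bool (\<exists>!t :: 'a alg_closure. True))"
    using poly_int_0[of n] by simp
  with poly_int_linear_system[of "[] :: (('a alg_closure list \<Rightarrow> 'a alg_closure) \<times> _) list" n] Suc
  show ?case by simp
qed

lemma polyL_cls:
  assumes "affine_closed n Z" "poly_int n (\<lambda>x. of_bool (x \<in> Z))"
  shows "polyL (cls n Z)"
  using has_int_closed[OF assms(1)] assms(2) has_int_unique polyL_cong unfolding poly_int_def by blast

lemma K0_class_of_polyL:
  fixes S :: "(nat, 'k::field) mpoly set"
  assumes "finite S" "polyL (cls n (zero_locus n S))"
  shows "\<exists>(d :: nat) (c :: nat \<Rightarrow> int). K0_class (affine_variety n S) =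
      (\<Oplus>\<^bsub>K0\<^esub>i\<in>{..d}. [c i] \<cdot>\<^bsub>K0\<^esub> (lefschetz [^]\<^bsub>K0\<^esub> i))"
proof -
  obtain d c where "mvar (affine_variety n S) \<approx> (\<Sum>i<d. of_int (c i) * lef ^ i)"
    using assms(2) unfolding polyL_def zero_locus_eq_affine_variety[OF assms(1)] by blast
  also have "(\<Sum>i<d. of_int (c i) * lef ^ i) = (\<Sum>i\<le>d. of_int (if i < d then c i else 0) * (lef :: ('k variety, int) mpoly) ^ i)"
    by (rule sum.mono_neutral_cong_left) auto
  finally show ?thesis by (intro exI K0_class_eqI)
qed

text \<open>
  The recursion over the edges numbers the coordinates in its own order. Permuting the coordinates
  is an isomorphism.
\<close>

lemma polyL_permuted:
  fixes Z :: "'k::field alg_closure list set"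
  assumes Z: "affine_closed n Z" and \<sigma>: "bij_betw \<sigma> {..<n} {..<n}"
    and int: "poly_int n (\<lambda>p. of_bool (map (\<lambda>j. p ! inv_into {..<n} \<sigma> j) [0..<n] \<in> Z))"
  shows "polyL (cls n Z)"
proof -
  let ?\<tau> = "inv_into {..<n} \<sigma>"
  let ?g = "\<lambda>p :: 'k alg_closure list. map (\<lambda>j. p ! ?\<tau> j) [0..<n]"
  let ?h = "\<lambda>x :: 'k alg_closure list. map (\<lambda>i. x ! \<sigma> i) [0..<n]"
  have \<tau>: "bij_betw ?\<tau> {..<n} {..<n}" by (rule bij_betw_inv_into[OF \<sigma>])
  have \<sigma>n: "\<sigma> i < n" if "i < n" for i using \<sigma> that by (auto simp: bij_betw_def)
  have \<tau>n: "?\<tau> i < n" if "i < n" for i using \<tau> that by (auto simp: bij_betw_def)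
  have inv: "\<sigma> (?\<tau> i) = i" "?\<tau> (\<sigma> i) = i" if "i < n" for i
    using bij_betw_inv_into_right[OF \<sigma>] bij_betw_inv_into_left[OF \<sigma>] that by auto
  have pf: "polyfun n (\<lambda>x :: 'k alg_closure list. nth_default 0 (map (\<lambda>i. x ! \<rho> i) [0..<n]) i)"
    if "i < n" "\<And>i. i < n \<Longrightarrow> \<rho> i < n" for i and \<rho> :: "nat \<Rightarrow> nat"
    using that polyfun_nth[of "\<rho> i" n] by (simp add: nth_default_def)
  let ?Z = "{p. length p = n \<and> ?g p \<in> Z}"
  have Z': "affine_closed n ?Z"
    by (rule affine_closed_preimage[OF Z]) (use pf[OF _ \<tau>n] in simp_all)
  note Zs = affine_closed_subset[OF Z]
  have gh: "?g (?h x) = x" if "length x = n" for x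
    using that \<tau>n inv by (intro nth_equalityI) auto
  have hg: "?h (?g p) = p" if "length p = n" for p
    using that \<sigma>n inv by (intro nth_equalityI) auto
  have "cls n Z \<approx> cls n ?Z"
    by (rule cls_isomorphic[OF Z Z', where h = ?h and g = ?g])
       (use pf[OF _ \<tau>n] pf[OF _ \<sigma>n] gh hg Zs in auto)
  moreover have "polyL (cls n ?Z)"
    by (rule polyL_cls[OF Z'], rule poly_int_cong[OF int]) simp
  ultimately show ?thesis by (rule polyL_cong)
qed

section \<open>Lagrangian planes in four-space\<close>

datatype 'a vec4 = Vec 'a 'a 'a 'a
text \<open>
  The values at one point of five polynomials attached to a graph with marked vertices \<open>a, b, d\<close>.
  They are sums over spanning forests, weighted by the product of the variables of the edges outside
  the forest: \<open>f\<^sub>0\<close> over spanning trees; \<open>f\<^sub>1\<close>, \<open>f\<^sub>2\<close> and \<open>f\<^sub>3\<close> over forests with two trees, one of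
  which contains only \<open>a\<close>, only \<open>b\<close> or only \<open>d\<close> of the marked vertices and the other one the other
  two; \<open>f\<^sub>4\<close> over forests with three trees that each contain one marked vertex. This interpretation
  motivates the formulas; the proofs use the recursive description in \<open>represents\<close> below.
\<close>

datatype 'a state = State 'a 'a 'a 'a 'a

text \<open>
  The symplectic form for which the coordinates 1 and 3, and 2 and 4, are conjugate.
\<close>

fun sp :: "'a::comm_ring_1 vec4 \<Rightarrow> 'a vec4 \<Rightarrow> 'a" where
  "sp (Vec x1 x2 x3 x4) (Vec y1 y2 y3 y4) = x1 * y3 - x3 * y1 + x2 * y4 - x4 * y2"

fun lc :: "'a::comm_ring_1 \<Rightarrow> 'a vec4 \<Rightarrow> 'a \<Rightarrow> 'a vec4 \<Rightarrow> 'a vec4" where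
  "lc p (Vec x1 x2 x3 x4) q (Vec y1 y2 y3 y4) = Vec (p * x1 + q * y1) (p * x2 + q * y2) (p * x3 + q * y3) (p * x4 + q * y4)"

abbreviation zv :: "'a::zero vec4" where "zv \<equiv> Vec 0 0 0 0"

text \<open>
  The entries at the positions \<open>(1, 3)\<close> and \<open>(2, 4)\<close> are opposite, which makes the form primitive
  with respect to \<open>sp\<close>. Its Pfaffian is \<open>f\<^sub>0 f\<^sub>4 - f\<^sub>1 f\<^sub>2 - f\<^sub>1 f\<^sub>3 - f\<^sub>2 f\<^sub>3\<close>. So on the quadric
  the form is decomposable, and if it is nonzero its radical is a Lagrangian plane.
\<close>

fun om :: "'a::comm_ring_1 state \<Rightarrow> 'a vec4 \<Rightarrow> 'a vec4 \<Rightarrow> 'a" where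
  "om (State f0 f1 f2 f3 f4) (Vec x1 x2 x3 x4) (Vec y1 y2 y3 y4) =
     f0 * (x1 * y2 - x2 * y1) - f3 * (x1 * y3 - x3 * y1) - (f2 + f3) * (x1 * y4 - x4 * y1)
     + (f1 + f3) * (x2 * y3 - x3 * y2) + f3 * (x2 * y4 - x4 * y2) + f4 * (x3 * y4 - x4 * y3)"

fun on_quadric :: "'a::comm_ring_1 state \<Rightarrow> bool" where
  "on_quadric (State f0 f1 f2 f3 f4) \<longleftrightarrow> f0 * f4 = f1 * f2 + f1 * f3 + f2 * f3"

lemma sp_lc: "sp (lc p x q y) z = p * sp x z + q * sp y z" "sp z (lc p x q y) = p * sp z x + q * sp z y"
  subgoal by (cases x; cases y; cases z) (simp add: algebra_simps)
  subgoal by (cases x; cases y; cases z) (simp add: algebra_simps)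
  done

lemma sp_self [simp]: "sp x x = 0"
  by (cases x) simp

lemma sp_skew: "sp y x = - sp x y"
  by (cases x; cases y) (simp add: algebra_simps)

lemma om_lc: "om f (lc p x q y) z = p * om f x z + q * om f y z" "om f z (lc p x q y) = p * om f z x + q * om f z y"
  subgoal by (cases f; cases x; cases y; cases z) (simp add: algebra_simps)
  subgoal by (cases f; cases x; cases y; cases z) (simp add: algebra_simps)
  done

lemma om_self [simp]: "om f x x = 0"
  by (cases f; cases x) simp

lemma om_skew: "om f y x = - om f x y"
  by (cases f; cases x; cases y) (simp add: algebra_simps)

lemma sp_zv [simp]: "sp zv x = 0" "sp x zv = 0"
  by (cases x; simp; fail)+

lemma om_zv [simp]: "om f zv x = 0" "om f x zv = 0"
  by (cases f; cases x; simp; fail)+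

lemma sp_nondegenerate:
  assumes "\<And>y. sp x y = 0"
  shows "x = zv"
proof -
  obtain x1 x2 x3 x4 where x: "x = (Vec x1 x2 x3 x4)" by (cases x)
  show ?thesis
    using assms[of "(Vec 1 0 0 0)"] assms[of "(Vec 0 1 0 0)"] assms[of "(Vec 0 0 1 0)"] assms[of "(Vec 0 0 0 1)"]
    by (simp add: x)
qed

text \<open>
  The exterior product of \<open>om f\<close> and \<open>sp\<close> vanishes. As the identity is linear in \<open>f\<close>, it suffices to
  check it for five basis states.
\<close>

lemma om_primitive:
  "om f x y * sp z t - om f x z * sp y t + om f x t * sp y z + om f y z * sp x t - om f y t * sp x z + om f z t * sp x y = 0"
proof -
  obtain a b c d e where f: "f = (State a b c d e)" by (cases f)
  obtain x1 x2 x3 x4 where x: "x = (Vec x1 x2 x3 x4)" by (cases x)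
  obtain y1 y2 y3 y4 where y: "y = (Vec y1 y2 y3 y4)" by (cases y)
  obtain z1 z2 z3 z4 where z: "z = (Vec z1 z2 z3 z4)" by (cases z)
  obtain t1 t2 t3 t4 where t: "t = (Vec t1 t2 t3 t4)" by (cases t)
  let ?P = "\<lambda>f. om f x y * sp z t - om f x z * sp y t + om f x t * sp y z + om f y z * sp x t - om f y t * sp x z + om f z t * sp x y"
  have "?P f = a * ?P (State 1 0 0 0 0) + b * ?P (State 0 1 0 0 0) + c * ?P (State 0 0 1 0 0) + d * ?P (State 0 0 0 1 0) + e * ?P (State 0 0 0 0 1)"
    proof -
    have lin: "om f u v = a * om (State 1 0 0 0 0) u v + b * om (State 0 1 0 0 0) u v + c * om (State 0 0 1 0 0) u v
        + d * om (State 0 0 0 1 0) u v + e * om (State 0 0 0 0 1) u v" for u v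
      unfolding f by (cases u; cases v) (simp add: algebra_simps)
    show ?thesis unfolding lin by (simp only: ring_distribs mult.assoc add_ac diff_conv_add_uminus minus_add_distrib mult_minus_right mult_minus_left)
  qed
  moreover have "?P (State 1 0 0 0 0) = 0" "?P (State 0 1 0 0 0) = 0" "?P (State 0 0 1 0 0) = 0" "?P (State 0 0 0 1 0) = 0" "?P (State 0 0 0 0 1) = 0"
    unfolding x y z t by (simp_all add: algebra_simps)
  ultimately show ?thesis by simp
qed

text \<open>
  The endomorphism that turns \<open>sp\<close> into \<open>om f\<close>. Its square is the Pfaffian of \<open>om f\<close> times the
  identity.
\<close>

fun om_map :: "'a::comm_ring_1 state \<Rightarrow> 'a vec4 \<Rightarrow> 'a vec4" where
  "om_map (State f0 f1 f2 f3 f4) (Vec x1 x2 x3 x4) =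
     Vec ((f1 + f3) * x2 - f3 * x1 - f4 * x4) (f3 * x2 + f4 * x3 - (f2 + f3) * x1)
      (f0 * x2 - f3 * x3 - (f2 + f3) * x4) ((f1 + f3) * x3 + f3 * x4 - f0 * x1)"

lemma om_eq_sp: "om f x y = sp (om_map f x) y"
  by (cases f; cases x; cases y; simp add: algebra_simps)

lemma om_map_om_map:
  assumes "on_quadric f"
  shows "om_map f (om_map f x) = zv"
proof -
  obtain a b c d e where f: "f = (State a b c d e)" by (cases f)
  obtain x1 x2 x3 x4 where x: "x = (Vec x1 x2 x3 x4)" by (cases x)
  have "om_map f (om_map f x) =
    lc (a * e - (b * c + b * d + c * d)) x 0 x"
    unfolding f x by (simp add: algebra_simps)
  then show ?thesis using assms by (simp add: f x)
qed

text \<open>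
  The exterior square of \<open>om f\<close> vanishes. It is obtained from \<open>om_primitive\<close> by inserting
  \<open>om_map f t\<close> in the last place, because \<open>om_map f\<close> squares to zero.
\<close>

lemma om_decomposable:
  assumes "on_quadric f"
  shows "om f x y * om f z t - om f x z * om f y t + om f x t * om f y z = 0"
proof -
  have 1: "om f u (om_map f t) = 0" for u
    using om_skew[of f u "om_map f t"] by (simp add: om_eq_sp[of f "om_map f t"] om_map_om_map[OF assms])
  have 2: "sp u (om_map f t) = om f u t" for u
    using sp_skew[of u "om_map f t"] om_skew[of f u t] by (simp add: om_eq_sp)
  show ?thesis
    using om_primitive[of f x y z "om_map f t"] unfolding 1 2 by (simp add: algebra_simps)
qed

text \<open>
  The vector \<open>v\<close> is an eigenvector of the nilpotent endomorphism \<open>om_map f\<close> with eigenvalue \<open>k\<close>.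
\<close>

lemma om_proportional_sp:
  fixes f :: "'a::field state"
  assumes f: "on_quadric f" and v: "v \<noteq> zv" and eq: "\<And>y. om f v y = k * sp v y"
  shows "k = 0"
proof -
  have "sp (lc 1 (om_map f v) (- k) v) y = 0" for y
    using eq[of y] by (simp add: sp_lc om_eq_sp)
  then have "lc 1 (om_map f v) (- k) v = zv" by (rule sp_nondegenerate)
  then have *: "om_map f v = lc k v 0 v" by (cases v; cases "om_map f v"; simp)
  have "om_map f (lc k v 0 v) = lc k (om_map f v) 0 v" by (cases f; cases v; simp add: algebra_simps)
  then have "zv = lc k (lc k v 0 v) 0 v" using om_map_om_map[OF f, of v] unfolding * by simp
  then show ?thesis using v by (cases v) auto
qed

fun indep :: "'a::comm_ring_1 vec4 \<Rightarrow> 'a vec4 \<Rightarrow> bool" where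
  "indep (Vec x1 x2 x3 x4) (Vec y1 y2 y3 y4) \<longleftrightarrow>
     x1 * y2 \<noteq> x2 * y1 \<or> x1 * y3 \<noteq> x3 * y1 \<or> x1 * y4 \<noteq> x4 * y1 \<or>
     x2 * y3 \<noteq> x3 * y2 \<or> x2 * y4 \<noteq> x4 * y2 \<or> x3 * y4 \<noteq> x4 * y3"

lemma not_indepD:
  fixes x y :: "'a::field vec4"
  assumes "\<not> indep x y" "x \<noteq> zv"
  obtains c where "y = lc c x 0 x"
proof -
  obtain x1 x2 x3 x4 where x: "x = (Vec x1 x2 x3 x4)" by (cases x)
  obtain y1 y2 y3 y4 where y: "y = (Vec y1 y2 y3 y4)" by (cases y)
  have h: "d = c / a * b" if "a \<noteq> 0" "a * d = b * c" for a b c d :: 'a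
    using that by (simp add: field_simps)
  have m: "x1 * y2 = x2 * y1" "x1 * y3 = x3 * y1" "x1 * y4 = x4 * y1"
    "x2 * y3 = x3 * y2" "x2 * y4 = x4 * y2" "x3 * y4 = x4 * y3"
    using assms(1) unfolding x y indep.simps by blast+
  from assms(2) consider "x1 \<noteq> 0" | "x2 \<noteq> 0" | "x3 \<noteq> 0" | "x4 \<noteq> 0" by (auto simp: x)
  then show thesis
  proof cases
    case 1
    show thesis
    proof (rule that[of "y1 / x1"])
      have c1: "y1 = y1 / x1 * x1" using 1 by simp
      have c2: "y2 = y1 / x1 * x2" by (rule h[OF 1 m(1)])
      have c3: "y3 = y1 / x1 * x3" by (rule h[OF 1 m(2)])
      have c4: "y4 = y1 / x1 * x4" by (rule h[OF 1 m(3)])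
      show "y = lc (y1 / x1) x 0 x" unfolding x y lc.simps using c1 c2 c3 c4 by simp
    qed
  next
    case 2
    show thesis
    proof (rule that[of "y2 / x2"])
      have c1: "y1 = y2 / x2 * x1" by (rule h[OF 2]) (use m(1) in \<open>simp only: mult.commute\<close>)
      have c2: "y2 = y2 / x2 * x2" using 2 by simp
      have c3: "y3 = y2 / x2 * x3" by (rule h[OF 2 m(4)])
      have c4: "y4 = y2 / x2 * x4" by (rule h[OF 2 m(5)])
      show "y = lc (y2 / x2) x 0 x" unfolding x y lc.simps using c1 c2 c3 c4 by simp
    qed
  next
    case 3
    show thesis
    proof (rule that[of "y3 / x3"])
      have c1: "y1 = y3 / x3 * x1" by (rule h[OF 3]) (use m(2) in \<open>simp only: mult.commute\<close>)
      have c2: "y2 = y3 / x3 * x2" by (rule h[OF 3]) (use m(4) in \<open>simp only: mult.commute\<close>)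
      have c3: "y3 = y3 / x3 * x3" using 3 by simp
      have c4: "y4 = y3 / x3 * x4" by (rule h[OF 3 m(6)])
      show "y = lc (y3 / x3) x 0 x" unfolding x y lc.simps using c1 c2 c3 c4 by simp
    qed
  next
    case 4
    show thesis
    proof (rule that[of "y4 / x4"])
      have c1: "y1 = y4 / x4 * x1" by (rule h[OF 4]) (use m(3) in \<open>simp only: mult.commute\<close>)
      have c2: "y2 = y4 / x4 * x2" by (rule h[OF 4]) (use m(5) in \<open>simp only: mult.commute\<close>)
      have c3: "y3 = y4 / x4 * x3" by (rule h[OF 4]) (use m(6) in \<open>simp only: mult.commute\<close>)
      have c4: "y4 = y4 / x4 * x4" using 4 by simp
      show "y = lc (y4 / x4) x 0 x" unfolding x y lc.simps using c1 c2 c3 c4 by simp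
    qed
  qed
qed

lemma indep_lc_zero:
  fixes x y :: "'a::field vec4"
  assumes "indep x y" "lc p x q y = zv"
  shows "p = 0" "q = 0"
proof -
  obtain x1 x2 x3 x4 where x: "x = (Vec x1 x2 x3 x4)" by (cases x)
  obtain y1 y2 y3 y4 where y: "y = (Vec y1 y2 y3 y4)" by (cases y)
  have e: "p * x1 + q * y1 = 0" "p * x2 + q * y2 = 0" "p * x3 + q * y3 = 0" "p * x4 + q * y4 = 0"
    using assms(2) unfolding x y lc.simps by blast+
  have p: "p * (a * d - b * c) = (p * a + q * c) * d - (p * b + q * d) * c"
    and q: "q * (a * d - b * c) = (p * b + q * d) * a - (p * a + q * c) * b" for a b c d
    by (simp_all add: algebra_simps)
  have "p = 0 \<or> (a * d = b * c)" if "p * a + q * c = 0" "p * b + q * d = 0" for a b c d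
    using p[of a d b c] unfolding that by simp
  note pm = this
  show "p = 0"
    using assms(1) pm[OF e(1) e(2)] pm[OF e(1) e(3)] pm[OF e(1) e(4)] pm[OF e(2) e(3)] pm[OF e(2) e(4)] pm[OF e(3) e(4)]
    unfolding x y indep.simps by blast
  have "q = 0 \<or> (a * d = b * c)" if "p * a + q * c = 0" "p * b + q * d = 0" for a b c d
    using q[of a d b c] unfolding that by simp
  note qm = this
  show "q = 0"
    using assms(1) qm[OF e(1) e(2)] qm[OF e(1) e(3)] qm[OF e(1) e(4)] qm[OF e(2) e(3)] qm[OF e(2) e(4)] qm[OF e(3) e(4)]
    unfolding x y indep.simps by blast
qed

section \<open>Incidence conditions along a pencil of states\<close>

lemma unique_solution_iff:
  fixes a b :: "'i \<Rightarrow> 'a::field"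
  shows "(\<exists>!t. \<forall>i\<in>I. a i * t + b i = 0) \<longleftrightarrow> (\<exists>t. \<forall>i\<in>I. a i * t + b i = 0) \<and> \<not> (\<forall>i\<in>I. a i = 0 \<and> b i = 0)"
proof (cases "\<forall>i\<in>I. a i = 0 \<and> b i = 0")
  case True
  then have "\<forall>t. \<forall>i\<in>I. a i * t + b i = 0" by simp
  then have "\<not> (\<exists>!t. \<forall>i\<in>I. a i * t + b i = 0)" using zero_neq_one by blast
  then show ?thesis using True by blast
next
  case False
  have "t = t'" if t: "\<forall>i\<in>I. a i * t + b i = 0" and t': "\<forall>i\<in>I. a i * t' + b i = 0" for t t'
  proof (rule ccontr)
    assume ne: "t \<noteq> t'"
    have "a i = 0 \<and> b i = 0" if "i \<in> I" for i
    proof -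
      have "a i * (t - t') = (a i * t + b i) - (a i * t' + b i)" by (simp add: algebra_simps)
      also have "\<dots> = 0" using t t' that by simp
      finally have "a i = 0" using ne by simp
      then show ?thesis using t that by auto
    qed
    then show False using False by blast
  qed
  then show ?thesis using False by blast
qed

text \<open>
  The homogeneous equations \<open>a s + b t = 0\<close> have as solutions on the projective line nothing, one
  point or everything. A unique solution is seen in both affine charts, unless it is the point that
  is missing in one of them; there all \<open>a\<close>, or all \<open>b\<close>, vanish.
\<close>

lemma unique_solution_swap:
  fixes a b :: "'i \<Rightarrow> 'a::field"
  shows "(of_bool (\<exists>!t. \<forall>i\<in>I. b i * t + a i = 0) :: int) =
     of_bool (\<exists>!t. \<forall>i\<in>I. a i * t + b i = 0) + of_bool (\<forall>i\<in>I. a i = 0) - of_bool (\<forall>i\<in>I. b i = 0)"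
proof (cases "\<forall>i\<in>I. a i = 0 \<and> b i = 0")
  case True
  then show ?thesis unfolding unique_solution_iff by simp
next
  case False
  have swap: "\<forall>i\<in>I. b i * inverse t + a i = 0" if "t \<noteq> 0" "\<forall>i\<in>I. a i * t + b i = 0" for t and a b :: "'i \<Rightarrow> 'a"
  proof
    fix i assume "i \<in> I"
    then have "b i = - (a i * t)" using that(2) by (simp add: add_eq_0_iff)
    then show "b i * inverse t + a i = 0" using that(1) by simp
  qed
  let ?A = "\<exists>t. \<forall>i\<in>I. a i * t + b i = 0" and ?B = "\<exists>t. \<forall>i\<in>I. b i * t + a i = 0"
  show ?thesis
  proof (cases "\<exists>t. t \<noteq> 0 \<and> (\<forall>i\<in>I. a i * t + b i = 0)")
    case True
    then obtain t where t: "t \<noteq> 0" "\<forall>i\<in>I. a i * t + b i = 0" by blast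
    have "?B" using swap[OF t] by blast
    moreover have "\<not> (\<forall>i\<in>I. a i = 0)"
    proof
      assume a: "\<forall>i\<in>I. a i = 0"
      then have "\<forall>i\<in>I. b i = 0" using t(2) by auto
      then show False using a False by blast
    qed
    moreover have "\<not> (\<forall>i\<in>I. b i = 0)"
    proof
      assume b: "\<forall>i\<in>I. b i = 0"
      then have "\<forall>i\<in>I. a i = 0" using t by auto
      then show False using b False by blast
    qed
    ultimately show ?thesis using t(2) False unfolding unique_solution_iff by auto
  next
    case nz: False
    have A: "?A \<longleftrightarrow> (\<forall>i\<in>I. b i = 0)"
    proof
      assume ?A
      then have "\<forall>i\<in>I. a i * 0 + b i = 0" using nz by metis
      then show "\<forall>i\<in>I. b i = 0" by simp
    qed (auto intro: exI[of _ 0])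
    have B: "?B \<longleftrightarrow> (\<forall>i\<in>I. a i = 0)"
    proof
      assume ?B
      then obtain t where t: "\<forall>i\<in>I. b i * t + a i = 0" by blast
      have "t = 0" using swap[OF _ t] nz inverse_nonzero_iff_nonzero[of t] by blast
      then show "\<forall>i\<in>I. a i = 0" using t by simp
    qed (auto intro: exI[of _ 0])
    show ?thesis using False A B unfolding unique_solution_iff by (auto simp: of_bool_def)
  qed
qed

definition in_radical :: "'a::comm_ring_1 state \<Rightarrow> 'a vec4 \<Rightarrow> bool" where
  "in_radical f m \<longleftrightarrow> (\<forall>y. om f m y = 0)"

definition vanishes :: "'a::comm_ring_1 state \<Rightarrow> bool" where
  "vanishes f \<longleftrightarrow> (\<forall>x. in_radical f x)"

text \<open>
  The combination of \<open>x\<close> and \<open>y\<close> that is perpendicular to \<open>v\<close>: in projective terms, the point where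
  the line through \<open>x\<close> and \<open>y\<close> meets the polar plane of \<open>v\<close>.
\<close>

definition dvec :: "'a::comm_ring_1 vec4 \<Rightarrow> 'a vec4 \<Rightarrow> 'a vec4 \<Rightarrow> 'a vec4" where
  "dvec v x y = lc (sp v x) y (- sp v y) x"

text \<open>
  The pole, with respect to \<open>sp\<close>, of the projective plane through \<open>v\<close>, \<open>x\<close> and \<open>y\<close>. Like every point
  it lies on its polar plane.
\<close>

definition cvec :: "'a::comm_ring_1 vec4 \<Rightarrow> 'a vec4 \<Rightarrow> 'a vec4 \<Rightarrow> 'a vec4" where
  "cvec v x y = lc (sp x y) v 1 (dvec v x y)"

text \<open>
  The action on \<open>om f\<close> of \<open>c\<close> times the infinitesimal symplectic transvection \<open>X u = sp v u \<cdot> v\<close>,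
  that is \<open>c\<close> times \<open>om f (X x) y + om f x (X y)\<close>.
\<close>

definition om_nil :: "'a::comm_ring_1 \<Rightarrow> 'a vec4 \<Rightarrow> 'a state \<Rightarrow> 'a vec4 \<Rightarrow> 'a vec4 \<Rightarrow> 'a" where
  "om_nil c v f x y = c * om f v (dvec v x y)"

lemma om_nil_eq: "om_nil c v f x y = c * (sp v x * om f v y - sp v y * om f v x)"
  by (simp add: om_nil_def dvec_def om_lc)

lemma sp_dvec [simp]: "sp v (dvec v x y) = 0" "sp (dvec v x y) v = 0"
  by (simp_all add: dvec_def sp_lc sp_skew[of v x] sp_skew[of v y] algebra_simps)

lemma sp_dvec_arg: "sp x (dvec v x y) = sp v x * sp x y" "sp y (dvec v x y) = sp v y * sp x y"
  using sp_skew[of x y] by (simp_all add: dvec_def sp_lc)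

lemma sp_dvec_cvec [simp]: "sp (dvec v x y) (cvec v x y) = 0"
  by (simp add: cvec_def sp_lc)

lemma om_dvec: "om f x (dvec v x y) = sp v x * om f x y" "om f y (dvec v x y) = sp v y * om f x y"
  using om_skew[of f x y] by (simp_all add: dvec_def om_lc)

lemma dvec_eq_zvI: "sp v x = 0 \<Longrightarrow> sp v y = 0 \<Longrightarrow> dvec v x y = zv"
  unfolding dvec_def by (cases x; cases y) simp

lemma cvec_perp: "sp x y = 0 \<Longrightarrow> cvec v x y = dvec v x y"
  unfolding cvec_def by (cases v; cases "dvec v x y") simp

lemma radical_flip: "in_radical f m \<Longrightarrow> om f y m = 0"
  unfolding in_radical_def using om_skew[of f y m] by simp

context
  fixes f :: "'a::field state" and v :: "'a vec4" and c :: 'a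
  assumes f: "on_quadric f" and v: "v \<noteq> zv" and c: "c \<noteq> 0"
begin

lemma sp_v_nonzero: obtains x where "sp v x \<noteq> 0"
  using sp_nondegenerate v by blast

lemma nil_zero_iff: "om_nil c v f x y = 0 \<longleftrightarrow> sp v x * om f v y = sp v y * om f v x"
  using c by (simp add: om_nil_eq)

lemma radical_from_proportional:
  assumes "\<And>y. s * om f v y = sp v y * k" "s \<noteq> 0"
  shows "in_radical f v"
proof -
  have *: "om f v y = k / s * sp v y" for y using assms(1)[of y] assms(2) by (simp add: field_simps)
  have "k / s = 0" by (rule om_proportional_sp[OF f v *])
  with * show ?thesis unfolding in_radical_def by simp
qed

text \<open>
  The radical of a nonzero form is isotropic, by primitivity.
\<close>

lemma radical_perp: "in_radical f m \<Longrightarrow> in_radical f n \<Longrightarrow> sp m n \<noteq> 0 \<Longrightarrow> vanishes f"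
  unfolding vanishes_def in_radical_def
proof (intro allI)
  fix p q assume mn: "\<forall>y. om f m y = 0" "\<forall>y. om f n y = 0" "sp m n \<noteq> 0"
  show "om f p q = 0" using om_primitive[of f m n p q] mn by simp
qed

text \<open>
  A decomposable form is the pullback of an area form on a plane; there \<open>om f m n = 0\<close> means that
  the images of \<open>m\<close> and \<open>n\<close> are proportional.
\<close>

lemma proportional_of_zero:
  assumes "om f m n = 0" "\<not> in_radical f m"
  obtains k where "\<And>y. om f n y = k * om f m y"
proof -
  obtain p where p: "om f m p \<noteq> 0" using assms(2) unfolding in_radical_def by blast
  have "om f n y = om f n p / om f m p * om f m y" for y
    using om_decomposable[OF f, of m n p y] assms(1) p by (simp add: field_simps)
  then show thesis by (rule that)
qed

lemma pair_full_degenerate: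
  assumes "dvec v x y = zv \<or> cvec v x y = zv"
  shows "om f x y = 0 \<and> om_nil c v f x y = 0 \<longleftrightarrow> om f x y = 0"
proof -
  have "om f v (dvec v x y) = 0"
  proof (cases "dvec v x y = zv")
    case False
    then have C: "cvec v x y = zv" using assms by blast
    have nz: "sp x y \<noteq> 0" using cvec_perp[of x y v] False C by auto
    have "om f (cvec v x y) (dvec v x y) = sp x y * om f v (dvec v x y)"
      by (simp add: cvec_def om_lc)
    then show ?thesis using nz unfolding C by simp
  qed simp
  then show ?thesis by (simp add: om_nil_def)
qed

text \<open>
  In projective terms, the form vanishes at two points if the Lagrangian line (its radical) meets
  the line through them. The two conditions on the left say that it meets the line through \<open>x\<close> and
  \<open>y\<close> and the line through \<open>v\<close> and \<open>dvec v x y\<close>. These two lines intersect in \<open>dvec v x y\<close>. So the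
  Lagrangian line goes through that point or lies in the plane of the two lines; as it is its own
  polar, the latter means that it contains the pole \<open>cvec v x y\<close> of the plane.
\<close>

lemma pair_full:
  assumes d: "dvec v x y \<noteq> zv" and C: "cvec v x y \<noteq> zv"
  shows "om f x y = 0 \<and> om_nil c v f x y = 0 \<longleftrightarrow> in_radical f (dvec v x y) \<or> in_radical f (cvec v x y)"
proof
  let ?z = "dvec v x y" and ?C = "cvec v x y"
  assume "in_radical f ?z \<or> in_radical f ?C"
  then show "om f x y = 0 \<and> om_nil c v f x y = 0"
  proof
    assume z: "in_radical f ?z"
    have "sp v x \<noteq> 0 \<or> sp v y \<noteq> 0" using dvec_eq_zvI d by blast
    moreover have "sp v x * om f x y = 0" "sp v y * om f x y = 0"
      using radical_flip[OF z, of x] radical_flip[OF z, of y] unfolding om_dvec .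
    ultimately have "om f x y = 0" by auto
    then show ?thesis using radical_flip[OF z] by (simp add: om_nil_def)
  next
    assume R: "in_radical f ?C"
    show ?thesis
    proof (cases "sp x y = 0")
      case True
      then have z: "in_radical f ?z" using R cvec_perp[of x y v] by simp
      have "sp v x \<noteq> 0 \<or> sp v y \<noteq> 0" using dvec_eq_zvI d by blast
      moreover have "sp v x * om f x y = 0" "sp v y * om f x y = 0"
        using radical_flip[OF z, of x] radical_flip[OF z, of y] unfolding om_dvec .
      ultimately have "om f x y = 0" by auto
      then show ?thesis using radical_flip[OF z] by (simp add: om_nil_def)
    next
      case False
      have "om f ?C ?z = sp x y * om f v ?z" by (simp add: cvec_def om_lc)
      then have "om f v ?z = 0" using R False unfolding in_radical_def by simp
      moreover obtain n where n: "sp ?C n \<noteq> 0" using sp_nondegenerate C by blast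
      have "sp ?C x = sp x y * sp v x - sp x ?z" "sp ?C y = sp x y * sp v y - sp y ?z"
        using sp_skew[of x ?z] sp_skew[of y ?z] by (simp_all add: cvec_def sp_lc)
      then have "sp ?C x = 0" "sp ?C y = 0" unfolding sp_dvec_arg by (simp_all add: mult.commute)
      then have "om f x y * sp ?C n = 0"
        using om_primitive[of f ?C n x y] R unfolding in_radical_def by simp
      ultimately show ?thesis using n by (simp add: om_nil_def)
    qed
  qed
next
  let ?z = "dvec v x y" and ?C = "cvec v x y"
  assume "om f x y = 0 \<and> om_nil c v f x y = 0"
  then have xy: "om f x y = 0" and vz: "om f v ?z = 0" using c by (auto simp: om_nil_def)
  show "in_radical f ?z \<or> in_radical f ?C"
  proof (rule disjCI)
    assume "\<not> in_radical f ?C"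
    show "in_radical f ?z"
    proof (rule ccontr)
      assume nz: "\<not> in_radical f ?z"
      then obtain t where t: "om f ?z t \<noteq> 0" unfolding in_radical_def by blast
      have zx: "om f ?z x = 0" "om f ?z y = 0" "om f ?z v = 0"
        by (subst om_skew, simp only: om_dvec xy vz mult_zero_right minus_zero)+
      have iso: "om f p q = 0" if "om f ?z p = 0" "om f ?z q = 0" for p q
        using om_decomposable[OF f, of ?z t p q] that t by simp
      have "om f ?C s = 0" for s
      proof -
        have vx: "om f v x = 0" "om f v y = 0" by (rule iso[OF zx(3,1)], rule iso[OF zx(3,2)])
        have "om f ?C s = sp x y * om f v s + sp v x * om f y s - sp v y * om f x s"
          by (simp add: cvec_def dvec_def om_lc)
        also have "\<dots> = 0" using om_primitive[of f v x y s] vx xy by (simp add: algebra_simps)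
        finally show ?thesis .
      qed
      then show False using \<open>\<not> in_radical f ?C\<close> unfolding in_radical_def by blast
    qed
  qed
qed

text \<open>
  If \<open>m\<close> is not perpendicular to \<open>v\<close>, the two conditions put both \<open>m\<close> and \<open>v\<close> into the radical,
  which is isotropic unless the form is zero.
\<close>

lemma radical_full:
  "(\<forall>y. om f m y = 0 \<and> om_nil c v f m y = 0) \<longleftrightarrow> (if sp v m = 0 then in_radical f m else vanishes f)"
proof (cases "sp v m = 0")
  case True
  have "om_nil c v f m y = 0" if "in_radical f m" for y
    using radical_flip[OF that, of v] True by (simp add: nil_zero_iff)
  then show ?thesis unfolding if_P[OF True] in_radical_def by blast
next
  case False
  have "vanishes f" if *: "\<forall>y. om f m y = 0 \<and> om_nil c v f m y = 0"
  proof -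
    have m: "in_radical f m" using * unfolding in_radical_def by blast
    have "sp v m * om f v y = sp v y * 0" for y
      using * radical_flip[OF m, of v] unfolding nil_zero_iff by simp
    then have "in_radical f v" using False by (rule radical_from_proportional)
    then show ?thesis using radical_perp[OF _ m] False by blast
  qed
  moreover have "\<forall>y. om f m y = 0 \<and> om_nil c v f m y = 0" if "vanishes f"
    using that by (simp add: vanishes_def in_radical_def om_nil_def)
  ultimately show ?thesis unfolding if_not_P[OF False] by blast
qed

text \<open>
  Inserting \<open>v\<close> for \<open>y\<close> kills the second summand, whence \<open>om f m v = 0\<close> (for \<open>t = 0\<close> the vanishing
  of the second summand for all \<open>y\<close> gives the same). Conversely, if \<open>om f m v = 0\<close> then \<open>om f v\<close> is
  a multiple of \<open>om f m\<close> and so is \<open>om_nil c v f m\<close>.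
\<close>

lemma radical_unique:
  "(\<exists>!t. \<forall>y\<in>UNIV. om f m y * t + om_nil c v f m y = 0) \<longleftrightarrow> om f m v = 0 \<and> \<not> in_radical f m"
proof
  assume "\<exists>!t. \<forall>y\<in>UNIV. om f m y * t + om_nil c v f m y = 0"
  then obtain t where t: "\<And>y. om f m y * t + om_nil c v f m y = 0" and
    nf: "\<not> (\<forall>y. om f m y = 0 \<and> om_nil c v f m y = 0)"
    unfolding unique_solution_iff by blast
  have tv: "om f m v * t = 0" using t[of v] by (simp add: om_nil_eq)
  have mv: "om f m v = 0"
  proof (cases "t = 0")
    case True
    then have n: "sp v m * om f v y = sp v y * om f v m" for y
      using t[of y] unfolding nil_zero_iff[symmetric] by simp
    show ?thesis
    proof (cases "sp v m = 0")
      case True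
      obtain x where "sp v x \<noteq> 0" by (rule sp_v_nonzero)
      then show ?thesis using n[of x] True om_skew[of f m v] by simp
    next
      case False
      from radical_from_proportional[OF n False] show ?thesis by (rule radical_flip)
    qed
  qed (use tv in simp)
  have "\<not> in_radical f m"
  proof
    assume m: "in_radical f m"
    then have "om_nil c v f m y = 0" for y using t[of y] unfolding in_radical_def by simp
    then show False using nf m unfolding in_radical_def by blast
  qed
  with mv show "om f m v = 0 \<and> \<not> in_radical f m" ..
next
  assume *: "om f m v = 0 \<and> \<not> in_radical f m"
  then obtain k where k: "\<And>y. om f v y = k * om f m y" using proportional_of_zero by blast
  have vm: "om f v m = 0" using * om_skew[of f m v] by simp
  have "om f m y * (- c * sp v m * k) + om_nil c v f m y = 0" for y
    unfolding om_nil_eq vm unfolding k by (simp add: algebra_simps)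
  then show "\<exists>!t. \<forall>y\<in>UNIV. om f m y * t + om_nil c v f m y = 0"
    unfolding unique_solution_iff using * unfolding in_radical_def by blast
qed

lemma radical_nil: "(\<forall>y. om_nil c v f m y = 0) \<longleftrightarrow> (if sp v m = 0 then om f v m = 0 else in_radical f v)"
proof (cases "sp v m = 0")
  case True
  obtain x where x: "sp v x \<noteq> 0" by (rule sp_v_nonzero)
  have "(\<forall>y. om_nil c v f m y = 0) \<longleftrightarrow> (\<forall>y. sp v y = 0 \<or> om f v m = 0)"
    unfolding nil_zero_iff True by simp
  then show ?thesis unfolding if_P[OF True] using x by blast
next
  case False
  have "in_radical f v" if "\<forall>y. om_nil c v f m y = 0"
    by (rule radical_from_proportional[of _ "om f v m", OF _ False]) (use that in \<open>simp add: nil_zero_iff\<close>)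
  moreover have "\<forall>y. om_nil c v f m y = 0" if "in_radical f v"
    using that by (simp add: nil_zero_iff in_radical_def)
  ultimately show ?thesis unfolding if_not_P[OF False] by blast
qed

lemma vanishes_nil: "(\<forall>x y. om_nil c v f x y = 0) \<longleftrightarrow> in_radical f v"
proof
  assume *: "\<forall>x y. om_nil c v f x y = 0"
  obtain x where x: "sp v x \<noteq> 0" by (rule sp_v_nonzero)
  have "\<forall>y. om_nil c v f x y = 0" using * by blast
  then show "in_radical f v" unfolding radical_nil if_not_P[OF x] .
qed (simp add: om_nil_eq in_radical_def)

lemma vanishes_full: "(\<forall>x y. om f x y = 0 \<and> om_nil c v f x y = 0) \<longleftrightarrow> vanishes f"
  by (auto simp: vanishes_def in_radical_def om_nil_def)

lemma vanishes_unique: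
  "(\<exists>!t. \<forall>p\<in>UNIV. om f (fst p) (snd p) * t + om_nil c v f (fst p) (snd p) = 0) \<longleftrightarrow> in_radical f v \<and> \<not> vanishes f"
proof -
  have "(\<exists>t. \<forall>p\<in>UNIV. om f (fst p) (snd p) * t + om_nil c v f (fst p) (snd p) = 0) \<longleftrightarrow> in_radical f v"
  proof
    assume "\<exists>t. \<forall>p\<in>UNIV. om f (fst p) (snd p) * t + om_nil c v f (fst p) (snd p) = 0"
    then obtain t where t: "\<And>x y. om f x y * t + om_nil c v f x y = 0" by force
    show "in_radical f v"
    proof (cases "t = 0")
      case True
      then show ?thesis using t vanishes_nil by simp
    next
      case False
      then show ?thesis using t[of v] by (auto simp: om_nil_eq in_radical_def)
    qed
  next
    assume "in_radical f v"
    then have "\<forall>p\<in>UNIV. om f (fst p) (snd p) * 0 + om_nil c v f (fst p) (snd p) = 0"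
      using vanishes_nil by simp
    then show "\<exists>t. \<forall>p\<in>UNIV. om f (fst p) (snd p) * t + om_nil c v f (fst p) (snd p) = 0" ..
  qed
  then show ?thesis
    unfolding unique_solution_iff by (auto simp: vanishes_def in_radical_def om_nil_def)
qed

text \<open>
  A Lagrangian plane is its own perpendicular space, so \<open>v\<close> lies in the plane spanned by \<open>m\<close> and
  \<open>n\<close>. Primitivity expresses the relation between the three values without coordinates of \<open>v\<close>.
\<close>

lemma isotropic_perp:
  assumes mn: "sp m n = 0" "indep m n" "sp v m = 0" "sp v n = 0"
  shows "om f m n = 0 \<longleftrightarrow> om f v m = 0 \<and> om f v n = 0"
proof -
  have *: "om f m n * sp v t + om f v m * sp n t - om f v n * sp m t = 0" for t
    using om_primitive[of f v m n t] mn by (simp add: algebra_simps)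
  show ?thesis
  proof
    assume "om f m n = 0"
    then have "sp (lc (- om f v n) m (om f v m) n) t = 0" for t using *[of t] by (simp add: sp_lc)
    then have "lc (- om f v n) m (om f v m) n = zv" by (rule sp_nondegenerate)
    from indep_lc_zero[OF mn(2) this] show "om f v m = 0 \<and> om f v n = 0" by simp
  next
    assume "om f v m = 0 \<and> om f v n = 0"
    moreover obtain t where "sp v t \<noteq> 0" by (rule sp_v_nonzero)
    ultimately show "om f m n = 0" using *[of t] by simp
  qed
qed

lemma plane_nil_perp:
  assumes "sp m n = 0" "indep m n" "sp v m = 0" "sp v n = 0"
  shows "(\<forall>y. om_nil c v f m y = 0) \<and> (\<forall>y. om_nil c v f n y = 0) \<longleftrightarrow> om f m n = 0"
  unfolding radical_nil isotropic_perp[OF assms] using assms by simp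

lemma plane_unique_perp:
  assumes "sp m n = 0" "indep m n" "sp v m = 0" "sp v n = 0"
  shows "(\<exists>!t. \<forall>p\<in>{m, n} \<times> UNIV. om f (fst p) (snd p) * t + om_nil c v f (fst p) (snd p) = 0) \<longleftrightarrow>
     om f m n = 0 \<and> \<not> (in_radical f m \<and> in_radical f n)"
proof -
  have "(\<exists>t. \<forall>p\<in>{m, n} \<times> UNIV. om f (fst p) (snd p) * t + om_nil c v f (fst p) (snd p) = 0) \<longleftrightarrow> om f m n = 0"
  proof
    assume "\<exists>t. \<forall>p\<in>{m, n} \<times> UNIV. om f (fst p) (snd p) * t + om_nil c v f (fst p) (snd p) = 0"
    then obtain t where t: "\<And>y. om f m y * t + om_nil c v f m y = 0" "\<And>y. om f n y * t + om_nil c v f n y = 0" by force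
    have 1: "om f m v * t = 0" "om f n v * t = 0" using t(1)[of v] t(2)[of v] by (simp_all add: om_nil_eq)
    show "om f m n = 0"
    proof (cases "t = 0")
      case True
      then show ?thesis using t plane_nil_perp[OF assms] by simp
    next
      case False
      then show ?thesis
        using 1 om_skew[of f m v] om_skew[of f n v] unfolding isotropic_perp[OF assms] by simp
    qed
  next
    assume "om f m n = 0"
    then have "\<forall>p\<in>{m, n} \<times> UNIV. om f (fst p) (snd p) * 0 + om_nil c v f (fst p) (snd p) = 0"
      using plane_nil_perp[OF assms] by auto
    then show "\<exists>t. \<forall>p\<in>{m, n} \<times> UNIV. om f (fst p) (snd p) * t + om_nil c v f (fst p) (snd p) = 0" ..
  qed
  moreover have "(\<forall>p\<in>{m, n} \<times> UNIV. om f (fst p) (snd p) = 0 \<and> om_nil c v f (fst p) (snd p) = 0) \<longleftrightarrow> in_radical f m \<and> in_radical f n"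
    using radical_full[of m] radical_full[of n] assms by auto
  ultimately show ?thesis unfolding unique_solution_iff by blast
qed

lemma plane_full_perp:
  assumes "sp v m = 0" "sp v n = 0"
  shows "(\<forall>y. om f m y = 0 \<and> om_nil c v f m y = 0) \<and> (\<forall>y. om f n y = 0 \<and> om_nil c v f n y = 0) \<longleftrightarrow> in_radical f m \<and> in_radical f n"
  using radical_full[of m] radical_full[of n] assms by simp

text \<open>
  Here \<open>m\<close> spans the part of the Lagrangian plane that is perpendicular to \<open>v\<close>. For a nonzero form a
  solution exists if \<open>v\<close> is in the radical (then \<open>t = 0\<close>) or \<open>m\<close> is in the radical but \<open>n\<close> is not;
  the right-hand side counts these cases by inclusion and exclusion, as \<open>v\<close> and \<open>n\<close> are never both
  in the radical. If the form is zero, every \<open>t\<close> is a solution and the right-hand side cancels.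
\<close>

lemma plane_unique_transversal:
  assumes mn: "sp m n = 0" "m \<noteq> zv" "sp v m = 0" "sp v n \<noteq> 0"
  shows "(of_bool (\<exists>!t. \<forall>p\<in>{m, n} \<times> UNIV. om f (fst p) (snd p) * t + om_nil c v f (fst p) (snd p) = 0) :: int) =
     of_bool (in_radical f v) + of_bool (in_radical f m) - of_bool (in_radical f m \<and> in_radical f v) - of_bool (in_radical f m \<and> in_radical f n)"
proof -
  have "(\<forall>p\<in>{m, n} \<times> UNIV. om f (fst p) (snd p) = 0 \<and> om_nil c v f (fst p) (snd p) = 0) \<longleftrightarrow>
     (\<forall>y. om f m y = 0 \<and> om_nil c v f m y = 0) \<and> (\<forall>y. om f n y = 0 \<and> om_nil c v f n y = 0)"
    by auto
  also have "\<dots> \<longleftrightarrow> vanishes f"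
    unfolding radical_full using mn by (simp add: vanishes_def) blast
  finally have full: "(\<forall>p\<in>{m, n} \<times> UNIV. om f (fst p) (snd p) = 0 \<and> om_nil c v f (fst p) (snd p) = 0) \<longleftrightarrow> vanishes f" .
  have rest: "(\<exists>t. \<forall>p\<in>{m, n} \<times> UNIV. om f (fst p) (snd p) * t + om_nil c v f (fst p) (snd p) = 0) \<longleftrightarrow>
     in_radical f v \<or> (in_radical f m \<and> \<not> in_radical f n)" if nv: "\<not> vanishes f"
  proof
    assume "\<exists>t. \<forall>p\<in>{m, n} \<times> UNIV. om f (fst p) (snd p) * t + om_nil c v f (fst p) (snd p) = 0"
    then obtain t where t: "\<And>y. om f m y * t + om_nil c v f m y = 0" "\<And>y. om f n y * t + om_nil c v f n y = 0" by force
    show "in_radical f v \<or> (in_radical f m \<and> \<not> in_radical f n)"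
    proof (cases "t = 0")
      case True
      then show ?thesis using t(2) radical_nil[of n] mn by simp
    next
      case False
      then have "om f m v = 0" using t(1)[of v] by (simp add: om_nil_eq)
      then have "om_nil c v f m y = 0" for y using mn om_skew[of f m v] by (simp add: om_nil_eq)
      then have m: "in_radical f m" using t(1) False unfolding in_radical_def by simp
      have "in_radical f v" if n: "in_radical f n"
      proof -
        have "om_nil c v f n y = 0" for y using t(2)[of y] n unfolding in_radical_def by simp
        then show ?thesis using radical_nil[of n] mn by simp
      qed
      then show ?thesis using m by blast
    qed
  next
    assume "in_radical f v \<or> (in_radical f m \<and> \<not> in_radical f n)"
    then show "\<exists>t. \<forall>p\<in>{m, n} \<times> UNIV. om f (fst p) (snd p) * t + om_nil c v f (fst p) (snd p) = 0"
    proof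
      assume "in_radical f v"
      then have "\<forall>p\<in>{m, n} \<times> UNIV. om f (fst p) (snd p) * 0 + om_nil c v f (fst p) (snd p) = 0"
        using vanishes_nil by simp
      then show ?thesis ..
    next
      assume R: "in_radical f m \<and> \<not> in_radical f n"
      obtain s where s: "sp m s \<noteq> 0" using sp_nondegenerate mn(2) by blast
      have "om f n v * sp m s = 0"
        using om_primitive[of f m n v s] R mn sp_skew[of m v] unfolding in_radical_def by simp
      then have nv: "om f n v = 0" using s by simp
      then obtain k where k: "\<And>y. om f v y = k * om f n y" using proportional_of_zero R by blast
      have vn: "om f v n = 0" using nv om_skew[of f n v] by simp
      have "om f n y * (- c * sp v n * k) + om_nil c v f n y = 0" for y
        unfolding om_nil_eq vn unfolding k by (simp add: algebra_simps)
      moreover have "om f m y * (- c * sp v n * k) + om_nil c v f m y = 0" for y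
        using R mn radical_flip[of f m v] unfolding om_nil_eq in_radical_def by simp
      ultimately have "\<forall>p\<in>{m, n} \<times> UNIV. om f (fst p) (snd p) * (- c * sp v n * k) + om_nil c v f (fst p) (snd p) = 0"
        by auto
      then show ?thesis ..
    qed
  qed
  show ?thesis
  proof (cases "vanishes f")
    case True
    then show ?thesis unfolding unique_solution_iff full by (simp add: vanishes_def)
  next
    case False
    have "\<not> (in_radical f v \<and> in_radical f n)" using radical_perp[of v n] False mn by blast
    then show ?thesis unfolding unique_solution_iff full rest[OF False] using False by auto
  qed
qed

lemma plane_full_transversal:
  assumes "sp v m \<noteq> 0 \<or> sp v n \<noteq> 0"
  shows "(\<forall>y. om f m y = 0 \<and> om_nil c v f m y = 0) \<and> (\<forall>y. om f n y = 0 \<and> om_nil c v f n y = 0) \<longleftrightarrow> vanishes f"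
proof -
  have "vanishes f \<Longrightarrow> in_radical f m" "vanishes f \<Longrightarrow> in_radical f n" by (simp_all add: vanishes_def)
  then show ?thesis unfolding radical_full using assms by (auto split: if_splits)
qed

lemma plane_nil_transversal:
  assumes "sp v m \<noteq> 0 \<or> sp v n \<noteq> 0"
  shows "(\<forall>y. om_nil c v f m y = 0) \<and> (\<forall>y. om_nil c v f n y = 0) \<longleftrightarrow> in_radical f v"
proof -
  have "in_radical f v \<Longrightarrow> om f v m = 0" "in_radical f v \<Longrightarrow> om f v n = 0" by (simp_all add: in_radical_def)
  then show ?thesis unfolding radical_nil using assms by (auto split: if_splits)
qed

end

section \<open>Families of states whose incidence loci are polynomial in the Lefschetz class\<close>

text \<open>
  Conditions are imposed at vectors with coordinates in \<open>k\<close> only, so that they define closed sets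
  over \<open>k\<close>.
\<close>

definition emb :: "'k::field vec4 \<Rightarrow> 'k alg_closure vec4" where
  "emb = map_vec4 to_ac"

lemma emb_simps:
  "sp (emb x) (emb y) = to_ac (sp x y)"
  "emb (lc p x q y) = lc (to_ac p) (emb x) (to_ac q) (emb y)"
  "emb (dvec v x y) = dvec (emb v) (emb x) (emb y)"
  "emb (cvec v x y) = cvec (emb v) (emb x) (emb y)"
  "emb x = zv \<longleftrightarrow> x = zv"
  "indep (emb x) (emb y) \<longleftrightarrow> indep x y"
proof -
  show sp: "sp (emb x) (emb y) = to_ac (sp x y)" for x y
    by (cases x; cases y) (simp add: emb_def)
  show lc: "emb (lc p x q y) = lc (to_ac p) (emb x) (to_ac q) (emb y)" for p x q y
    by (cases x; cases y) (simp add: emb_def)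
  show d: "emb (dvec v x y) = dvec (emb v) (emb x) (emb y)" for v x y
    by (simp add: dvec_def lc sp)
  show "emb (cvec v x y) = cvec (emb v) (emb x) (emb y)"
    by (simp add: cvec_def lc sp d)
  show "emb x = zv \<longleftrightarrow> x = zv"
    by (cases x) (simp add: emb_def)
  show "indep (emb x) (emb y) \<longleftrightarrow> indep x y"
    by (cases x; cases y) (simp add: emb_def flip: to_ac_mult)
qed

definition vbasis :: "'a::comm_ring_1 vec4 list" where
  "vbasis = [Vec 1 0 0 0, Vec 0 1 0 0, Vec 0 0 1 0, Vec 0 0 0 1]"

lemma emb_vbasis: "map emb vbasis = vbasis"
  by (simp add: vbasis_def emb_def)

definition bilin :: "('a::comm_ring_1 vec4 \<Rightarrow> 'a vec4 \<Rightarrow> 'a) \<Rightarrow> bool" where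
  "bilin g \<longleftrightarrow> (\<forall>p x q y z. g (lc p x q y) z = p * g x z + q * g y z \<and> g z (lc p x q y) = p * g z x + q * g z y)"

lemma linear_zero_iff_basis:
  fixes g :: "'a::comm_ring_1 vec4 \<Rightarrow> 'a"
  assumes "\<And>p x q y. g (lc p x q y) = p * g x + q * g y"
  shows "(\<forall>y. g y = 0) \<longleftrightarrow> (\<forall>e\<in>set vbasis. g e = 0)"
proof
  assume *: "\<forall>e\<in>set vbasis. g e = 0"
  show "\<forall>y. g y = 0"
  proof
    fix y :: "'a vec4"
    obtain a b c d where y: "y = Vec a b c d" by (cases y)
    have "y = lc 1 (lc a (Vec 1 0 0 0) b (Vec 0 1 0 0)) 1 (lc c (Vec 0 0 1 0) d (Vec 0 0 0 1))"
      by (simp add: y)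
    then have "g y = g (lc 1 (lc a (Vec 1 0 0 0) b (Vec 0 1 0 0)) 1 (lc c (Vec 0 0 1 0) d (Vec 0 0 0 1)))"
      by (rule arg_cong)
    also have "\<dots> = 0" unfolding assms using * by (simp add: vbasis_def)
    finally show "g y = 0" .
  qed
qed blast

text \<open>
  A condition is a set of pairs of vectors on which a form has to vanish. For the form of a nonzero
  state, whose radical is a Lagrangian plane, the four kinds mean: the plane meets the span of \<open>x\<close>
  and \<open>y\<close> nontrivially (for independent \<open>x\<close> and \<open>y\<close>); it contains \<open>m\<close>; it is spanned by \<open>m\<close> and \<open>n\<close>;
  never. The first three are the Schubert conditions of the Lagrangian Grassmannian, except that the
  span of \<open>x\<close> and \<open>y\<close> need not be Lagrangian.
\<close>

inductive cond :: "('k::field alg_closure vec4 \<times> 'k alg_closure vec4) set \<Rightarrow> bool" where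
  pair: "cond {(emb x, emb y)}"
| rad: "cond ({emb m} \<times> UNIV)"
| plane: "sp m n = 0 \<Longrightarrow> indep m n \<Longrightarrow> cond ({emb m, emb n} \<times> UNIV)"
| zero: "cond UNIV"

text \<open>
  By bilinearity a condition amounts to finitely many polynomial equations.
\<close>

lemma cond_finite:
  assumes "cond J"
  obtains L :: "('k::field vec4 \<times> 'k vec4) list" where
    "\<And>g. bilin g \<Longrightarrow> (\<forall>p\<in>J. g (fst p) (snd p) = 0) \<longleftrightarrow> (\<forall>q\<in>set L. g (emb (fst q)) (emb (snd q)) = 0)"
proof -
  have row: "(\<forall>y. g (emb m) y = 0) \<longleftrightarrow> (\<forall>q\<in>set (map (Pair m) vbasis). g (emb (fst q)) (emb (snd q)) = 0)"
    if "bilin g" for g :: "'k alg_closure vec4 \<Rightarrow> 'k alg_closure vec4 \<Rightarrow> 'k alg_closure" and m :: "'k vec4"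
  proof -
    have "(\<forall>y. g (emb m) y = 0) \<longleftrightarrow> (\<forall>e\<in>set vbasis. g (emb m) e = 0)"
      by (rule linear_zero_iff_basis) (use that in \<open>simp add: bilin_def\<close>)
    also have "\<dots> \<longleftrightarrow> (\<forall>e\<in>set (map emb vbasis). g (emb m) e = 0)" unfolding emb_vbasis ..
    finally show ?thesis by simp
  qed
  from assms show thesis
  proof cases
    case (pair x y)
    then show thesis by (intro that[of "[(x, y)]"]) simp
  next
    case (rad m)
    have "(\<forall>p\<in>J. g (fst p) (snd p) = 0) \<longleftrightarrow> (\<forall>y. g (emb m) y = 0)"
      for g :: "'k alg_closure vec4 \<Rightarrow> 'k alg_closure vec4 \<Rightarrow> 'k alg_closure" unfolding rad by auto
    then show thesis by (intro that[of "map (Pair m) vbasis"]) (simp only: row)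
  next
    case (plane m n)
    have "(\<forall>p\<in>J. g (fst p) (snd p) = 0) \<longleftrightarrow> (\<forall>y. g (emb m) y = 0) \<and> (\<forall>y. g (emb n) y = 0)"
      for g :: "'k alg_closure vec4 \<Rightarrow> 'k alg_closure vec4 \<Rightarrow> 'k alg_closure" unfolding plane by auto
    then show thesis by (intro that[of "map (Pair m) vbasis @ map (Pair n) vbasis"]) (simp only: row set_append ball_Un)
  next
    case zero
    have "(\<forall>p\<in>J. g (fst p) (snd p) = 0) \<longleftrightarrow> (\<forall>q\<in>set (concat (map (\<lambda>m. map (Pair m) vbasis) vbasis)). g (emb (fst q)) (emb (snd q)) = 0)"
      if g: "bilin g" for g :: "'k alg_closure vec4 \<Rightarrow> 'k alg_closure vec4 \<Rightarrow> 'k alg_closure"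
    proof -
      have "(\<forall>p\<in>J. g (fst p) (snd p) = 0) \<longleftrightarrow> (\<forall>y. \<forall>x. g x y = 0)" unfolding zero by auto
      also have "\<dots> \<longleftrightarrow> (\<forall>y. \<forall>e\<in>set vbasis. g e y = 0)"
        by (intro iff_allI linear_zero_iff_basis) (use g in \<open>simp add: bilin_def\<close>)
      also have "\<dots> \<longleftrightarrow> (\<forall>e\<in>set (map emb vbasis). \<forall>y. g e y = 0)" unfolding emb_vbasis by blast
      also have "\<dots> \<longleftrightarrow> (\<forall>m\<in>set vbasis. \<forall>q\<in>set (map (Pair m) vbasis). g (emb (fst q)) (emb (snd q)) = 0)"
        unfolding set_map ball_simps by (simp only: row[OF g] set_map ball_simps)
      also have "\<dots> \<longleftrightarrow> (\<forall>q\<in>set (concat (map (\<lambda>m. map (Pair m) vbasis) vbasis)). g (emb (fst q)) (emb (snd q)) = 0)"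
        by auto
      finally show ?thesis .
    qed
    then show thesis by (rule that)
  qed
qed

lemma bilin_om: "bilin (om f)"
  by (simp add: bilin_def om_lc)

lemma bilin_om_nil: "bilin (om_nil c v f)"
  by (simp add: bilin_def om_nil_eq om_lc sp_lc algebra_simps)

lemma bilin_pencil: "bilin g \<Longrightarrow> bilin h \<Longrightarrow> bilin (\<lambda>x y. g x y * t + h x y)"
  by (simp add: bilin_def algebra_simps)

definition satisfies :: "('a vec4 \<times> 'a vec4) set \<Rightarrow> ('a vec4 \<Rightarrow> 'a vec4 \<Rightarrow> 'a::zero) \<Rightarrow> bool" where
  "satisfies J g \<longleftrightarrow> (\<forall>p\<in>J. g (fst p) (snd p) = 0)"

text \<open>
  The loci of the conditions are all that has to be remembered about a family of states when further
  edges are added.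
\<close>

definition good :: "nat \<Rightarrow> ('k::field alg_closure list \<Rightarrow> 'k alg_closure state) \<Rightarrow> bool" where
  "good n f \<longleftrightarrow> (\<forall>x y. polyfun n (\<lambda>p. om (f p) (emb x) (emb y))) \<and> (\<forall>p. length p = n \<longrightarrow> on_quadric (f p)) \<and>
     (\<forall>J. cond J \<longrightarrow> poly_int n (\<lambda>p. of_bool (satisfies J (om (f p)))))"

lemma goodD:
  assumes "good n f"
  shows "polyfun n (\<lambda>p. om (f p) (emb x) (emb y))" "length p = n \<Longrightarrow> on_quadric (f p)"
    "cond J \<Longrightarrow> poly_int n (\<lambda>p. of_bool (satisfies J (om (f p))))"
  using assms unfolding good_def by blast+

lemma satisfies_simps:
  "satisfies {(x, y)} (om f) \<longleftrightarrow> om f x y = 0"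
  "satisfies ({m} \<times> UNIV) (om f) \<longleftrightarrow> in_radical f m"
  "satisfies ({m, n} \<times> UNIV) (om f) \<longleftrightarrow> in_radical f m \<and> in_radical f n"
  "satisfies UNIV (om f) \<longleftrightarrow> vanishes f"
  by (auto simp: satisfies_def in_radical_def vanishes_def)

lemma good_atoms:
  assumes "good n f"
  shows "poly_int n (\<lambda>p. of_bool (om (f p) (emb x) (emb y) = 0))"
    "poly_int n (\<lambda>p. of_bool (in_radical (f p) (emb m)))"
    "sp m m' = 0 \<Longrightarrow> indep m m' \<Longrightarrow> poly_int n (\<lambda>p. of_bool (in_radical (f p) (emb m) \<and> in_radical (f p) (emb m')))"
    "poly_int n (\<lambda>p. of_bool (vanishes (f p)))"
  using goodD(3)[OF assms cond.pair, of x y] goodD(3)[OF assms cond.rad, of m]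
    goodD(3)[OF assms cond.plane, of m m'] goodD(3)[OF assms cond.zero]
  unfolding satisfies_simps by blast+

lemma polyfun_om_nil:
  assumes "good n f"
  shows "polyfun n (\<lambda>p. om_nil (to_ac c) (emb v) (f p) (emb x) (emb y))"
  unfolding om_nil_def emb_simps[symmetric]
  by (intro polyfun_mult polyfun_const goodD(1)[OF assms])

lemma poly_int_pencil:
  fixes A B :: "'k::field alg_closure list \<Rightarrow> 'k alg_closure vec4 \<Rightarrow> 'k alg_closure vec4 \<Rightarrow> 'k alg_closure"
  assumes J: "cond J" and bil: "\<And>p. bilin (A p)" "\<And>p. bilin (B p)"
    and pf: "\<And>x y. polyfun n (\<lambda>p. A p (emb x) (emb y))" "\<And>x y. polyfun n (\<lambda>p. B p (emb x) (emb y))"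
    and U: "poly_int n (\<lambda>p. of_bool (\<exists>!t. \<forall>q\<in>J. A p (fst q) (snd q) * t + B p (fst q) (snd q) = 0))"
    and F: "poly_int n (\<lambda>p. of_bool (satisfies J (A p) \<and> satisfies J (B p)))"
  shows "poly_int (Suc n) (\<lambda>y. of_bool (satisfies J (\<lambda>u w. A (butlast y) u w * last y + B (butlast y) u w)))"
proof -
  obtain L :: "('k vec4 \<times> 'k vec4) list" where
    L: "\<And>g. bilin g \<Longrightarrow> (\<forall>p\<in>J. g (fst p) (snd p) = 0) \<longleftrightarrow> (\<forall>q\<in>set L. g (emb (fst q)) (emb (snd q)) = 0)"
    using cond_finite[OF J] by blast
  let ?ps = "map (\<lambda>q. (\<lambda>p. A p (emb (fst q)) (emb (snd q)), \<lambda>p. B p (emb (fst q)) (emb (snd q)))) L"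
  have L': "(\<forall>r\<in>set ?ps. fst r p * t + snd r p = 0) \<longleftrightarrow> (\<forall>q\<in>J. A p (fst q) (snd q) * t + B p (fst q) (snd q) = 0)" for p t
    unfolding L[OF bilin_pencil[OF bil]] by simp
  have F': "(\<forall>r\<in>set ?ps. fst r p = 0 \<and> snd r p = 0) \<longleftrightarrow> satisfies J (A p) \<and> satisfies J (B p)" for p
    unfolding satisfies_def L[OF bil(1)] L[OF bil(2)] by auto
  have "poly_int (Suc n) (\<lambda>y. of_bool (\<forall>r\<in>set ?ps. fst r (butlast y) * last y + snd r (butlast y) = 0))"
  proof (rule poly_int_linear_system)
    show "polyfun n (fst r) \<and> polyfun n (snd r)" if "r \<in> set ?ps" for r using that pf by auto
    show "poly_int n (\<lambda>p. of_bool (\<exists>!t. \<forall>r\<in>set ?ps. fst r p * t + snd r p = 0))" unfolding L' by (rule U)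
    show "poly_int n (\<lambda>p. of_bool (\<forall>r\<in>set ?ps. fst r p = 0 \<and> snd r p = 0))" unfolding F' by (rule F)
  qed
  then show ?thesis unfolding L' satisfies_def .
qed

context
  fixes n :: nat and f :: "'k::field alg_closure list \<Rightarrow> 'k alg_closure state" and v :: "'k vec4" and c :: 'k
  assumes good: "good n f" and v: "v \<noteq> zv" and c: "c \<noteq> 0"
begin

lemma v': "emb v \<noteq> zv" and c': "to_ac c \<noteq> 0"
  using v c by (simp_all add: emb_simps)

abbreviation (input) "N p \<equiv> om_nil (to_ac c) (emb v) (f p)"

text \<open>
  Inclusion and exclusion if \<open>x\<close> and \<open>y\<close> span a Lagrangian plane. Otherwise they are proportional
  and the two conditions coincide.
\<close>

lemma poly_int_indep_or:
  assumes "sp x y = 0" "x \<noteq> zv" "y \<noteq> zv"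
  shows "poly_int n (\<lambda>p. of_bool (in_radical (f p) (emb x) \<or> in_radical (f p) (emb y)))"
proof (cases "indep x y")
  case True
  have "poly_int n (\<lambda>p. of_bool (in_radical (f p) (emb x)) + of_bool (in_radical (f p) (emb y))
     - of_bool (in_radical (f p) (emb x) \<and> in_radical (f p) (emb y)))"
    by (intro poly_int_add poly_int_diff good_atoms[OF good] assms True)
  then show ?thesis by (rule poly_int_cong) simp
next
  case False
  then obtain k where k: "y = lc k x 0 x" using assms(2) by (rule not_indepD)
  then have "k \<noteq> 0" using assms(3) by (cases x) auto
  have "in_radical (f p) (emb y) \<longleftrightarrow> in_radical (f p) (emb x)" for p
    unfolding k in_radical_def emb_simps om_lc using \<open>k \<noteq> 0\<close> by simp
  then show ?thesis using good_atoms(2)[OF good, of x] by simp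
qed

text \<open>
  The four kinds of conditions are closed under passing from a family to its pencil: whether the
  equations in \<open>t\<close> have exactly one solution, whether they hold for all \<open>t\<close>, and whether the
  nilpotent part satisfies the condition, are all integer combinations of conditions on the original
  state.
\<close>

lemma pencil_pieces:
  assumes "cond J"
  shows "poly_int n (\<lambda>p. of_bool (\<exists>!t. \<forall>q\<in>J. om (f p) (fst q) (snd q) * t + N p (fst q) (snd q) = 0)) \<and>
    poly_int n (\<lambda>p. of_bool (satisfies J (om (f p)) \<and> satisfies J (N p))) \<and>
    poly_int n (\<lambda>p. of_bool (satisfies J (N p)))"
  using assms
proof cases
  case (pair x y)
  let ?d = "dvec v x y" and ?C = "cvec v x y"
  have U: "(\<exists>!t. \<forall>q\<in>J. om (f p) (fst q) (snd q) * t + N p (fst q) (snd q) = 0) \<longleftrightarrow> om (f p) (emb x) (emb y) \<noteq> 0" for p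
  proof -
    have "(\<exists>t. om (f p) (emb x) (emb y) * t + N p (emb x) (emb y) = 0)" if "om (f p) (emb x) (emb y) \<noteq> 0"
      using that by (intro exI[of _ "- N p (emb x) (emb y) / om (f p) (emb x) (emb y)"]) simp
    then show ?thesis unfolding unique_solution_iff pair by auto
  qed
  have "poly_int n (\<lambda>p. 1 - of_bool (om (f p) (emb x) (emb y) = 0))"
    by (intro poly_int_diff poly_int_1 good_atoms[OF good])
  then have 1: "poly_int n (\<lambda>p. of_bool (\<exists>!t. \<forall>q\<in>J. om (f p) (fst q) (snd q) * t + N p (fst q) (snd q) = 0))"
    unfolding U by (rule poly_int_cong) simp
  have F: "satisfies J (om (f p)) \<and> satisfies J (N p) \<longleftrightarrow> om (f p) (emb x) (emb y) = 0 \<and> N p (emb x) (emb y) = 0" for p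
    unfolding pair satisfies_def by simp
  have 2: "poly_int n (\<lambda>p. of_bool (om (f p) (emb x) (emb y) = 0 \<and> N p (emb x) (emb y) = 0))"
  proof (cases "?d = zv \<or> ?C = zv")
    case True
    then have z: "dvec (emb v) (emb x) (emb y) = zv \<or> cvec (emb v) (emb x) (emb y) = zv"
      by (simp flip: emb_simps(3,4) add: emb_simps(5))
    show ?thesis
      by (rule poly_int_cong[OF good_atoms(1)[OF good, of x y]])
         (simp only: pair_full_degenerate[OF goodD(2)[OF good] v' c' z])
  next
    case False
    then have ne: "dvec (emb v) (emb x) (emb y) \<noteq> zv" "cvec (emb v) (emb x) (emb y) \<noteq> zv"
      by (simp_all flip: emb_simps(3,4) add: emb_simps(5))
    have "poly_int n (\<lambda>p. of_bool (in_radical (f p) (emb ?d) \<or> in_radical (f p) (emb ?C)))"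
      using False by (intro poly_int_indep_or) auto
    then show ?thesis
      by (rule poly_int_cong) (simp only: pair_full[OF goodD(2)[OF good] v' c' ne] emb_simps(3,4))
  qed
  have 3: "poly_int n (\<lambda>p. of_bool (satisfies J (N p)))"
    by (rule poly_int_cong[OF good_atoms(1)[OF good, of v ?d]])
       (simp add: pair satisfies_def om_nil_def emb_simps c)
  show ?thesis using 1 2 3 unfolding F by blast
next
  case (rad m)
  have J: "(\<forall>q\<in>J. P q) \<longleftrightarrow> (\<forall>y\<in>UNIV. P (emb m, y))" for P unfolding rad by auto
  have "poly_int n (\<lambda>p. of_bool (om (f p) (emb m) (emb v) = 0) - of_bool (in_radical (f p) (emb m)))"
    by (intro poly_int_diff good_atoms[OF good])
  then have 1: "poly_int n (\<lambda>p. of_bool (\<exists>!t. \<forall>q\<in>J. om (f p) (fst q) (snd q) * t + N p (fst q) (snd q) = 0))"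
    unfolding J fst_conv snd_conv
  proof (rule poly_int_cong)
    fix p :: "'k alg_closure list" assume p: "length p = n"
    show "of_bool (om (f p) (emb m) (emb v) = 0) - of_bool (in_radical (f p) (emb m)) =
      (of_bool (\<exists>!t. \<forall>y\<in>UNIV. om (f p) (emb m) y * t + N p (emb m) y = 0) :: int)"
      unfolding radical_unique[OF goodD(2)[OF good p] v' c'] by (auto simp: in_radical_def)
  qed
  have 2: "poly_int n (\<lambda>p. of_bool (satisfies J (om (f p)) \<and> satisfies J (N p)))"
  proof -
    have "poly_int n (\<lambda>p. of_bool (if sp (emb v) (emb m) = 0 then in_radical (f p) (emb m) else vanishes (f p)))"
      by (cases "sp v m = 0") (simp_all add: emb_simps good_atoms[OF good])
    then show ?thesis
    proof (rule poly_int_cong)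
      fix p :: "'k alg_closure list" assume p: "length p = n"
      show "of_bool (if sp (emb v) (emb m) = 0 then in_radical (f p) (emb m) else vanishes (f p)) =
        (of_bool (satisfies J (om (f p)) \<and> satisfies J (N p)) :: int)"
        unfolding radical_full[OF goodD(2)[OF good p] v' c', symmetric] by (auto simp: satisfies_def J)
    qed
  qed
  have 3: "poly_int n (\<lambda>p. of_bool (satisfies J (N p)))"
  proof -
    have "poly_int n (\<lambda>p. of_bool (if sp (emb v) (emb m) = 0 then om (f p) (emb v) (emb m) = 0 else in_radical (f p) (emb v)))"
      by (cases "sp v m = 0") (simp_all add: emb_simps good_atoms[OF good])
    then show ?thesis
    proof (rule poly_int_cong)
      fix p :: "'k alg_closure list" assume p: "length p = n"
      show "of_bool (if sp (emb v) (emb m) = 0 then om (f p) (emb v) (emb m) = 0 else in_radical (f p) (emb v)) =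
        (of_bool (satisfies J (N p)) :: int)"
        unfolding radical_nil[OF goodD(2)[OF good p] v' c', symmetric] by (auto simp: satisfies_def J)
    qed
  qed
  show ?thesis using 1 2 3 by blast
next
  case (plane m m')
  have J: "(\<forall>q\<in>{a, b} \<times> UNIV. P q) \<longleftrightarrow> (\<forall>y. P (a, y)) \<and> (\<forall>y. P (b, y))"
    for P and a b :: "'k alg_closure vec4" by auto
  have e: "sp (emb m) (emb m') = 0" "indep (emb m) (emb m')" using plane by (simp_all add: emb_simps)
  have swap: "{emb m, emb m'} = {emb m', emb m}" by auto
  show ?thesis
  proof (cases "sp v m = 0 \<and> sp v m' = 0")
    case True
    then have ev: "sp (emb v) (emb m) = 0" "sp (emb v) (emb m') = 0" by (simp_all add: emb_simps)
    have "poly_int n (\<lambda>p. of_bool (om (f p) (emb m) (emb m') = 0) - of_bool (in_radical (f p) (emb m) \<and> in_radical (f p) (emb m')))"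
      by (intro poly_int_diff good_atoms[OF good] plane)
    then have 1: "poly_int n (\<lambda>p. of_bool (\<exists>!t. \<forall>q\<in>J. om (f p) (fst q) (snd q) * t + N p (fst q) (snd q) = 0))"
    proof (rule poly_int_cong)
      fix p :: "'k alg_closure list" assume p: "length p = n"
      show "of_bool (om (f p) (emb m) (emb m') = 0) - of_bool (in_radical (f p) (emb m) \<and> in_radical (f p) (emb m')) =
        (of_bool (\<exists>!t. \<forall>q\<in>J. om (f p) (fst q) (snd q) * t + N p (fst q) (snd q) = 0) :: int)"
        unfolding plane(1) plane_unique_perp[OF goodD(2)[OF good p] v' c' e ev] by (auto simp: in_radical_def)
    qed
    have 2: "poly_int n (\<lambda>p. of_bool (satisfies J (om (f p)) \<and> satisfies J (N p)))"
    proof (rule poly_int_cong[OF good_atoms(3)[OF good plane(2,3)]])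
      fix p :: "'k alg_closure list" assume p: "length p = n"
      show "of_bool (in_radical (f p) (emb m) \<and> in_radical (f p) (emb m')) =
        (of_bool (satisfies J (om (f p)) \<and> satisfies J (N p)) :: int)"
        unfolding plane_full_perp[OF goodD(2)[OF good p] v' c' ev, symmetric] plane(1) satisfies_def J by auto
    qed
    have 3: "poly_int n (\<lambda>p. of_bool (satisfies J (N p)))"
    proof (rule poly_int_cong[OF good_atoms(1)[OF good, of m m']])
      fix p :: "'k alg_closure list" assume p: "length p = n"
      show "of_bool (om (f p) (emb m) (emb m') = 0) = (of_bool (satisfies J (N p)) :: int)"
        unfolding plane_nil_perp[OF goodD(2)[OF good p] v' c' e ev, symmetric] plane(1) satisfies_def J by simp
    qed
    show ?thesis using 1 2 3 by blast
  next
    case False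
    then have ev: "sp (emb v) (emb m) \<noteq> 0 \<or> sp (emb v) (emb m') \<noteq> 0" by (simp add: emb_simps)
    have 2: "poly_int n (\<lambda>p. of_bool (satisfies J (om (f p)) \<and> satisfies J (N p)))"
    proof (rule poly_int_cong[OF good_atoms(4)[OF good]])
      fix p :: "'k alg_closure list" assume p: "length p = n"
      show "of_bool (vanishes (f p)) = (of_bool (satisfies J (om (f p)) \<and> satisfies J (N p)) :: int)"
        unfolding plane_full_transversal[OF goodD(2)[OF good p] v' c' ev, symmetric] plane(1) satisfies_def J by auto
    qed
    have 3: "poly_int n (\<lambda>p. of_bool (satisfies J (N p)))"
    proof (rule poly_int_cong[OF good_atoms(2)[OF good, of v]])
      fix p :: "'k alg_closure list" assume p: "length p = n"
      show "of_bool (in_radical (f p) (emb v)) = (of_bool (satisfies J (N p)) :: int)"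
        unfolding plane_nil_transversal[OF goodD(2)[OF good p] v' c' ev, symmetric] plane(1) satisfies_def J by simp
    qed
    \<comment> \<open>The plane is not perpendicular to \<open>v\<close>: it is spanned by \<open>b\<close> and the vector \<open>?z\<close> perpendicular to \<open>v\<close>.\<close>
    have main: "poly_int n (\<lambda>p. of_bool (\<exists>!t. \<forall>q\<in>{emb a, emb b} \<times> UNIV. om (f p) (fst q) (snd q) * t + N p (fst q) (snd q) = 0))"
      if ab: "sp a b = 0" "indep a b" "sp v b \<noteq> 0" for a b
    proof -
      let ?z = "dvec v a b"
      have z: "?z = lc (sp v a) b (- sp v b) a" by (simp add: dvec_def)
      have zne: "?z \<noteq> zv"
      proof
        assume "?z = zv"
        then have "lc (- sp v b) a (sp v a) b = zv" unfolding z by (cases a; cases b) (simp add: add.commute)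
        then show False using indep_lc_zero(1)[OF ab(2)] ab(3) by fastforce
      qed
      have zb: "sp ?z b = 0" using ab(1) by (simp add: z sp_lc)
      have zv0: "sp v ?z = 0" by simp
      have izv: "indep ?z v"
      proof (rule ccontr)
        assume "\<not> indep ?z v"
        then obtain k where "v = lc k ?z 0 ?z" using zne by (rule not_indepD)
        then have "sp v b = k * sp ?z b + 0 * sp ?z b" by (metis sp_lc(1))
        then show False using zb ab(3) by simp
      qed
      have eq: "(\<forall>y. g (emb a) y = 0) \<and> (\<forall>y. g (emb b) y = 0) \<longleftrightarrow> (\<forall>y. g (emb ?z) y = 0) \<and> (\<forall>y. g (emb b) y = 0)"
        if g: "bilin g" for g
      proof -
        have "g (emb ?z) y = to_ac (sp v a) * g (emb b) y - to_ac (sp v b) * g (emb a) y" for y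
          using g unfolding z emb_simps bilin_def by simp
        then show ?thesis using ab(3) by auto
      qed
      have sat: "(\<forall>q\<in>{emb a, emb b} \<times> UNIV. g (fst q) (snd q) = 0) \<longleftrightarrow> (\<forall>q\<in>{emb ?z, emb b} \<times> UNIV. g (fst q) (snd q) = 0)"
        if g: "bilin g" for g unfolding J fst_conv snd_conv by (rule eq[OF g])
      have rad: "in_radical (f p) (emb a) \<and> in_radical (f p) (emb b) \<longleftrightarrow> in_radical (f p) (emb ?z) \<and> in_radical (f p) (emb b)" for p
        unfolding in_radical_def by (rule eq[OF bilin_om])
      have "poly_int n (\<lambda>p. of_bool (in_radical (f p) (emb v)) + of_bool (in_radical (f p) (emb ?z))
          - of_bool (in_radical (f p) (emb ?z) \<and> in_radical (f p) (emb v))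
          - of_bool (in_radical (f p) (emb a) \<and> in_radical (f p) (emb b)))"
        by (intro poly_int_add poly_int_diff good_atoms[OF good] ab izv) simp
      then show ?thesis
      proof (rule poly_int_cong)
        fix p :: "'k alg_closure list" assume p: "length p = n"
        have "(of_bool (\<exists>!t. \<forall>q\<in>{emb a, emb b} \<times> UNIV. om (f p) (fst q) (snd q) * t + N p (fst q) (snd q) = 0) :: int)
          = of_bool (\<exists>!t. \<forall>q\<in>{emb ?z, emb b} \<times> UNIV. om (f p) (fst q) (snd q) * t + N p (fst q) (snd q) = 0)"
          unfolding sat[OF bilin_pencil[OF bilin_om bilin_om_nil]] ..
        also have "\<dots> = of_bool (in_radical (f p) (emb v)) + of_bool (in_radical (f p) (emb ?z))
          - of_bool (in_radical (f p) (emb ?z) \<and> in_radical (f p) (emb v))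
          - of_bool (in_radical (f p) (emb ?z) \<and> in_radical (f p) (emb b))"
          by (rule plane_unique_transversal[OF goodD(2)[OF good p] v' c'])
             (use zb zne zv0 ab(3) in \<open>simp_all only: emb_simps to_ac_eq_0_iff to_ac_0 flip: emb_simps(3)\<close>, simp_all add: emb_simps)
        finally show "of_bool (in_radical (f p) (emb v)) + of_bool (in_radical (f p) (emb ?z))
          - of_bool (in_radical (f p) (emb ?z) \<and> in_radical (f p) (emb v))
          - of_bool (in_radical (f p) (emb a) \<and> in_radical (f p) (emb b)) =
          (of_bool (\<exists>!t. \<forall>q\<in>{emb a, emb b} \<times> UNIV. om (f p) (fst q) (snd q) * t + N p (fst q) (snd q) = 0) :: int)"
          unfolding rad by simp
      qed
    qed
    have 1: "poly_int n (\<lambda>p. of_bool (\<exists>!t. \<forall>q\<in>J. om (f p) (fst q) (snd q) * t + N p (fst q) (snd q) = 0))"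
    proof (cases "sp v m' = 0")
      case True
      have "indep m' m" using plane(3) by (cases m; cases m') (auto simp: mult.commute)
      moreover have "sp m' m = 0" using plane(2) sp_skew[of m' m] by simp
      ultimately show ?thesis
        using main[of m' m] True False unfolding plane(1) swap by blast
    next
      case False
      then show ?thesis using main[of m m'] plane by blast
    qed
    show ?thesis using 1 2 3 by blast
  qed
next
  case zero
  have J: "(\<forall>q\<in>UNIV. P q) \<longleftrightarrow> (\<forall>x y. P (x, y))" for P :: "'k alg_closure vec4 \<times> 'k alg_closure vec4 \<Rightarrow> bool" by auto
  have "poly_int n (\<lambda>p. of_bool (in_radical (f p) (emb v)) - of_bool (vanishes (f p)))"
    by (intro poly_int_diff good_atoms[OF good])
  then have 1: "poly_int n (\<lambda>p. of_bool (\<exists>!t. \<forall>q\<in>J. om (f p) (fst q) (snd q) * t + N p (fst q) (snd q) = 0))"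
  proof (rule poly_int_cong)
    fix p :: "'k alg_closure list" assume p: "length p = n"
    show "of_bool (in_radical (f p) (emb v)) - of_bool (vanishes (f p)) =
      (of_bool (\<exists>!t. \<forall>q\<in>J. om (f p) (fst q) (snd q) * t + N p (fst q) (snd q) = 0) :: int)"
      unfolding zero vanishes_unique[OF goodD(2)[OF good p] v' c'] by (auto simp: vanishes_def)
  qed
  have 2: "poly_int n (\<lambda>p. of_bool (satisfies J (om (f p)) \<and> satisfies J (N p)))"
  proof (rule poly_int_cong[OF good_atoms(4)[OF good]])
    fix p :: "'k alg_closure list" assume p: "length p = n"
    show "of_bool (vanishes (f p)) = (of_bool (satisfies J (om (f p)) \<and> satisfies J (N p)) :: int)"
      unfolding vanishes_full[OF goodD(2)[OF good p] v' c', symmetric] zero satisfies_def J by auto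
  qed
  have 3: "poly_int n (\<lambda>p. of_bool (satisfies J (N p)))"
  proof (rule poly_int_cong[OF good_atoms(2)[OF good, of v]])
    fix p :: "'k alg_closure list" assume p: "length p = n"
    show "of_bool (in_radical (f p) (emb v)) = (of_bool (satisfies J (N p)) :: int)"
      unfolding vanishes_nil[OF goodD(2)[OF good p] v' c', symmetric] zero satisfies_def J by simp
  qed
  show ?thesis using 1 2 3 by blast
qed

lemma good_pencil:
  assumes om: "\<And>y u w. om (g y) u w = om (f (butlast y)) u w * last y + N (butlast y) u w"
    and quad: "\<And>y. length y = Suc n \<Longrightarrow> on_quadric (g y)"
  shows "good (Suc n) g"
  unfolding good_def
proof (intro conjI allI impI)
  show "polyfun (Suc n) (\<lambda>p. om (g p) (emb x) (emb y))" for x y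
    unfolding om
    by (intro polyfun_add polyfun_mult polyfun_last polyfun_butlast[OF goodD(1)[OF good]] polyfun_butlast[OF polyfun_om_nil[OF good]])
  show "length p = Suc n \<Longrightarrow> on_quadric (g p)" for p by (rule quad)
  fix J :: "('k alg_closure vec4 \<times> 'k alg_closure vec4) set" assume J: "cond J"
  have "om (g p) = (\<lambda>u w. om (f (butlast p)) u w * last p + N (butlast p) u w)" for p
    by (intro ext om)
  then show "poly_int (Suc n) (\<lambda>p. of_bool (satisfies J (om (g p))))"
    using poly_int_pencil[OF J bilin_om bilin_om_nil goodD(1)[OF good] polyfun_om_nil[OF good]] pencil_pieces[OF J]
    by simp
qed

lemma good_nil:
  assumes om: "\<And>p u w. om (g p) u w = N p u w" and quad: "\<And>p. length p = n \<Longrightarrow> on_quadric (g p)"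
  shows "good n g"
  unfolding good_def
proof (intro conjI allI impI)
  show "polyfun n (\<lambda>p. om (g p) (emb x) (emb y))" for x y
    unfolding om by (rule polyfun_om_nil[OF good])
  show "length p = n \<Longrightarrow> on_quadric (g p)" for p by (rule quad)
  fix J :: "('k alg_closure vec4 \<times> 'k alg_closure vec4) set" assume J: "cond J"
  have "om (g p) = N p" for p by (intro ext om)
  then show "poly_int n (\<lambda>p. of_bool (satisfies J (om (g p))))"
    using pencil_pieces[OF J] by simp
qed

text \<open>
  Here the parameter multiplies the nilpotent part. This is the other affine chart of the pencil in
  \<open>good_pencil\<close>, and \<open>unique_solution_swap\<close> compares the two.
\<close>

lemma good_series:
  assumes om: "\<And>y u w. om (g y) u w = N (butlast y) u w * last y + om (f (butlast y)) u w"
    and quad: "\<And>y. length y = Suc n \<Longrightarrow> on_quadric (g y)"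
  shows "good (Suc n) g"
  unfolding good_def
proof (intro conjI allI impI)
  show "polyfun (Suc n) (\<lambda>p. om (g p) (emb x) (emb y))" for x y
    unfolding om
    by (intro polyfun_add polyfun_mult polyfun_last polyfun_butlast[OF goodD(1)[OF good]] polyfun_butlast[OF polyfun_om_nil[OF good]])
  show "length p = Suc n \<Longrightarrow> on_quadric (g p)" for p by (rule quad)
  fix J :: "('k alg_closure vec4 \<times> 'k alg_closure vec4) set" assume J: "cond J"
  note P = pencil_pieces[OF J]
  have eq: "om (g p) = (\<lambda>u w. N (butlast p) u w * last p + om (f (butlast p)) u w)" for p
    by (intro ext om)
  have "poly_int n (\<lambda>p. of_bool (\<exists>!t. \<forall>q\<in>J. om (f p) (fst q) (snd q) * t + N p (fst q) (snd q) = 0)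
      + of_bool (satisfies J (om (f p))) - of_bool (satisfies J (N p)))"
    using P goodD(3)[OF good J] by (intro poly_int_add poly_int_diff) blast+
  then have "poly_int n (\<lambda>p. of_bool (\<exists>!t. \<forall>q\<in>J. N p (fst q) (snd q) * t + om (f p) (fst q) (snd q) = 0))"
    unfolding unique_solution_swap[of J "\<lambda>q. N _ (fst q) (snd q)" "\<lambda>q. om (f _) (fst q) (snd q)"] satisfies_def .
  moreover have "poly_int n (\<lambda>p. of_bool (satisfies J (N p) \<and> satisfies J (om (f p))))"
    using P by (simp add: conj_commute)
  ultimately show "poly_int (Suc n) (\<lambda>p. of_bool (satisfies J (om (g p))))"
    unfolding eq by (rule poly_int_pencil[OF J bilin_om_nil bilin_om polyfun_om_nil[OF good] goodD(1)[OF good]])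
qed

end

section \<open>The moves on states\<close>

text \<open>
  Where the condition fails for \<open>f\<close>, exactly \<open>t = 0\<close> satisfies it.
\<close>

lemma good_scaled:
  assumes good: "good n f" and om: "\<And>y u w. om (g y) u w = om (f (butlast y)) u w * last y"
    and quad: "\<And>y. length y = Suc n \<Longrightarrow> on_quadric (g y)"
  shows "good (Suc n) g"
  unfolding good_def
proof (intro conjI allI impI)
  show "polyfun (Suc n) (\<lambda>p. om (g p) (emb x) (emb y))" for x y
    unfolding om by (intro polyfun_mult polyfun_last polyfun_butlast[OF goodD(1)[OF good]])
  show "length p = Suc n \<Longrightarrow> on_quadric (g p)" for p by (rule quad)
  fix J :: "('a alg_closure vec4 \<times> 'a alg_closure vec4) set" assume J: "cond J"
  have eq: "om (g p) = (\<lambda>u w. om (f (butlast p)) u w * last p + 0)" for p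
    by (intro ext) (simp add: om)
  have U: "(\<exists>!t. \<forall>q\<in>J. om (f p) (fst q) (snd q) * t + 0 = 0) \<longleftrightarrow> \<not> satisfies J (om (f p))" for p
    unfolding unique_solution_iff satisfies_def by (auto intro: exI[of _ 0])
  have "poly_int n (\<lambda>p. 1 - of_bool (satisfies J (om (f p))))"
    by (intro poly_int_diff poly_int_1 goodD(3)[OF good J])
  then have "poly_int n (\<lambda>p. of_bool (\<exists>!t. \<forall>q\<in>J. om (f p) (fst q) (snd q) * t + 0 = 0))"
    unfolding U by (rule poly_int_cong) simp
  moreover have "poly_int n (\<lambda>p. of_bool (satisfies J (om (f p)) \<and> satisfies J (\<lambda>_ _. 0)))"
    using goodD(3)[OF good J] by (simp add: satisfies_def)
  ultimately show "poly_int (Suc n) (\<lambda>p. of_bool (satisfies J (om (g p))))"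
    unfolding eq
    by (intro poly_int_pencil[OF J bilin_om _ goodD(1)[OF good]]) (simp_all add: bilin_def polyfun_0)
qed

lemma good_constant:
  assumes good: "good n f"
  shows "good (Suc n) (\<lambda>y. f (butlast y))"
  unfolding good_def
proof (intro conjI allI impI)
  show "polyfun (Suc n) (\<lambda>p. om (f (butlast p)) (emb x) (emb y))" for x y
    by (intro polyfun_butlast[OF goodD(1)[OF good]])
  show "length p = Suc n \<Longrightarrow> on_quadric (f (butlast p))" for p using goodD(2)[OF good, of "butlast p"] by simp
  fix J :: "('a alg_closure vec4 \<times> 'a alg_closure vec4) set" assume J: "cond J"
  have eq: "om (f (butlast p)) = (\<lambda>u w. 0 * last p + om (f (butlast p)) u w)" for p
    by (intro ext) simp
  have U: "\<not> (\<exists>!t. \<forall>q\<in>J. 0 * t + om (f p) (fst q) (snd q) = 0)" for p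
  proof
    assume "\<exists>!t. \<forall>q\<in>J. 0 * t + om (f p) (fst q) (snd q) = 0"
    then show False unfolding unique_solution_iff by auto
  qed
  have "poly_int (Suc n) (\<lambda>p. of_bool (satisfies J (\<lambda>u w. 0 * last p + om (f (butlast p)) u w)))"
  proof (rule poly_int_pencil[OF J _ bilin_om _ goodD(1)[OF good]])
    show "poly_int n (\<lambda>p. of_bool (\<exists>!t. \<forall>q\<in>J. 0 * t + om (f p) (fst q) (snd q) = 0))"
      using U poly_int_0 by simp
    show "poly_int n (\<lambda>p. of_bool (satisfies J (\<lambda>_ _. 0) \<and> satisfies J (om (f p))))"
      using goodD(3)[OF good J] by (simp add: satisfies_def)
  qed (simp_all add: bilin_def polyfun_0)
  then show "poly_int (Suc n) (\<lambda>p. of_bool (satisfies J (om (f (butlast p)))))"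
    unfolding eq[symmetric] .
qed

text \<open>
  A permutation of the marked vertices acts on the forms, up to sign, through a linear map that
  preserves \<open>sp\<close> and therefore permutes the conditions.
\<close>

lemma good_symmetry:
  assumes good: "good n f"
    and om: "\<And>p u w. om (g p) u w = - om (f p) (P u) (P w)"
    and quad: "\<And>p. length p = n \<Longrightarrow> on_quadric (g p)"
    and P: "\<And>u. P (emb u) = emb (P' u)" "\<And>u w. sp (P' u) (P' w) = sp u w" "\<And>u w. indep (P' u) (P' w) \<longleftrightarrow> indep u w"
      "\<And>u. P (P u) = u"
  shows "good n g"
  unfolding good_def
proof (intro conjI allI impI)
  show "polyfun n (\<lambda>p. om (g p) (emb x) (emb y))" for x y
    unfolding om P(1) by (intro polyfun_uminus goodD(1)[OF good])
  show "length p = n \<Longrightarrow> on_quadric (g p)" for p by (rule quad)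
  fix J :: "('a alg_closure vec4 \<times> 'a alg_closure vec4) set" assume J: "cond J"
  let ?J = "map_prod P P ` J"
  have surj: "surj P" using P(4) by (metis surjI)
  have UP: "map_prod P P ` (A \<times> UNIV) = P ` A \<times> UNIV" for A
    using surj by (simp add: map_prod_def image_paired_Times)
  have "cond ?J" using J
  proof cases
    case (pair x y)
    then show ?thesis using cond.pair[of "P' x" "P' y"] by (simp add: P(1))
  next
    case (rad m)
    then show ?thesis using cond.rad[of "P' m"] by (simp add: P(1) UP)
  next
    case (plane m m')
    then show ?thesis using cond.plane[of "P' m" "P' m'"] by (simp add: P UP)
  next
    case zero
    have "map_prod P P ` UNIV = UNIV" using UP[of UNIV] surj by simp
    then show ?thesis using zero cond.zero by simp
  qed
  from goodD(3)[OF good this]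
  show "poly_int n (\<lambda>p. of_bool (satisfies J (om (g p))))"
    by (rule poly_int_cong) (simp add: satisfies_def om)
qed

text \<open>
  A new edge with variable \<open>a\<close> between the first two marked vertices.
\<close>

fun st_parallel :: "'a::comm_ring_1 \<Rightarrow> 'a state \<Rightarrow> 'a state" where
  "st_parallel a (State f0 f1 f2 f3 f4) = State (a * f0 + f1 + f2) (a * f1) (a * f2) (a * f3 + f4) (a * f4)"

text \<open>
  The first marked vertex is no longer marked, and a new isolated vertex takes its place.
\<close>

fun st_forget :: "'a::comm_ring_1 state \<Rightarrow> 'a state" where
  "st_forget (State f0 f1 f2 f3 f4) = State 0 f0 0 0 (f2 + f3)"

text \<open>
  A new edge with variable \<open>a\<close> leads from the first marked vertex to a new vertex, which takes its
  place.
\<close>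

fun st_series :: "'a::comm_ring_1 \<Rightarrow> 'a state \<Rightarrow> 'a state" where
  "st_series a (State f0 f1 f2 f3 f4) = State f0 (f1 + a * f0) f2 f3 (f4 + a * (f2 + f3))"

text \<open>
  A self-loop with variable \<open>a\<close>.
\<close>

fun st_scale :: "'a::comm_ring_1 \<Rightarrow> 'a state \<Rightarrow> 'a state" where
  "st_scale a (State f0 f1 f2 f3 f4) = State (a * f0) (a * f1) (a * f2) (a * f3) (a * f4)"

text \<open>
  This and \<open>st_swap23\<close> exchange two neighbouring marked vertices.
\<close>

fun st_swap12 :: "'a state \<Rightarrow> 'a state" where
  "st_swap12 (State f0 f1 f2 f3 f4) = State f0 f2 f1 f3 f4"

fun st_swap23 :: "'a state \<Rightarrow> 'a state" where
  "st_swap23 (State f0 f1 f2 f3 f4) = State f0 f1 f3 f2 f4"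

lemma on_quadric_ops:
  assumes "on_quadric f"
  shows "on_quadric (st_parallel a f)" "on_quadric (st_forget f)" "on_quadric (st_series a f)"
    "on_quadric (st_scale a f)" "on_quadric (st_swap12 f)" "on_quadric (st_swap23 f)"
proof -
  obtain f0 f1 f2 f3 f4 where f: "f = State f0 f1 f2 f3 f4" by (cases f)
  have q: "f0 * f4 = f1 * f2 + f1 * f3 + f2 * f3" using assms by (simp add: f)
  have "(a * f0) * (a * f4) = a * a * (f0 * f4)" by (simp add: algebra_simps)
  also have "\<dots> = a * a * (f1 * f2 + f1 * f3 + f2 * f3)" unfolding q ..
  finally have q2: "(a * f0) * (a * f4) = a * a * (f1 * f2 + f1 * f3 + f2 * f3)" .
  show "on_quadric (st_parallel a f)"
    unfolding f st_parallel.simps on_quadric.simps distrib_right q2 by (simp add: algebra_simps)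
  show "on_quadric (st_forget f)" by (simp add: f)
  show "on_quadric (st_series a f)"
    unfolding f st_series.simps on_quadric.simps distrib_left q by (simp add: algebra_simps)
  show "on_quadric (st_scale a f)"
    unfolding f st_scale.simps on_quadric.simps q2 by (simp add: algebra_simps)
  show "on_quadric (st_swap12 f)" "on_quadric (st_swap23 f)" using q by (simp_all add: f algebra_simps)
qed

text \<open>
  The parallel and series moves are the two charts of pencils along transvections, and forgetting a
  vertex is the nilpotent part of the second pencil.
\<close>

lemma om_parallel: "om (st_parallel a f) x y = om f x y * a + om_nil 1 (Vec 0 0 1 (- 1)) f x y"
  unfolding om_nil_eq by (cases f; cases x; cases y) (simp add: algebra_simps)

lemma om_forget: "om (st_forget f) x y = om_nil (- 1) (Vec 1 0 0 0) f x y"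
  unfolding om_nil_eq by (cases f; cases x; cases y) (simp add: algebra_simps)

lemma om_series: "om (st_series a f) x y = om_nil (- 1) (Vec 1 0 0 0) f x y * a + om f x y"
  unfolding om_nil_eq by (cases f; cases x; cases y) (simp add: algebra_simps)

lemma om_scale: "om (st_scale a f) x y = om f x y * a"
  by (cases f; cases x; cases y) (simp add: algebra_simps)

fun vec_swap12 :: "'a vec4 \<Rightarrow> 'a vec4" where
  "vec_swap12 (Vec x1 x2 x3 x4) = Vec x2 x1 x4 x3"

fun vec_swap23 :: "'a::comm_ring_1 vec4 \<Rightarrow> 'a vec4" where
  "vec_swap23 (Vec x1 x2 x3 x4) = Vec (x1 - x2) (- x2) x3 (- x3 - x4)"

lemma om_swap12: "om (st_swap12 f) x y = - om f (vec_swap12 x) (vec_swap12 y)"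
  by (cases f; cases x; cases y) (simp add: algebra_simps)

lemma om_swap23: "om (st_swap23 f) x y = - om f (vec_swap23 x) (vec_swap23 y)"
  by (cases f; cases x; cases y) (simp add: algebra_simps)

lemma emb_Vec: "emb (Vec a b c d) = Vec (to_ac a) (to_ac b) (to_ac c) (to_ac d)"
  by (simp add: emb_def)

lemma good_parallel: "good n f \<Longrightarrow> good (Suc n) (\<lambda>y. st_parallel (last y) (f (butlast y)))"
  by (rule good_pencil[where v = "Vec 0 0 1 (- 1)" and c = 1])
     (simp_all add: om_parallel emb_Vec on_quadric_ops goodD)

lemma good_forget: "good n f \<Longrightarrow> good n (\<lambda>y. st_forget (f y))"
  by (rule good_nil[where v = "Vec 1 0 0 0" and c = "- 1"])
     (simp_all add: om_forget emb_Vec on_quadric_ops goodD)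

lemma good_series_op: "good n f \<Longrightarrow> good (Suc n) (\<lambda>y. st_series (last y) (f (butlast y)))"
  by (rule good_series[where v = "Vec 1 0 0 0" and c = "- 1"])
     (simp_all add: om_series emb_Vec on_quadric_ops goodD)

lemma good_scale: "good n f \<Longrightarrow> good (Suc n) (\<lambda>y. st_scale (last y) (f (butlast y)))"
  by (rule good_scaled[where f = f]) (simp_all add: om_scale on_quadric_ops goodD)

lemma good_swap12: "good n f \<Longrightarrow> good n (\<lambda>y. st_swap12 (f y))"
proof (rule good_symmetry[where P = vec_swap12 and P' = vec_swap12])
  show "vec_swap12 (emb u) = emb (vec_swap12 u)" for u :: "'a vec4" by (cases u) (simp add: emb_Vec)
  show "sp (vec_swap12 u) (vec_swap12 w) = sp u w" for u w :: "'a vec4"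
    by (cases u; cases w) (simp add: algebra_simps)
  show "indep (vec_swap12 u) (vec_swap12 w) \<longleftrightarrow> indep u w" for u w :: "'a vec4"
    by (cases u; cases w) auto
  show "vec_swap12 (vec_swap12 u) = u" for u :: "'a alg_closure vec4" by (cases u) simp
qed (simp_all add: om_swap12 on_quadric_ops goodD)

lemma indep_vec_swap23: "indep u w \<Longrightarrow> indep (vec_swap23 u) (vec_swap23 w)" for u w :: "'a::field vec4"
proof (rule ccontr)
  obtain u1 u2 u3 u4 where u: "u = Vec u1 u2 u3 u4" by (cases u)
  obtain w1 w2 w3 w4 where w: "w = Vec w1 w2 w3 w4" by (cases w)
  assume i: "indep u w" and n: "\<not> indep (vec_swap23 u) (vec_swap23 w)"
  have m: "(u1 - u2) * w2 = u2 * (w1 - w2)" "(u1 - u2) * w3 = u3 * (w1 - w2)"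
    "(u1 - u2) * (- w3 - w4) = (- u3 - u4) * (w1 - w2)" "u2 * w3 = u3 * w2" "- u2 * (- w3 - w4) = (- u3 - u4) * (- w2)"
    "u3 * (- w3 - w4) = (- u3 - u4) * w3"
    using n unfolding u w vec_swap23.simps indep.simps by simp_all
  have "u1 * w2 = u2 * w1" "u3 * w4 = u4 * w3" "u2 * w4 = u4 * w2" "u1 * w3 = u3 * w1"
    using m by (simp_all add: algebra_simps)
  moreover have "u1 * w4 = u4 * w1"
    using m(3) m(4) calculation by (simp add: algebra_simps)
  ultimately show False using i m(4) unfolding u w indep.simps by blast
qed

lemma vec_swap23_swap23: "vec_swap23 (vec_swap23 u) = u"
  by (cases u) simp

lemma good_swap23: "good n f \<Longrightarrow> good n (\<lambda>y. st_swap23 (f y))"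
proof (rule good_symmetry[where P = vec_swap23 and P' = vec_swap23])
  show "vec_swap23 (emb u) = emb (vec_swap23 u)" for u :: "'a vec4" by (cases u) (simp add: emb_Vec)
  show "sp (vec_swap23 u) (vec_swap23 w) = sp u w" for u w :: "'a vec4"
    by (cases u; cases w) (simp add: algebra_simps)
  show "indep (vec_swap23 u) (vec_swap23 w) \<longleftrightarrow> indep u w" for u w :: "'a vec4"
    using indep_vec_swap23[of u w] indep_vec_swap23[of "vec_swap23 u" "vec_swap23 w"]
    unfolding vec_swap23_swap23 by blast
  show "vec_swap23 (vec_swap23 u) = u" for u :: "'a alg_closure vec4" by (rule vec_swap23_swap23)
qed (simp_all add: om_swap23 on_quadric_ops goodD)

lemma poly_int_zero_dim: "poly_int 0 \<phi>"
  by (rule poly_int_cong[OF poly_int_scale[OF poly_int_1, of 0 "\<phi> []"]]) simp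

text \<open>
  The state of three isolated vertices without edges.
\<close>

lemma good_init: "good 0 (\<lambda>_. State 0 0 0 0 1)"
  unfolding good_def
proof (intro conjI allI impI poly_int_zero_dim)
  show "polyfun 0 (\<lambda>p. om (State 0 0 0 0 1) (emb x) (emb y))" for x y :: "'a vec4"
  proof -
    have "om (State 0 0 0 0 1) (emb x) (emb y) = to_ac (om (State 0 0 0 0 1) x y)"
      by (cases x; cases y) (simp add: emb_Vec)
    then show ?thesis by (simp add: polyfun_const)
  qed
qed simp

section \<open>Graph polynomials with three marked vertices\<close>

text \<open>
  A colouring \<open>c\<close> stands for the partition of the vertices into sets of equal colour, the vertices
  that have been identified so far. The classes of \<open>u\<close> and \<open>v\<close> are identified by recolouring the
  first one.
\<close>

definition merge :: "('w \<Rightarrow> 'w) \<Rightarrow> 'w \<Rightarrow> 'w \<Rightarrow> 'w \<Rightarrow> 'w" where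
  "merge c u v x = (if c x = c u then c v else c x)"

text \<open>
  The graph polynomial of the graph with vertices \<open>W\<close>, identified according to \<open>c\<close>, and a list of
  edges, by deletion and contraction of the head edge; an edge whose ends have been identified
  cannot be contracted. The head edge carries the last variable, as adding an edge at the head
  passes from \<open>n\<close>-space to \<open>(n + 1)\<close>-space by appending a coordinate.
\<close>

fun psi :: "'w set \<Rightarrow> ('w \<Rightarrow> 'w) \<Rightarrow> ('w \<times> 'w) list \<Rightarrow> 'a::comm_ring_1 list \<Rightarrow> 'a" where
  "psi W c [] p = of_bool (\<forall>x\<in>W. \<forall>y\<in>W. c x = c y)"
| "psi W c ((u, v) # es) p = last p * psi W c es (butlast p) + (if c u = c v then 0 else psi W (merge c u v) es (butlast p))"

definition vset :: "('w \<times> 'w) list \<Rightarrow> 'w set" where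
  "vset es = (\<Union>e\<in>set es. {fst e, snd e})"

lemma vset_simps [simp]: "vset [] = {}" "vset ((u, v) # es) = {u, v} \<union> vset es"
  by (auto simp: vset_def)

lemma finite_vset [simp]: "finite (vset es)"
  by (simp add: vset_def)

text \<open>
  The polynomial depends only on the partition into colour classes and on the classes that the edges
  meet. Vertices that are not met by an edge can be moved within their class, dropped or added, as
  long as no class appears or disappears.
\<close>

lemma psi_transfer:
  fixes p :: "'a::comm_ring_1 list"
  assumes "vset es \<subseteq> W" "r ` W \<subseteq> W'" "\<And>x. x \<in> vset es \<Longrightarrow> r x = x"
    and "\<And>x y. x \<in> W \<Longrightarrow> y \<in> W \<Longrightarrow> c x = c y \<longleftrightarrow> c' (r x) = c' (r y)"
    and "\<And>y. y \<in> W' \<Longrightarrow> \<exists>x\<in>W. c' y = c' (r x)"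
  shows "psi W c es p = psi W' c' es p"
  using assms
proof (induction es arbitrary: c c' p)
  case Nil
  have "(\<forall>x\<in>W. \<forall>y\<in>W. c x = c y) \<longleftrightarrow> (\<forall>x\<in>W'. \<forall>y\<in>W'. c' x = c' y)"
  proof
    assume *: "\<forall>x\<in>W. \<forall>y\<in>W. c x = c y"
    show "\<forall>x\<in>W'. \<forall>y\<in>W'. c' x = c' y"
    proof (intro ballI)
      fix x y assume "x \<in> W'" "y \<in> W'"
      then obtain x0 y0 where "x0 \<in> W" "c' x = c' (r x0)" "y0 \<in> W" "c' y = c' (r y0)" using Nil(5) by metis
      then show "c' x = c' y" using * Nil(4) by metis
    qed
  next
    assume *: "\<forall>x\<in>W'. \<forall>y\<in>W'. c' x = c' y"
    then show "\<forall>x\<in>W. \<forall>y\<in>W. c x = c y" using Nil(2,4) by blast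
  qed
  then show ?case by simp
next
  case (Cons e es)
  obtain u v where e: "e = (u, v)" by (cases e)
  have uv: "u \<in> W" "v \<in> W" "r u = u" "r v = v" using Cons.prems(1,3) by (auto simp: e)
  have cuv: "c u = c v \<longleftrightarrow> c' u = c' v" using Cons.prems(4)[OF uv(1,2)] uv by simp
  have 1: "psi W c es p = psi W' c' es p" for p :: "'a list"
    by (rule Cons.IH[OF _ Cons.prems(2) _ Cons.prems(4,5)]) (use Cons.prems(1,3) in \<open>auto simp: e\<close>)
  have 2: "psi W (merge c u v) es p = psi W' (merge c' u v) es p" for p :: "'a list"
  proof (rule Cons.IH[OF _ Cons.prems(2)])
    show "vset es \<subseteq> W" using Cons.prems(1) by (auto simp: e)
    show "r x = x" if "x \<in> vset es" for x using Cons.prems(3) that by (auto simp: e)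
    have k: "c x = c u \<longleftrightarrow> c' (r x) = c' u" "c x = c v \<longleftrightarrow> c' (r x) = c' v"
       "c v = c x \<longleftrightarrow> c' v = c' (r x)" if "x \<in> W" for x
      using Cons.prems(4)[OF that uv(1)] Cons.prems(4)[OF that uv(2)] Cons.prems(4)[OF uv(2) that] uv by simp_all
    show "merge c u v x = merge c u v y \<longleftrightarrow> merge c' u v (r x) = merge c' u v (r y)" if "x \<in> W" "y \<in> W" for x y
      unfolding merge_def using k[OF that(1)] k[OF that(2)] Cons.prems(4)[OF that] by (simp split: if_splits)
    show "\<exists>x\<in>W. merge c' u v y = merge c' u v (r x)" if y: "y \<in> W'" for y
    proof -
      obtain x where "x \<in> W" "c' y = c' (r x)" using Cons.prems(5)[OF y] by blast
      then show ?thesis unfolding merge_def by (intro bexI[of _ x]) simp_all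
    qed
  qed
  show ?case unfolding e psi.simps 1 2 cuv ..
qed

lemma psi_cong:
  assumes "vset es \<subseteq> W" "\<And>x y. x \<in> W \<Longrightarrow> y \<in> W \<Longrightarrow> c x = c y \<longleftrightarrow> c' x = c' y"
  shows "psi W c es p = psi W c' es p"
  by (rule psi_transfer[where r = id]) (use assms in auto)

text \<open>
  A class that no edge meets can never be connected to the others.
\<close>

lemma psi_isolated:
  fixes p :: "'a::comm_ring_1 list"
  assumes "x \<in> W" "z \<in> W" "c x \<noteq> c z" "\<And>w. w \<in> vset es \<Longrightarrow> c w \<noteq> c x"
  shows "psi W c es p = 0"
  using assms
proof (induction es arbitrary: c p)
  case Nil
  then show ?case by auto
next
  case (Cons e es)
  obtain u v where e: "e = (u, v)" by (cases e)
  have 1: "psi W c es p = 0" for p :: "'a list"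
    by (rule Cons.IH[OF Cons.prems(1,2,3)]) (use Cons.prems(4) in \<open>auto simp: e\<close>)
  have x: "c u \<noteq> c x" "c v \<noteq> c x" using Cons.prems(4) by (auto simp: e)
  have 2: "psi W (merge c u v) es p = 0" for p :: "'a list"
  proof (rule Cons.IH[OF Cons.prems(1,2)])
    show "merge c u v x \<noteq> merge c u v z" using Cons.prems(3) x by (auto simp: merge_def)
    show "merge c u v w \<noteq> merge c u v x" if "w \<in> vset es" for w
      using Cons.prems(4)[of w] that x by (auto simp: merge_def e)
  qed
  show ?case unfolding e psi.simps 1 2 by simp
qed

lemma psi_swap_edge:
  fixes p :: "'a::comm_ring_1 list"
  assumes "vset ((u, v) # es) \<subseteq> W"
  shows "psi W c ((u, v) # es) p = psi W c ((v, u) # es) p"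
proof -
  have "psi W (merge c u v) es q = psi W (merge c v u) es q" for q :: "'a list"
    by (rule psi_cong) (use assms in \<open>auto simp: merge_def\<close>)
  then show ?thesis by (simp add: eq_commute[of "c u"])
qed

definition glue :: "'w \<Rightarrow> 'w \<Rightarrow> 'w \<Rightarrow> 'w" where
  "glue a b x = (if x = a then b else x)"

definition glue3 :: "'w \<Rightarrow> 'w \<Rightarrow> 'w \<Rightarrow> 'w \<Rightarrow> 'w" where
  "glue3 a b d x = (if x = a \<or> x = b then d else x)"

text \<open>
  The marked vertices can be identified in five ways. If \<open>d\<close> is identified with \<open>b\<close>, the spanning
  trees of the resulting graph are the forests with two trees that separate \<open>d\<close> from \<open>b\<close>, which
  \<open>f\<^sub>2\<close> and \<open>f\<^sub>3\<close> enumerate; similarly for the other pairs.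
\<close>

fun represents :: "('w \<times> 'w) list \<Rightarrow> 'w \<Rightarrow> 'w \<Rightarrow> 'w \<Rightarrow> 'a::comm_ring_1 state \<Rightarrow> 'a list \<Rightarrow> bool" where
  "represents es a b d (State f0 f1 f2 f3 f4) p \<longleftrightarrow> (let W = {a, b, d} \<union> vset es in
     psi W id es p = f0 \<and> psi W (glue d b) es p = f2 + f3 \<and> psi W (glue d a) es p = f1 + f3 \<and>
     psi W (glue b a) es p = f1 + f2 \<and> psi W (glue3 b d a) es p = f4)"

lemma representsI:
  assumes "f = State f0 f1 f2 f3 f4" "W = {a, b, d} \<union> vset es"
    and "psi W id es p = f0" "psi W (glue d b) es p = f2 + f3" "psi W (glue d a) es p = f1 + f3"
     "psi W (glue b a) es p = f1 + f2" "psi W (glue3 b d a) es p = f4"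
  shows "represents es a b d f p"
  using assms by (simp add: Let_def)

lemma representsD:
  assumes "represents es a b d (State f0 f1 f2 f3 f4) p"
  shows "psi ({a, b, d} \<union> vset es) id es p = f0" "psi ({a, b, d} \<union> vset es) (glue d b) es p = f2 + f3"
     "psi ({a, b, d} \<union> vset es) (glue d a) es p = f1 + f3"
     "psi ({a, b, d} \<union> vset es) (glue b a) es p = f1 + f2" "psi ({a, b, d} \<union> vset es) (glue3 b d a) es p = f4"
  using assms by (simp_all add: Let_def)

lemma represents_swap12:
  assumes "represents es a b d f p"
  shows "represents es b a d (st_swap12 f) p"
proof -
  obtain f0 f1 f2 f3 f4 where f: "f = State f0 f1 f2 f3 f4" by (cases f)
  note v = representsD[OF assms[unfolded f]]
  let ?W = "{b, a, d} \<union> vset es"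
  have W: "?W = {a, b, d} \<union> vset es" by auto
  show ?thesis
  proof (rule representsI[OF _ refl])
    show "st_swap12 f = State f0 f2 f1 f3 f4" by (simp add: f)
    show "psi ?W id es p = f0" "psi ?W (glue d a) es p = f1 + f3" "psi ?W (glue d b) es p = f2 + f3"
      unfolding W by (rule v)+
    have "psi ?W (glue a b) es p = psi ?W (glue b a) es p"
      by (rule psi_cong) (auto simp: glue_def)
    then show "psi ?W (glue a b) es p = f2 + f1" unfolding W v by (simp add: add.commute)
    have "psi ?W (glue3 a d b) es p = psi ?W (glue3 b d a) es p"
      by (rule psi_cong) (auto simp: glue3_def)
    then show "psi ?W (glue3 a d b) es p = f4" unfolding W v .
  qed
qed

lemma represents_swap23:
  assumes "represents es a b d f p"
  shows "represents es a d b (st_swap23 f) p"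
proof -
  obtain f0 f1 f2 f3 f4 where f: "f = State f0 f1 f2 f3 f4" by (cases f)
  note v = representsD[OF assms[unfolded f]]
  let ?W = "{a, d, b} \<union> vset es"
  have W: "?W = {a, b, d} \<union> vset es" by auto
  show ?thesis
  proof (rule representsI[OF _ refl])
    show "st_swap23 f = State f0 f1 f3 f2 f4" by (simp add: f)
    show "psi ?W id es p = f0" "psi ?W (glue d a) es p = f1 + f3" "psi ?W (glue b a) es p = f1 + f2"
      unfolding W by (rule v)+
    have "psi ?W (glue b d) es p = psi ?W (glue d b) es p"
      by (rule psi_cong) (auto simp: glue_def)
    then show "psi ?W (glue b d) es p = f3 + f2" unfolding W v by (simp add: add.commute)
    have "psi ?W (glue3 d b a) es p = psi ?W (glue3 b d a) es p"
      by (rule psi_cong) (auto simp: glue3_def)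
    then show "psi ?W (glue3 d b a) es p = f4" unfolding W v .
  qed
qed

lemma represents_parallel:
  assumes "represents es a b d f (butlast p)" "a \<noteq> b" "a \<noteq> d" "b \<noteq> d"
  shows "represents ((a, b) # es) a b d (st_parallel (last p) f) p"
proof -
  obtain f0 f1 f2 f3 f4 where f: "f = State f0 f1 f2 f3 f4" by (cases f)
  note v = representsD[OF assms(1)[unfolded f]]
  let ?W = "{a, b, d} \<union> vset ((a, b) # es)"
  have W: "?W = {a, b, d} \<union> vset es" by auto
  have m: "psi ?W (merge id a b) es q = psi ?W (glue b a) es q"
     "psi ?W (merge (glue d b) a b) es q = psi ?W (glue3 b d a) es q"
     "psi ?W (merge (glue d a) a b) es q = psi ?W (glue3 b d a) es q" for q
    by (rule psi_cong; use assms in \<open>auto simp: glue_def glue3_def merge_def\<close>; fail)+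
  show ?thesis
  proof (rule representsI[OF _ refl])
    show "st_parallel (last p) f = State (last p * f0 + f1 + f2) (last p * f1) (last p * f2) (last p * f3 + f4) (last p * f4)"
      by (simp add: f)
    show "psi ?W id ((a, b) # es) p = last p * f0 + f1 + f2"
      unfolding psi.simps m unfolding W v using assms by (simp add: add.assoc)
    show "psi ?W (glue d b) ((a, b) # es) p = last p * f2 + (last p * f3 + f4)"
      unfolding psi.simps m unfolding W v using assms by (simp add: glue_def algebra_simps)
    show "psi ?W (glue d a) ((a, b) # es) p = last p * f1 + (last p * f3 + f4)"
      unfolding psi.simps m unfolding W v using assms by (simp add: glue_def algebra_simps)
    show "psi ?W (glue b a) ((a, b) # es) p = last p * f1 + last p * f2"
      unfolding psi.simps unfolding W v using assms by (simp add: glue_def algebra_simps)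
    show "psi ?W (glue3 b d a) ((a, b) # es) p = last p * f4"
      unfolding psi.simps unfolding W v using assms by (simp add: glue3_def)
  qed
qed

text \<open>
  The new vertex \<open>z\<close> is isolated. So the polynomials without an identification of \<open>z\<close> vanish, and
  identifying \<open>z\<close> with another vertex makes it disappear.
\<close>

lemma represents_forget:
  assumes "represents es a b d f q" "a \<noteq> b" "a \<noteq> d" "b \<noteq> d" "a \<in> vset es" "z \<notin> vset es \<union> {b, d}"
  shows "represents es z b d (st_forget f) q"
proof -
  obtain f0 f1 f2 f3 f4 where f: "f = State f0 f1 f2 f3 f4" by (cases f)
  note v = representsD[OF assms(1)[unfolded f]]
  let ?W = "{a, b, d} \<union> vset es" and ?W' = "{z, b, d} \<union> vset es"
  have sub: "id ` ?W \<subseteq> ?W'" using assms(5) by auto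
  show ?thesis
  proof (rule representsI[OF _ refl])
    show "st_forget f = State 0 f0 0 0 (f2 + f3)" by (simp add: f)
    show "psi ?W' id es q = 0"
      by (rule psi_isolated[of z _ b]) (use assms in auto)
    show "psi ?W' (glue d b) es q = 0 + 0"
      by (subst psi_isolated[of z _ b]) (use assms in \<open>auto simp: glue_def\<close>)
    have "psi ?W' (glue d z) es q = psi ?W id es q"
      by (rule psi_transfer[where r = id, OF _ sub, symmetric]) (use assms in \<open>auto simp: glue_def\<close>)
    then show "psi ?W' (glue d z) es q = f0 + 0" unfolding v by simp
    have "psi ?W' (glue b z) es q = psi ?W id es q"
      by (rule psi_transfer[where r = id, OF _ sub, symmetric]) (use assms in \<open>auto simp: glue_def\<close>)
    then show "psi ?W' (glue b z) es q = f0 + 0" unfolding v by simp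
    have "psi ?W' (glue3 b d z) es q = psi ?W (glue d b) es q"
      by (rule psi_transfer[where r = id, OF _ sub, symmetric]) (use assms in \<open>auto simp: glue_def glue3_def\<close>)
    then show "psi ?W' (glue3 b d z) es q = f2 + f3" unfolding v .
  qed
qed

lemma represents_series:
  assumes "represents es a b d f (butlast p)" "a \<noteq> b" "a \<noteq> d" "b \<noteq> d" "a \<in> vset es" "z \<notin> vset es \<union> {b, d}"
  shows "represents ((z, a) # es) z b d (st_series (last p) f) p"
proof -
  obtain f0 f1 f2 f3 f4 where f: "f = State f0 f1 f2 f3 f4" by (cases f)
  note v = representsD[OF assms(1)[unfolded f]]
  obtain g0 g1 g2 g3 g4 where g: "st_forget f = State g0 g1 g2 g3 g4" by (cases "st_forget f")
  note w = representsD[OF represents_forget[OF assms, unfolded g]]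
  have gs: "g0 = 0" "g1 = f0" "g2 = 0" "g3 = 0" "g4 = f2 + f3" using g by (simp_all add: f)
  let ?W = "{z, b, d} \<union> vset ((z, a) # es)"
  have W: "?W = {z, b, d} \<union> vset es" using assms by auto
  have az: "a \<noteq> z" using assms by auto
  have sub: "id ` ({a, b, d} \<union> vset es) \<subseteq> ?W" by auto
  have m: "psi ?W (merge id z a) es q = psi ({a, b, d} \<union> vset es) id es q"
    "psi ?W (merge (glue d b) z a) es q = psi ({a, b, d} \<union> vset es) (glue d b) es q"
    "psi ?W (merge (glue d z) z a) es q = psi ({a, b, d} \<union> vset es) (glue d a) es q"
    "psi ?W (merge (glue b z) z a) es q = psi ({a, b, d} \<union> vset es) (glue b a) es q"
    "psi ?W (merge (glue3 b d z) z a) es q = psi ({a, b, d} \<union> vset es) (glue3 b d a) es q" for q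
    by (rule psi_transfer[where r = id, OF _ sub, symmetric];
        use assms az in \<open>auto simp: glue_def glue3_def merge_def\<close>; fail)+
  show ?thesis
  proof (rule representsI[OF _ refl])
    show "st_series (last p) f = State f0 (f1 + last p * f0) f2 f3 (f4 + last p * (f2 + f3))"
      by (simp add: f)
    show "psi ?W id ((z, a) # es) p = f0"
      unfolding psi.simps m unfolding W v w gs using az by simp
    show "psi ?W (glue d b) ((z, a) # es) p = f2 + f3"
      unfolding psi.simps m unfolding W v w gs using az assms by (simp add: glue_def)
    show "psi ?W (glue d z) ((z, a) # es) p = f1 + last p * f0 + f3"
      unfolding psi.simps m unfolding W v w gs using az assms by (simp add: glue_def algebra_simps)
    show "psi ?W (glue b z) ((z, a) # es) p = f1 + last p * f0 + f2"
      unfolding psi.simps m unfolding W v w gs using az assms by (simp add: glue_def algebra_simps)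
    show "psi ?W (glue3 b d z) ((z, a) # es) p = f4 + last p * (f2 + f3)"
      unfolding psi.simps m unfolding W v w gs using az assms by (simp add: glue3_def algebra_simps)
  qed
qed

lemma represents_loop:
  assumes "represents es a b d f (butlast p)" "u \<in> {a, b, d} \<union> vset es"
  shows "represents ((u, u) # es) a b d (st_scale (last p) f) p"
proof -
  obtain f0 f1 f2 f3 f4 where f: "f = State f0 f1 f2 f3 f4" by (cases f)
  note v = representsD[OF assms(1)[unfolded f]]
  have W: "{a, b, d} \<union> vset ((u, u) # es) = {a, b, d} \<union> vset es" using assms(2) by auto
  show ?thesis
    by (rule representsI[OF _ refl, where ?f0.0 = "last p * f0" and ?f1.0 = "last p * f1" and ?f2.0 = "last p * f2"
          and ?f3.0 = "last p * f3" and ?f4.0 = "last p * f4"])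
       (simp_all only: W psi.simps v, simp_all add: f distrib_left)
qed

text \<open>
  A new edge to a vertex that is met by no other edge and is not marked lies in every spanning tree.
\<close>

lemma represents_bridge:
  assumes "represents es a b d f (butlast p)" "u \<in> {a, b, d} \<union> vset es" "z \<notin> {a, b, d} \<union> vset es"
  shows "represents ((u, z) # es) a b d f p"
proof -
  obtain f0 f1 f2 f3 f4 where f: "f = State f0 f1 f2 f3 f4" by (cases f)
  note v = representsD[OF assms(1)[unfolded f]]
  let ?W = "{a, b, d} \<union> vset es" and ?W' = "{a, b, d} \<union> vset ((u, z) # es)"
  have bridge: "psi ?W' c ((u, z) # es) p = psi ?W c es (butlast p)"
    if c: "\<And>x. x \<in> ?W \<Longrightarrow> c x \<in> ?W" "c z = z" for c
  proof -
    have ne: "c x \<noteq> z" if "x \<in> ?W" for x using c(1)[OF that] assms(3) by metis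
    have "psi ?W' c es (butlast p) = 0"
      by (rule psi_isolated[of z _ u]) (use assms(2) c(2) ne in auto)
    moreover have "psi ?W' (merge c u z) es (butlast p) = psi ?W c es (butlast p)"
    proof (rule psi_transfer[where r = id, symmetric])
      show "c x = c y \<longleftrightarrow> merge c u z (id x) = merge c u z (id y)" if "x \<in> ?W" "y \<in> ?W" for x y
        using ne[OF that(1)] ne[OF that(2)] c(2) by (auto simp: merge_def)
      show "\<exists>x\<in>?W. merge c u z y = merge c u z (id x)" if "y \<in> ?W'" for y
        using that assms(2) c(2) by (cases "y = z") (auto simp: merge_def intro: bexI[of _ u])
    qed auto
    ultimately show ?thesis using ne[OF assms(2)] c(2) by simp
  qed
  show ?thesis
  proof (rule representsI[OF f refl])
    show "psi ?W' id ((u, z) # es) p = f0" unfolding v[symmetric] by (rule bridge) auto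
    show "psi ?W' (glue d b) ((u, z) # es) p = f2 + f3" unfolding v[symmetric] by (rule bridge) (use assms(3) in \<open>auto simp: glue_def\<close>)
    show "psi ?W' (glue d a) ((u, z) # es) p = f1 + f3" unfolding v[symmetric] by (rule bridge) (use assms(3) in \<open>auto simp: glue_def\<close>)
    show "psi ?W' (glue b a) ((u, z) # es) p = f1 + f2" unfolding v[symmetric] by (rule bridge) (use assms(3) in \<open>auto simp: glue_def\<close>)
    show "psi ?W' (glue3 b d a) ((u, z) # es) p = f4" unfolding v[symmetric] by (rule bridge) (use assms(3) in \<open>auto simp: glue3_def\<close>)
  qed
qed

text \<open>
  Neither end of the new edge is marked or met by another edge, so the graph stays disconnected
  under all identifications.
\<close>

lemma represents_separate:
  fixes p :: "'a::comm_ring_1 list"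
  assumes "u \<notin> {a, b, d} \<union> vset es" "z \<notin> {a, b, d} \<union> vset es"
  shows "represents ((u, z) # es) a b d (State 0 0 0 0 0) p"
proof -
  let ?W' = "{a, b, d} \<union> vset ((u, z) # es)"
  have sep: "psi ?W' c ((u, z) # es) p = 0"
    if c: "\<And>x. x \<in> {a, b, d} \<union> vset es \<Longrightarrow> c x \<in> {a, b, d} \<union> vset es" "c z = z" "c u = u" for c
  proof -
    have nz: "c x \<noteq> z" "c x \<noteq> u" if "x \<in> {a, b, d} \<union> vset es" for x using c(1)[OF that] assms by metis+
    have "psi ?W' c es (butlast p) = 0"
      by (rule psi_isolated[of z _ a]) (use c(2) nz in auto)
    moreover have "psi ?W' (merge c u z) es (butlast p) = 0"
    proof (rule psi_isolated[of z _ a])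
      have mz: "merge c u z z = z" using c by (simp add: merge_def)
      have m: "merge c u z x = c x" if "x \<in> {a, b, d} \<union> vset es" for x
        using nz[OF that] c(3) by (simp add: merge_def)
      show "merge c u z z \<noteq> merge c u z a" using mz m[of a] nz[of a] by auto
      show "merge c u z w \<noteq> merge c u z z" if "w \<in> vset es" for w using mz m[of w] nz[of w] that by auto
    qed auto
    ultimately show ?thesis by simp
  qed
  show ?thesis
    by (rule representsI[OF refl refl]; subst sep) (use assms in \<open>auto simp: glue_def glue3_def\<close>)
qed

text \<open>
  A marked vertex without edges is only a placeholder.
\<close>

lemma represents_retarget:
  assumes "represents es a b d f p" "a \<noteq> b" "a \<noteq> d" "b \<noteq> d" "a \<notin> vset es" "z \<notin> vset es \<union> {b, d}"
  shows "represents es z b d f p"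
proof -
  obtain f0 f1 f2 f3 f4 where f: "f = State f0 f1 f2 f3 f4" by (cases f)
  note v = representsD[OF assms(1)[unfolded f]]
  let ?W = "{a, b, d} \<union> vset es" and ?W' = "{z, b, d} \<union> vset es"
  let ?r = "\<lambda>x. if x = a then z else x"
  have sub: "?r ` ?W \<subseteq> ?W'" by auto
  have m: "psi ?W' id es p = psi ?W id es p" "psi ?W' (glue d b) es p = psi ?W (glue d b) es p"
    "psi ?W' (glue d z) es p = psi ?W (glue d a) es p" "psi ?W' (glue b z) es p = psi ?W (glue b a) es p"
    "psi ?W' (glue3 b d z) es p = psi ?W (glue3 b d a) es p"
    by (rule psi_transfer[where r = ?r, OF _ sub, symmetric];
        use assms in \<open>auto simp: glue_def glue3_def\<close>; fail)+
  show ?thesis by (rule representsI[OF f refl]) (simp_all only: m v)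
qed

lemma represents_init:
  fixes p :: "'a::comm_ring_1 list"
  assumes "a \<noteq> b" "a \<noteq> d" "b \<noteq> d"
  shows "represents [] a b d (State 0 0 0 0 1) p"
  using assms by (auto simp: Let_def glue_def glue3_def)

section \<open>Three slots for the boundary vertices\<close>

text \<open>
  The state depends on the order of the marked vertices, but whether a family of states is good does
  not. So the order can be left open.
\<close>

definition repr :: "'k::field itself \<Rightarrow> ('w \<times> 'w) list \<Rightarrow> 'w set \<Rightarrow> bool" where
  "repr K es S \<longleftrightarrow> card S = 3 \<and> (\<forall>a b d. S = {a, b, d} \<longrightarrow>
     (\<exists>F :: 'k alg_closure list \<Rightarrow> 'k alg_closure state. good (length es) F \<and>
        (\<forall>p. length p = length es \<longrightarrow> represents es a b d (F p) p)))"

lemma card3D: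
  assumes "card {a, b, d} = 3"
  shows "a \<noteq> b" "a \<noteq> d" "b \<noteq> d"
  using assms by (auto simp: card_insert_if split: if_splits)

text \<open>
  Two transpositions generate all permutations of the marked vertices.
\<close>

lemma reprI:
  fixes F :: "'k::field alg_closure list \<Rightarrow> 'k alg_closure state"
  assumes "a \<noteq> b" "a \<noteq> d" "b \<noteq> d" "good (length es) F"
    "\<And>p. length p = length es \<Longrightarrow> represents es a b d (F p) p"
  shows "repr TYPE('k) es {a, b, d}"
proof -
  let ?P = "\<lambda>a b d. \<exists>F :: 'k alg_closure list \<Rightarrow> 'k alg_closure state. good (length es) F \<and>
        (\<forall>p. length p = length es \<longrightarrow> represents es a b d (F p) p)"
  have 0: "?P a b d" using assms(4,5) by blast
  have s12: "?P b a d" if "?P a b d" for a b d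
    using that represents_swap12 good_swap12 by metis
  have s23: "?P a d b" if "?P a b d" for a b d
    using that represents_swap23 good_swap23 by metis
  have all: "?P a b d" "?P b a d" "?P a d b" "?P b d a" "?P d a b" "?P d b a"
    using 0 s12[OF 0] s23[OF 0] s23[OF s12[OF 0]] s12[OF s23[OF 0]] s12[OF s23[OF s12[OF 0]]] by blast+
  have "?P a' b' d'" if eq: "{a, b, d} = {a', b', d'}" for a' b' d'
  proof -
    have "card {a', b', d'} = 3" using assms(1-3) unfolding eq[symmetric] by simp
    note ne = card3D[OF this]
    have "a' \<in> {a, b, d}" "b' \<in> {a, b, d}" "d' \<in> {a, b, d}" unfolding eq by auto
    then consider "a' = a \<and> b' = b \<and> d' = d" | "a' = b \<and> b' = a \<and> d' = d" | "a' = a \<and> b' = d \<and> d' = b"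
      | "a' = b \<and> b' = d \<and> d' = a" | "a' = d \<and> b' = a \<and> d' = b" | "a' = d \<and> b' = b \<and> d' = a"
      using ne by auto
    then show ?thesis using all by cases blast+
  qed
  then show ?thesis unfolding repr_def using assms(1-3) by simp
qed

lemma reprE:
  assumes "repr TYPE('k::field) es S" "a \<in> S"
  obtains b d and F :: "'k::field alg_closure list \<Rightarrow> 'k alg_closure state" where "S = {a, b, d}" "a \<noteq> b" "a \<noteq> d" "b \<noteq> d"
    "good (length es) F" "\<forall>p. length p = length es \<longrightarrow> represents es a b d (F p) p"
proof -
  have S: "card S = 3" using assms(1) unfolding repr_def by blast
  then have "card (S - {a}) = 2" using assms(2) by (simp add: card_Diff_singleton)
  then obtain b d where bd: "S - {a} = {b, d}" "b \<noteq> d" by (auto simp: card_2_iff)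
  then have Sabd: "S = {a, b, d}" using assms(2) by auto
  moreover have "a \<noteq> b" "a \<noteq> d" using bd by auto
  moreover obtain F :: "'k alg_closure list \<Rightarrow> 'k alg_closure state" where
    "good (length es) F" "\<forall>p. length p = length es \<longrightarrow> represents es a b d (F p) p"
    using assms(1) Sabd unfolding repr_def by blast
  ultimately show thesis using that bd(2) by blast
qed

lemma reprE2:
  assumes "repr TYPE('k::field) es S" "a \<in> S" "b \<in> S" "a \<noteq> b"
  obtains d and F :: "'k::field alg_closure list \<Rightarrow> 'k alg_closure state" where "S = {a, b, d}" "a \<noteq> d" "b \<noteq> d"
    "good (length es) F" "\<forall>p. length p = length es \<longrightarrow> represents es a b d (F p) p"
proof -
  have S: "card S = 3" using assms(1) unfolding repr_def by blast
  then have "card (S - {a, b}) = 1" using assms by (subst card_Diff_subset) auto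
  then obtain d where d: "S - {a, b} = {d}" by (auto simp: card_1_singleton_iff)
  then have Sabd: "S = {a, b, d}" using assms by auto
  moreover have "a \<noteq> d" "b \<noteq> d" using d by auto
  moreover obtain F :: "'k alg_closure list \<Rightarrow> 'k alg_closure state" where
    "good (length es) F" "\<forall>p. length p = length es \<longrightarrow> represents es a b d (F p) p"
    using assms(1) Sabd unfolding repr_def by blast
  ultimately show thesis using that by blast
qed

lemma repr_card: "repr K es S \<Longrightarrow> card S = 3"
  by (simp add: repr_def)

lemma repr_init: "card S = 3 \<Longrightarrow> repr TYPE('k::field) [] S"
proof -
  assume "card S = 3"
  then obtain a b d where S: "S = {a, b, d}" "a \<noteq> b" "a \<noteq> d" "b \<noteq> d" by (auto simp: card_3_iff)
  show ?thesis unfolding S(1)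
  proof (rule reprI[OF S(2-4)])
    show "good (length []) (\<lambda>_. State 0 0 0 0 (1 :: 'k alg_closure))" using good_init by simp
    show "represents [] a b d (State 0 0 0 0 (1 :: 'k alg_closure)) p" for p
      by (rule represents_init[OF S(2-4)])
  qed
qed

lemma repr_replace:
  fixes F' :: "('k::field alg_closure list \<Rightarrow> 'k alg_closure state) \<Rightarrow> 'k alg_closure list \<Rightarrow> 'k alg_closure state"
  assumes R: "repr TYPE('k) es S" and a: "a \<in> S" and z: "z \<notin> S - {a}"
    and good: "\<And>F. good (length es) F \<Longrightarrow> good (length es') (F' F)"
    and rep: "\<And>F b d p. S = {a, b, d} \<Longrightarrow> a \<noteq> b \<Longrightarrow> a \<noteq> d \<Longrightarrow> b \<noteq> d \<Longrightarrow>
      (\<And>p. length p = length es \<Longrightarrow> represents es a b d (F p) p) \<Longrightarrow>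
      length p = length es' \<Longrightarrow> represents es' z b d (F' F p) p"
  shows "repr TYPE('k) es' (insert z (S - {a}))"
proof -
  obtain b d and F :: "'k alg_closure list \<Rightarrow> 'k alg_closure state" where F: "S = {a, b, d}" "a \<noteq> b" "a \<noteq> d" "b \<noteq> d"
    "good (length es) F" "\<forall>p. length p = length es \<longrightarrow> represents es a b d (F p) p"
    by (rule reprE[OF R a])
  have "z \<noteq> b" "z \<noteq> d" using z F(1-4) by auto
  then have "repr TYPE('k) es' {z, b, d}"
    by (rule reprI[OF _ _ F(4) good[OF F(5)] rep[OF F(1-4)]]) (use F(6) in auto)
  moreover have "insert z (S - {a}) = {z, b, d}" using F(1-4) by auto
  ultimately show ?thesis by simp
qed

lemma repr_retarget:
  assumes "repr TYPE('k::field) es S" "a \<in> S" "a \<notin> vset es" "z \<notin> vset es \<union> S"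
  shows "repr TYPE('k) es (insert z (S - {a}))"
  by (rule repr_replace[OF assms(1,2), where F' = "\<lambda>F. F"])
     (use assms in \<open>auto intro: represents_retarget\<close>)

lemma repr_forget:
  assumes "repr TYPE('k::field) es S" "a \<in> S" "a \<in> vset es" "z \<notin> vset es \<union> S"
  shows "repr TYPE('k) es (insert z (S - {a}))"
  by (rule repr_replace[OF assms(1,2), where F' = "\<lambda>F p. st_forget (F p)"])
     (use assms in \<open>auto intro: represents_forget good_forget\<close>)

lemma repr_series:
  assumes "repr TYPE('k::field) es S" "a \<in> S" "a \<in> vset es" "z \<notin> vset es \<union> S"
  shows "repr TYPE('k) ((z, a) # es) (insert z (S - {a}))"
  by (rule repr_replace[OF assms(1,2), where F' = "\<lambda>F p. st_series (last p) (F (butlast p))"])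
     (use assms in \<open>auto intro!: represents_series good_series_op\<close>)

lemma repr_keep:
  fixes F' :: "('k::field alg_closure list \<Rightarrow> 'k alg_closure state) \<Rightarrow> 'k alg_closure list \<Rightarrow> 'k alg_closure state"
  assumes R: "repr TYPE('k) es S"
    and good: "\<And>F. good (length es) F \<Longrightarrow> good (length es') (F' F)"
    and rep: "\<And>F a b d p. S = {a, b, d} \<Longrightarrow>
      (\<And>p. length p = length es \<Longrightarrow> represents es a b d (F p) p) \<Longrightarrow>
      length p = length es' \<Longrightarrow> represents es' a b d (F' F p) p"
  shows "repr TYPE('k) es' S"
proof -
  have "S \<noteq> {}" using repr_card[OF R] by auto
  then obtain a where a: "a \<in> S" by blast
  have "repr TYPE('k) es' (insert a (S - {a}))"
    by (rule repr_replace[OF R a _ good]) (use rep in auto)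
  then show ?thesis using a by (simp add: insert_absorb)
qed

lemma repr_parallel:
  assumes "repr TYPE('k::field) es S" "a \<in> S" "b \<in> S" "a \<noteq> b"
  shows "repr TYPE('k) ((a, b) # es) S"
proof -
  obtain d and F :: "'k alg_closure list \<Rightarrow> 'k alg_closure state" where F: "S = {a, b, d}" "a \<noteq> d" "b \<noteq> d"
    "good (length es) F" "\<forall>p. length p = length es \<longrightarrow> represents es a b d (F p) p"
    by (rule reprE2[OF assms])
  show ?thesis unfolding F(1)
  proof (rule reprI[OF assms(4) F(2,3)])
    show "good (length ((a, b) # es)) (\<lambda>y. st_parallel (last y) (F (butlast y)))" using good_parallel[OF F(4)] by simp
    fix p :: "'k alg_closure list" assume "length p = length ((a, b) # es)"
    then have "represents es a b d (F (butlast p)) (butlast p)" using F(5) by simp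
    then show "represents ((a, b) # es) a b d (st_parallel (last p) (F (butlast p))) p" by (rule represents_parallel) (use F(2,3) assms(4) in simp_all)
  qed
qed

lemma repr_loop:
  assumes "repr TYPE('k::field) es S" "u \<in> S \<union> vset es"
  shows "repr TYPE('k) ((u, u) # es) S"
  by (rule repr_keep[OF assms(1), where F' = "\<lambda>F p. st_scale (last p) (F (butlast p))"])
     (use assms(2) in \<open>auto intro!: represents_loop good_scale\<close>)

lemma repr_bridge:
  assumes "repr TYPE('k::field) es S" "u \<in> S \<union> vset es" "z \<notin> S \<union> vset es"
  shows "repr TYPE('k) ((u, z) # es) S"
  by (rule repr_keep[OF assms(1), where F' = "\<lambda>F p. F (butlast p)"])
     (use assms(2,3) in \<open>auto intro!: represents_bridge good_constant\<close>)

lemma repr_separate: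
  assumes "repr TYPE('k::field) es S" "u \<notin> S \<union> vset es" "z \<notin> S \<union> vset es"
  shows "repr TYPE('k) ((u, z) # es) S"
proof (rule repr_keep[OF assms(1), where F' = "\<lambda>F p. State 0 0 0 0 0"])
  fix F :: "'k alg_closure list \<Rightarrow> 'k alg_closure state" assume F: "good (length es) F"
  \<comment> \<open>The zero state arises by making two vertices inner without connecting them.\<close>
  have "st_forget (st_forget f) = State 0 0 0 0 0" for f :: "'k alg_closure state" by (cases f) simp
  with good_constant[OF good_forget[OF good_forget[OF F]]]
  show "good (length ((u, z) # es)) (\<lambda>y. State 0 0 0 0 (0 :: 'k alg_closure))" by simp
next
  fix a b d and p :: "'k alg_closure list" assume "S = {a, b, d}"
  then show "represents ((u, z) # es) a b d (State 0 0 0 0 0) p"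
    by (intro represents_separate) (use assms(2,3) in auto)
qed

lemma repr_swap_edge:
  assumes "repr TYPE('k::field) ((u, v) # es) S"
  shows "repr TYPE('k) ((v, u) # es) S"
proof -
  have W: "{a, b, d} \<union> vset ((v, u) # es) = {a, b, d} \<union> vset ((u, v) # es)" for a b d by auto
  have "represents ((v, u) # es) a b d f p \<longleftrightarrow> represents ((u, v) # es) a b d f p" for a b d p and f :: "'k alg_closure state"
    by (cases f) (simp only: represents.simps Let_def W psi_swap_edge[of u v es "{a, b, d} \<union> vset ((u, v) # es)"] Un_upper2)
  then show ?thesis using assms unfolding repr_def by simp
qed

text \<open>
  With \<open>P\<close> the set of vertices of the edges still to be added, the marked vertices comprise the
  boundary vertices, which are common to \<open>P\<close> and the edges already present. The other slots are
  occupied by vertices that are not met by these edges.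
\<close>

definition slots :: "'k::field itself \<Rightarrow> ('w \<times> 'w) list \<Rightarrow> 'w set \<Rightarrow> 'w set \<Rightarrow> bool" where
  "slots K es P S \<longleftrightarrow> repr K es S \<and> S \<inter> vset es = P \<inter> vset es"

lemma slots_finite: "slots K es P S \<Longrightarrow> finite S"
  unfolding slots_def using repr_card card.infinite by (metis zero_neq_numeral)

text \<open>
  Placeholders can be moved away from any finite set of vertices.
\<close>

lemma slots_avoid:
  assumes "slots TYPE('k::field) es P S" "finite A" "infinite (UNIV :: 'w set)"
  obtains S' where "slots TYPE('k) es P S'" "\<And>x :: 'w. x \<in> S' \<Longrightarrow> x \<in> A \<Longrightarrow> x \<in> vset es"
proof -
  have "\<exists>S'. slots TYPE('k) es P S' \<and> (S' - vset es) \<inter> A = {}"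
    using assms(1)
  proof (induction "card ((S - vset es) \<inter> A)" arbitrary: S)
    case 0
    then have "(S - vset es) \<inter> A = {}" using slots_finite[OF 0(2)] by simp
    then show ?case using 0 by blast
  next
    case (Suc k)
    then have "(S - vset es) \<inter> A \<noteq> {}" by auto
    then obtain a where a: "a \<in> S" "a \<notin> vset es" "a \<in> A" by blast
    have fS: "finite S" by (rule slots_finite[OF Suc.prems])
    obtain z where z: "z \<notin> vset es \<union> S \<union> A"
      using ex_new_if_finite[OF assms(3), of "vset es \<union> S \<union> A"] fS assms(2) by auto
    have "repr TYPE('k) es (insert z (S - {a}))"
      by (rule repr_retarget) (use Suc.prems a z in \<open>auto simp: slots_def\<close>)
    then have *: "slots TYPE('k) es P (insert z (S - {a}))"
      using Suc.prems a z unfolding slots_def by auto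
    have "(insert z (S - {a}) - vset es) \<inter> A = (S - vset es) \<inter> A - {a}" using z by auto
    moreover have "card \<dots> = k" using Suc.hyps(2) a fS by (simp add: card_Diff_singleton)
    ultimately show ?case using Suc.hyps(1)[OF _ *] by simp
  qed
  then show thesis using that by blast
qed

lemma repr_free_slot:
  assumes "repr K es S" "card (S \<inter> V) \<le> 2"
  obtains a where "a \<in> S" "a \<notin> V"
proof -
  have "S \<inter> V \<noteq> S" using assms repr_card[OF assms(1)] by auto
  then show thesis using that by blast
qed

text \<open>
  A marked vertex that is not on the boundary any more is forgotten.
\<close>

lemma slots_remove:
  assumes r: "repr TYPE('k::field) es S" and sub: "P \<inter> vset es \<subseteq> S" and inf: "infinite (UNIV :: 'w set)"
  shows "\<exists>S' :: 'w set. slots TYPE('k) es P S'"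
  using assms(1,2)
proof (induction "card (S \<inter> vset es - P)" arbitrary: S)
  case 0
  have "finite S" using repr_card[OF 0(2)] by (metis card.infinite zero_neq_numeral)
  then have "S \<inter> vset es - P = {}" using 0(1) by simp
  then have "slots TYPE('k) es P S" using 0 unfolding slots_def by auto
  then show ?case by blast
next
  case (Suc k)
  have fS: "finite S" using repr_card[OF Suc.prems(1)] by (metis card.infinite zero_neq_numeral)
  have "S \<inter> vset es - P \<noteq> {}" using Suc.hyps(2) by (metis Zero_not_Suc card.empty)
  then obtain a where a: "a \<in> S" "a \<in> vset es" "a \<notin> P" by blast
  obtain z where z: "z \<notin> vset es \<union> S" using ex_new_if_finite[OF inf, of "vset es \<union> S"] fS by auto
  have 1: "repr TYPE('k) es (insert z (S - {a}))"
    by (rule repr_forget[OF Suc.prems(1) a(1,2) z])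
  have "insert z (S - {a}) \<inter> vset es - P = (S \<inter> vset es - P) - {a}" using z by auto
  moreover have "card \<dots> = k" using Suc.hyps(2) a fS by (simp add: card_Diff_singleton)
  ultimately show ?case using Suc.hyps(1)[OF _ 1] Suc.prems(2) a by auto
qed

text \<open>
  An end of the new edge that is on the new boundary and has no slot yet takes that of a
  placeholder, which exists because the new boundary has at most three vertices, or that of the
  other end if this one leaves the boundary (series). An end that is not marked and not on the new
  boundary needs no slot (bridge, separate).
\<close>

lemma repr_add_edge:
  assumes S: "slots TYPE('k::field) es (P \<union> {u, v}) S" and card: "card (P \<inter> vset ((u, v) # es)) \<le> 3"
    and avoid: "\<And>x. x \<in> S \<Longrightarrow> x \<in> {u, v} \<Longrightarrow> x \<in> vset es"
    and order: "u \<in> vset es \<Longrightarrow> v \<in> vset es"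
  shows "\<exists>S'. repr TYPE('k) ((u, v) # es) S' \<and> P \<inter> vset ((u, v) # es) \<subseteq> S'"
proof -
  let ?V = "vset es"
  have R: "repr TYPE('k) es S" and SV: "S \<inter> ?V = (P \<union> {u, v}) \<inter> ?V" using S by (auto simp: slots_def)
  have PV: "P \<inter> ?V \<subseteq> S" using SV by auto
  have fS: "finite S" by (rule slots_finite[OF S])
  show ?thesis
  proof (cases "u \<in> ?V")
    case True
    then have uv: "u \<in> ?V" "v \<in> ?V" using order by auto
    then have "u \<in> S" "v \<in> S" using SV by auto
    then have "repr TYPE('k) ((u, v) # es) S"
      using repr_parallel[OF R] repr_loop[OF R, of u] by (cases "u = v") auto
    moreover have "P \<inter> vset ((u, v) # es) \<subseteq> S" using uv PV by auto
    ultimately show ?thesis by blast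
  next
    case u: False
    then have uS: "u \<notin> S" using avoid by auto
    show ?thesis
    proof (cases "v \<in> ?V")
      case v: True
      then have vS: "v \<in> S" using SV by auto
      have uv: "u \<noteq> v" using u v by auto
      show ?thesis
      proof (cases "u \<in> P")
        case False
        have "repr TYPE('k) ((u, v) # es) S"
          by (rule repr_swap_edge[OF repr_bridge[OF R]]) (use v u uS in auto)
        moreover have "P \<inter> vset ((u, v) # es) \<subseteq> S" using False v PV by auto
        ultimately show ?thesis by blast
      next
        case uP: True
        show ?thesis
        proof (cases "v \<in> P")
          case False
          have "repr TYPE('k) ((u, v) # es) (insert u (S - {v}))"
            by (rule repr_series[OF R vS v]) (use u uS in auto)
          moreover have "P \<inter> vset ((u, v) # es) \<subseteq> insert u (S - {v})" using False v PV by auto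
          ultimately show ?thesis by blast
        next
          case vP: True
          have "P \<inter> vset ((u, v) # es) = insert u (S \<inter> ?V)" using uP vP v u SV by auto
          then have "card (S \<inter> ?V) \<le> 2" using card u fS by simp
          then obtain a where a: "a \<in> S" "a \<notin> ?V" using repr_free_slot[OF R] by blast
          have "repr TYPE('k) es (insert u (S - {a}))"
            by (rule repr_retarget[OF R a]) (use u uS in auto)
          then have "repr TYPE('k) ((u, v) # es) (insert u (S - {a}))"
            by (rule repr_parallel) (use vS v a uv in auto)
          moreover have "P \<inter> vset ((u, v) # es) \<subseteq> insert u (S - {a})" using v PV a by auto
          ultimately show ?thesis by blast
        qed
      qed
    next
      case v: False
      then have vS: "v \<notin> S" using avoid by auto
      have SPV: "S \<inter> ?V = P \<inter> ?V" using SV u v by auto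
      show ?thesis
      proof (cases "u \<in> P \<and> v \<in> P")
        case False
        show ?thesis
        proof (cases "u \<in> P \<or> v \<in> P")
          case False
          have "repr TYPE('k) ((u, v) # es) S"
            by (rule repr_separate[OF R]) (use u v uS vS in auto)
          moreover have "P \<inter> vset ((u, v) # es) \<subseteq> S" using False PV by auto
          ultimately show ?thesis by blast
        next
          case True
          define w z where "w = (if u \<in> P then u else v)" and "z = (if u \<in> P then v else u)"
          have wz: "w \<in> P" "z \<notin> P" "w \<notin> ?V" "z \<notin> ?V" "w \<notin> S" "z \<notin> S" "{w, z} = {u, v}" "w \<noteq> z"
            using True False u v uS vS by (auto simp: w_def z_def)
          have "P \<inter> vset ((u, v) # es) = insert w (S \<inter> ?V)" using wz SPV by auto
          then have "card (S \<inter> ?V) \<le> 2" using card wz fS by simp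
          then obtain a where a: "a \<in> S" "a \<notin> ?V" using repr_free_slot[OF R] by blast
          have "repr TYPE('k) es (insert w (S - {a}))"
            by (rule repr_retarget[OF R a]) (use wz in auto)
          then have "repr TYPE('k) ((w, z) # es) (insert w (S - {a}))"
            by (rule repr_bridge) (use wz in auto)
          then have "repr TYPE('k) ((u, v) # es) (insert w (S - {a}))"
            using repr_swap_edge[of z w] repr_swap_edge[of w z] wz(7,8) by (auto simp: doubleton_eq_iff)
          moreover have "P \<inter> vset ((u, v) # es) \<subseteq> insert w (S - {a})" using PV a wz by auto
          ultimately show ?thesis by blast
        qed
      next
        case uvP: True
        show ?thesis
        proof (cases "u = v")
          case True
          have "P \<inter> vset ((u, v) # es) = insert u (S \<inter> ?V)" using uvP True SPV by auto
          then have "card (S \<inter> ?V) \<le> 2" using card u fS by simp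
          then obtain a where a: "a \<in> S" "a \<notin> ?V" using repr_free_slot[OF R] by blast
          have "repr TYPE('k) es (insert u (S - {a}))"
            by (rule repr_retarget[OF R a]) (use u uS in auto)
          then have "repr TYPE('k) ((u, u) # es) (insert u (S - {a}))"
            by (rule repr_loop) simp
          moreover have "P \<inter> vset ((u, v) # es) \<subseteq> insert u (S - {a})" using True PV a by auto
          ultimately show ?thesis using True by blast
        next
          case False
          have "P \<inter> vset ((u, v) # es) = insert u (insert v (S \<inter> ?V))" using uvP SPV by auto
          then have c: "card (S \<inter> ?V) \<le> 1" using card u v fS False by simp
          then have "card (S \<inter> ?V) \<le> 2" by simp
          then obtain a where a: "a \<in> S" "a \<notin> ?V" using repr_free_slot[OF R] by blast
          have "S \<inter> (insert a ?V) = insert a (S \<inter> ?V)" using a by auto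
          then have "card (S \<inter> (insert a ?V)) \<le> 2" using c fS by (simp add: card_insert_if)
          then obtain a' where a': "a' \<in> S" "a' \<notin> insert a ?V" using repr_free_slot[OF R] by blast
          have "repr TYPE('k) es (insert u (S - {a}))"
            by (rule repr_retarget[OF R a]) (use u uS in auto)
          then have "repr TYPE('k) es (insert v (insert u (S - {a}) - {a'}))"
            by (rule repr_retarget) (use a a' v vS False in auto)
          then have "repr TYPE('k) ((u, v) # es) (insert v (insert u (S - {a}) - {a'}))"
            by (rule repr_parallel) (use False a' uS in auto)
          moreover have "P \<inter> vset ((u, v) # es) \<subseteq> insert v (insert u (S - {a}) - {a'})" using PV a a' uS by auto
          ultimately show ?thesis by blast
        qed
      qed
    qed
  qed
qed

lemma slots_step:
  fixes u v :: 'w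
  assumes S: "slots TYPE('k::field) es (P \<union> {u, v}) S" and card: "card (P \<inter> vset ((u, v) # es)) \<le> 3"
    and inf: "infinite (UNIV :: 'w set)"
  shows "\<exists>S'. slots TYPE('k) ((u, v) # es) P S'"
proof -
  obtain S0 where S0: "slots TYPE('k) es (P \<union> {u, v}) S0" and av: "\<And>x. x \<in> S0 \<Longrightarrow> x \<in> {u, v} \<Longrightarrow> x \<in> vset es"
    using slots_avoid[OF S, of "{u, v}"] inf by auto
  have "\<exists>S'. repr TYPE('k) ((u, v) # es) S' \<and> P \<inter> vset ((u, v) # es) \<subseteq> S'"
  proof (cases "u \<notin> vset es \<or> v \<in> vset es")
    case True
    then show ?thesis using repr_add_edge[OF S0 card av] by blast
  next
    case False
    have S0': "slots TYPE('k) es (P \<union> {v, u}) S0" using S0 by (simp add: insert_commute)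
    have "card (P \<inter> vset ((v, u) # es)) \<le> 3" using card by (simp add: insert_commute)
    from repr_add_edge[OF S0' this] av False
    obtain S' where "repr TYPE('k) ((v, u) # es) S'" "P \<inter> vset ((v, u) # es) \<subseteq> S'" by blast
    then show ?thesis using repr_swap_edge[of v u es S'] by (auto simp: insert_commute)
  qed
  then show ?thesis using slots_remove[OF _ _ inf] by blast
qed

section \<open>Joining vertices and closing cycles by one more edge\<close>

lemma walk_verts:
  assumes "walk G F u es v" "\<forall>e\<in>F. ends G e \<subseteq> verts G"
  shows "u \<in> verts G" "v \<in> verts G"
  using assms by (induction) auto

lemma walk_mono: "walk G F u es v \<Longrightarrow> F \<subseteq> F' \<Longrightarrow> walk G F' u es v"
  by (induction rule: walk.induct) (auto intro: walk.intros)

lemma walk_append: "walk G F u es v \<Longrightarrow> walk G F v fs w \<Longrightarrow> walk G F u (es @ fs) w"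
  by (induction rule: walk.induct) (auto intro: walk.intros)

lemma walk_edges: "walk G F u es v \<Longrightarrow> set es \<subseteq> F"
  by (induction rule: walk.induct) auto

lemma walk_restrict: "walk G F u es v \<Longrightarrow> set es \<subseteq> F' \<Longrightarrow> walk G F' u es v"
  by (induction rule: walk.induct) (auto intro: walk.intros)

lemma walk_rev:
  assumes "walk G F u es v" "\<forall>e\<in>F. ends G e \<subseteq> verts G"
  shows "walk G F v (rev es) u"
  using assms
proof (induction rule: walk.induct)
  case (Nil u)
  then show ?case by (auto intro: walk.Nil)
next
  case (Cons e u v es w)
  have "walk G F v [e] u"
    using Cons.hyps Cons.prems by (intro walk.Cons[of e F G v u] walk.Nil) (auto simp: insert_commute)
  then show ?case using Cons.IH[OF Cons.prems] walk_append by fastforce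
qed

lemma walk_split:
  "walk G F u (as @ bs) v \<Longrightarrow> \<forall>e\<in>F. ends G e \<subseteq> verts G \<Longrightarrow> \<exists>w. walk G F u as w \<and> walk G F w bs v"
proof (induction as arbitrary: u)
  case Nil
  then have "u \<in> verts G" using walk_verts(1)[of G F u bs v] by simp
  then show ?case using Nil by (auto intro: walk.Nil)
next
  case (Cons a as)
  from Cons.prems(1) obtain x where x: "a \<in> F" "ends G a = {u, x}" "walk G F x (as @ bs) v"
    by (auto elim: walk.cases)
  from Cons.IH[OF x(3) Cons.prems(2)] obtain w where "walk G F x as w" "walk G F w bs v" by blast
  then show ?case using x by (auto intro: walk.Cons)
qed

text \<open>
  Cycles are closed walks without repeated edges. A repeated edge is cut out together with the part
  of the walk in between; since the edge may be traversed in either direction, one copy of it may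
  have to stay.
\<close>

lemma walk_distinct:
  assumes "walk G F u es v" "\<forall>e\<in>F. ends G e \<subseteq> verts G"
  shows "\<exists>fs. walk G F u fs v \<and> distinct fs \<and> set fs \<subseteq> set es"
  using assms(1)
proof (induction "length es" arbitrary: u es rule: less_induct)
  case less
  show ?case
  proof (cases es)
    case Nil
    then show ?thesis using less.prems by (intro exI[of _ "[]"]) auto
  next
    case (Cons e es')
    from less.prems obtain x where x: "e \<in> F" "ends G e = {u, x}" "walk G F x es' v"
      unfolding Cons by (auto elim: walk.cases)
    from less.hyps[OF _ x(3)] Cons obtain fs where fs: "walk G F x fs v" "distinct fs" "set fs \<subseteq> set es'" by auto
    show ?thesis
    proof (cases "e \<in> set fs")
      case False
      have "walk G F u (e # fs) v" by (rule walk.Cons[OF x(1,2) fs(1)])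
      then show ?thesis using fs False Cons by (intro exI[of _ "e # fs"]) auto
    next
      case True
      then obtain as bs where ab: "fs = as @ e # bs" by (auto simp: in_set_conv_decomp)
      obtain w where w: "walk G F w (e # bs) v" using walk_split[of G F x as "e # bs" v] fs(1) ab assms(2) by blast
      then obtain y where y: "ends G e = {w, y}" "walk G F y bs v" by (auto elim: walk.cases)
      have "u = w \<or> u = y" using x(2) y(1) by (auto simp: doubleton_eq_iff)
      then have "walk G F u (e # bs) v \<or> walk G F u bs v" using w y(2) by blast
      moreover have "distinct (e # bs)" "set (e # bs) \<subseteq> set es" using fs ab Cons by auto
      ultimately show ?thesis by (metis distinct.simps(2) dual_order.trans set_subset_Cons)
    qed
  qed
qed

definition joined :: "('v, 'e) multigraph \<Rightarrow> 'e set \<Rightarrow> 'v \<Rightarrow> 'v \<Rightarrow> bool" where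
  "joined G F x y \<longleftrightarrow> (\<exists>es. walk G F x es y)"

context
  fixes G :: "('v, 'e) multigraph" and t h :: "'e \<Rightarrow> 'v"
  assumes ends: "\<And>e. e \<in> edges G \<Longrightarrow> ends G e = {t e, h e}"
    and ends_verts: "\<And>e. e \<in> edges G \<Longrightarrow> ends G e \<subseteq> verts G"
begin

lemma ends_verts': "F \<subseteq> edges G \<Longrightarrow> \<forall>e\<in>F. ends G e \<subseteq> verts G"
  using ends_verts by blast

lemma joined_refl: "x \<in> verts G \<Longrightarrow> joined G F x x"
  unfolding joined_def by (blast intro: walk.Nil)

lemma joined_sym: "F \<subseteq> edges G \<Longrightarrow> joined G F x y \<Longrightarrow> joined G F y x"
  unfolding joined_def using walk_rev ends_verts' by metis

lemma joined_trans: "joined G F x y \<Longrightarrow> joined G F y z \<Longrightarrow> joined G F x z"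
  unfolding joined_def using walk_append by metis

text \<open>
  A walk with the new edge \<open>e\<close> is cut at its uses of \<open>e\<close>.
\<close>

lemma joined_insert:
  assumes F: "F \<subseteq> edges G" and e: "e \<in> edges G" and x: "x \<in> verts G" and y: "y \<in> verts G"
  shows "joined G (insert e F) x y \<longleftrightarrow> joined G F x y \<or> (joined G F x (t e) \<and> joined G F (h e) y)
     \<or> (joined G F x (h e) \<and> joined G F (t e) y)"
proof
  have te: "t e \<in> verts G" "h e \<in> verts G" using ends[OF e] ends_verts[OF e] by auto
  have eF: "insert e F \<subseteq> edges G" using F e by simp
  assume "joined G (insert e F) x y"
  then obtain es where "walk G (insert e F) x es y" unfolding joined_def by blast
  then show "joined G F x y \<or> (joined G F x (t e) \<and> joined G F (h e) y) \<or> (joined G F x (h e) \<and> joined G F (t e) y)"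
  proof (induction rule: walk.induct)
    case (Nil u)
    then show ?case using joined_refl by blast
  next
    case (Cons a u v es w)
    have v: "v \<in> verts G" using walk_verts(1)[OF Cons.hyps(3) ends_verts'[OF eF]] .
    show ?case
    proof (cases "a \<in> F")
      case True
      then have "joined G F u v"
        unfolding joined_def using Cons.hyps(2) v by (blast intro: walk.Cons walk.Nil)
      then show ?thesis using Cons.IH joined_trans by blast
    next
      case False
      then have "a = e" using Cons.hyps(1) by simp
      then have "(u = t e \<and> v = h e) \<or> (u = h e \<and> v = t e)"
        using Cons.hyps(2) ends[OF e] by (auto simp: doubleton_eq_iff)
      moreover have "joined G F (t e) (t e)" "joined G F (h e) (h e)" using joined_refl te by blast+
      ultimately show ?thesis using Cons.IH joined_trans joined_sym[OF F] by metis
    qed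
  qed
next
  have te: "t e \<in> verts G" "h e \<in> verts G" using ends[OF e] ends_verts[OF e] by auto
  have mono: "joined G F a b \<Longrightarrow> joined G (insert e F) a b" for a b
    unfolding joined_def using walk_mono subset_insertI by metis
  have "walk G (insert e F) (t e) [e] (h e)" "walk G (insert e F) (h e) [e] (t e)"
    using ends[OF e] te by (auto intro!: walk.intros simp: insert_commute)
  then have "joined G (insert e F) (t e) (h e)" "joined G (insert e F) (h e) (t e)"
    unfolding joined_def by blast+
  then show "joined G F x y \<or> (joined G F x (t e) \<and> joined G F (h e) y) \<or> (joined G F x (h e) \<and> joined G F (t e) y)
     \<Longrightarrow> joined G (insert e F) x y"
    using mono joined_trans by metis
qed

text \<open>
  A cycle through \<open>e\<close>, without \<open>e\<close>, is a walk between the ends of \<open>e\<close>, and conversely.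
\<close>

lemma acyclic_insert:
  assumes F: "F \<subseteq> edges G" and e: "e \<in> edges G" "e \<notin> F" and ac: "acyclic_edges G F"
  shows "acyclic_edges G (insert e F) \<longleftrightarrow> \<not> joined G F (t e) (h e)"
proof
  have te: "t e \<in> verts G" "h e \<in> verts G" using ends[OF e(1)] ends_verts[OF e(1)] by auto
  assume a: "acyclic_edges G (insert e F)"
  show "\<not> joined G F (t e) (h e)"
  proof
    assume "joined G F (t e) (h e)"
    then obtain fs where fs: "walk G F (t e) fs (h e)" "distinct fs"
      unfolding joined_def using walk_distinct ends_verts'[OF F] by metis
    have "walk G (insert e F) (h e) (e # fs) (h e)"
      using ends[OF e(1)] walk_mono[OF fs(1), of "insert e F"] by (intro walk.Cons) (auto simp: insert_commute)
    moreover have "distinct (e # fs)" using fs walk_edges[OF fs(1)] e by auto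
    ultimately show False using a unfolding acyclic_edges_def by blast
  qed
next
  assume nj: "\<not> joined G F (t e) (h e)"
  have eF: "insert e F \<subseteq> edges G" using F e by simp
  show "acyclic_edges G (insert e F)"
    unfolding acyclic_edges_def
  proof
    assume "\<exists>u es. es \<noteq> [] \<and> distinct es \<and> walk G (insert e F) u es u"
    then obtain u es where es: "es \<noteq> []" "distinct es" "walk G (insert e F) u es u" by blast
    show False
    proof (cases "e \<in> set es")
      case False
      then have "walk G F u es u" using walk_edges[OF es(3)] by (intro walk_restrict[OF es(3)]) auto
      then show False using es ac unfolding acyclic_edges_def by blast
    next
      case True
      then obtain as bs where ab: "es = as @ e # bs" by (auto simp: in_set_conv_decomp)
      obtain w where w: "walk G (insert e F) u as w" "walk G (insert e F) w (e # bs) u"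
        using walk_split[of G "insert e F" u as "e # bs" u] es(3) ab ends_verts'[OF eF] by blast
      then obtain y where y: "ends G e = {w, y}" "walk G (insert e F) y bs u" by (auto elim: walk.cases)
      have "set as \<subseteq> F" "set bs \<subseteq> F"
        using es(2) ab walk_edges[OF w(1)] walk_edges[OF y(2)] by auto
      then have "walk G F u as w" "walk G F y bs u" using walk_restrict w(1) y(2) by metis+
      then have "joined G F y w" unfolding joined_def using walk_append by metis
      moreover have "(w = t e \<and> y = h e) \<or> (w = h e \<and> y = t e)"
        using y(1) ends[OF e(1)] by (auto simp: doubleton_eq_iff)
      ultimately show False using nj joined_sym[OF F] by blast
    qed
  qed
qed

end

section \<open>Deletion and contraction compute the graph polynomial\<close>

text \<open>
  Kruskal's algorithm on the edges in \<open>T\<close>: each edge has to join two different classes, and at the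
  end there has to be only one. This is the branch of the deletion-contraction recursion in which
  the edges of \<open>T\<close> are contracted.
\<close>

fun accept :: "'w set \<Rightarrow> ('e \<Rightarrow> 'w) \<Rightarrow> ('e \<Rightarrow> 'w) \<Rightarrow> ('w \<Rightarrow> 'w) \<Rightarrow> 'e list \<Rightarrow> 'e set \<Rightarrow> bool" where
  "accept W a b c [] T \<longleftrightarrow> (\<forall>x\<in>W. \<forall>y\<in>W. c x = c y)"
| "accept W a b c (e # es) T \<longleftrightarrow> (if e \<in> T then c (a e) \<noteq> c (b e) \<and> accept W a b (merge c (a e) (b e)) es T
     else accept W a b c es T)"

lemma accept_cong: "T \<inter> set es = T' \<inter> set es \<Longrightarrow> accept W a b c es T \<longleftrightarrow> accept W a b c es T'"
proof (induction es arbitrary: c)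
  case (Cons e es)
  have "T \<inter> set es = T' \<inter> set es" "e \<in> T \<longleftrightarrow> e \<in> T'" using Cons.prems by auto
  then show ?case using Cons.IH by simp
qed simp

lemma psi_expand:
  fixes val :: "'e \<Rightarrow> 'a::comm_ring_1"
  assumes "distinct es"
  shows "psi W c (map (\<lambda>e. (a e, b e)) es) (rev (map val es)) =
     (\<Sum>T\<in>Pow (set es). of_bool (accept W a b c es T) * (\<Prod>e\<in>set es - T. val e))"
  using assms
proof (induction es arbitrary: c)
  case Nil
  then show ?case by simp
next
  case (Cons e es)
  let ?S = "set es"
  have e: "e \<notin> ?S" "distinct es" using Cons.prems by auto
  have inj: "inj_on (insert e) (Pow ?S)" using e(1) by (intro inj_onI) (metis PowD insert_ident subsetD)
  have disj: "Pow ?S \<inter> insert e ` Pow ?S = {}" using e(1) by blast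
  let ?f = "\<lambda>T. of_bool (accept W a b c (e # es) T) * (\<Prod>e\<in>set (e # es) - T. val e)"
  have "(\<Sum>T\<in>Pow (set (e # es)). ?f T) = (\<Sum>T\<in>Pow ?S. ?f T) + (\<Sum>T\<in>insert e ` Pow ?S. ?f T)"
    unfolding set_simps(2) Pow_insert using disj by (intro sum.union_disjoint) auto
  also have "(\<Sum>T\<in>insert e ` Pow ?S. ?f T) = (\<Sum>T\<in>Pow ?S. ?f (insert e T))"
    by (simp only: sum.reindex[OF inj] o_def)
  also have "(\<Sum>T\<in>Pow ?S. ?f T) = (\<Sum>T\<in>Pow ?S. val e * (of_bool (accept W a b c es T) * (\<Prod>e\<in>?S - T. val e)))"
  proof (rule sum.cong)
    fix T assume T: "T \<in> Pow ?S"
    then have eT: "e \<notin> T" and 1: "set (e # es) - T = insert e (?S - T)" using e(1) by auto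
    have 2: "(\<Prod>x\<in>set (e # es) - T. val x) = val e * (\<Prod>x\<in>?S - T. val x)"
      unfolding 1 by (rule prod.insert) (use e(1) in auto)
    have 3: "accept W a b c (e # es) T \<longleftrightarrow> accept W a b c es T" using eT by simp
    show "?f T = val e * (of_bool (accept W a b c es T) * (\<Prod>e\<in>?S - T. val e))"
      unfolding 2 3 by (rule mult.left_commute)
  qed simp
  also have "\<dots> = val e * psi W c (map (\<lambda>e. (a e, b e)) es) (rev (map val es))"
    unfolding Cons.IH[OF e(2)] by (simp only: sum_distrib_left)
  also have "(\<Sum>T\<in>Pow ?S. ?f (insert e T)) =
     (if c (a e) = c (b e) then 0 else psi W (merge c (a e) (b e)) (map (\<lambda>e. (a e, b e)) es) (rev (map val es)))"
  proof -
    have "?f (insert e T) = (if c (a e) = c (b e) then 0 else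
       of_bool (accept W a b (merge c (a e) (b e)) es T) * (\<Prod>e\<in>?S - T. val e))" if T: "T \<in> Pow ?S" for T
    proof -
      have 1: "set (e # es) - insert e T = ?S - T" using e(1) T by auto
      have 2: "accept W a b c' es (insert e T) \<longleftrightarrow> accept W a b c' es T" for c'
        by (rule accept_cong) (use e(1) in auto)
      have "accept W a b c (e # es) (insert e T) \<longleftrightarrow> c (a e) \<noteq> c (b e) \<and> accept W a b (merge c (a e) (b e)) es T"
        unfolding accept.simps 2 by simp
      then show ?thesis unfolding 1 by (cases "c (a e) = c (b e)") simp_all
    qed
    then have "(\<Sum>T\<in>Pow ?S. ?f (insert e T)) = (\<Sum>T\<in>Pow ?S. if c (a e) = c (b e) then 0 else
       of_bool (accept W a b (merge c (a e) (b e)) es T) * (\<Prod>e\<in>?S - T. val e))" by (intro sum.cong refl)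
    then show ?thesis unfolding Cons.IH[OF e(2)] by simp
  qed
  finally show ?case by simp
qed

lemma acyclic_edges_mono: "acyclic_edges G F \<Longrightarrow> F' \<subseteq> F \<Longrightarrow> acyclic_edges G F'"
  unfolding acyclic_edges_def using walk_mono by metis

text \<open>
  The invariant is that \<open>F\<close>, the set of edges contracted so far, is acyclic and that the colour
  classes are its connected components. An edge creates a cycle exactly if its ends have the same
  colour.
\<close>

lemma accept_iff_spanning:
  fixes G :: "('v, 'e) multigraph" and t h :: "'e \<Rightarrow> 'v" and \<iota> :: "'v \<Rightarrow> 'w"
  assumes ends: "\<And>e. e \<in> edges G \<Longrightarrow> ends G e = {t e, h e}"
    and ends_verts: "\<And>e. e \<in> edges G \<Longrightarrow> ends G e \<subseteq> verts G"
    and "F \<subseteq> edges G" "set es \<subseteq> edges G" "distinct es" "set es \<inter> F = {}" "T \<subseteq> set es" "acyclic_edges G F"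
    and "\<And>x y. x \<in> verts G \<Longrightarrow> y \<in> verts G \<Longrightarrow> c (\<iota> x) = c (\<iota> y) \<longleftrightarrow> joined G F x y"
  shows "accept (\<iota> ` verts G) (\<lambda>e. \<iota> (t e)) (\<lambda>e. \<iota> (h e)) c es T \<longleftrightarrow>
     (\<forall>x\<in>verts G. \<forall>y\<in>verts G. joined G (F \<union> T) x y) \<and> acyclic_edges G (F \<union> T)"
  using assms(3-)
proof (induction es arbitrary: c F T)
  case Nil
  then show ?case by simp
next
  case (Cons e es)
  note F = Cons.prems(1) and ac_F = Cons.prems(6) and p = Cons.prems(7)
  have e: "e \<in> edges G" "e \<notin> F" "e \<notin> set es" and
    es: "set es \<subseteq> edges G" "distinct es" "set es \<inter> F = {}" "set es \<inter> insert e F = {}"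
    using Cons.prems(2-4) by auto
  have te: "t e \<in> verts G" "h e \<in> verts G" using ends[OF e(1)] ends_verts[OF e(1)] by auto
  show ?case
  proof (cases "e \<in> T")
    case False
    have "accept (\<iota> ` verts G) (\<lambda>e. \<iota> (t e)) (\<lambda>e. \<iota> (h e)) c es T \<longleftrightarrow>
      (\<forall>x\<in>verts G. \<forall>y\<in>verts G. joined G (F \<union> T) x y) \<and> acyclic_edges G (F \<union> T)"
      by (rule Cons.IH[OF F es(1-3) _ ac_F p]) (use Cons.prems(5) False in auto)
    then show ?thesis using False by simp
  next
    case True
    let ?c = "merge c (\<iota> (t e)) (\<iota> (h e))" and ?T = "T - {e}" and ?F = "insert e F"
    have FT: "?F \<union> ?T = F \<union> T" using True by auto
    have j: "c (\<iota> (t e)) = c (\<iota> (h e)) \<longleftrightarrow> joined G F (t e) (h e)" by (rule Cons.prems(7)[OF te])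
    have ac: "acyclic_edges G ?F \<longleftrightarrow> \<not> joined G F (t e) (h e)"
      by (rule acyclic_insert[where t = t and h = h, OF ends ends_verts Cons.prems(1) e(1,2) Cons.prems(6)])
    have merge_eq: "(X = Y \<or> (X = u \<and> v = Y) \<or> (X = v \<and> u = Y)) \<longleftrightarrow>
        ((if X = u then v else X) = (if Y = u then v else Y))" for X Y u v :: 'w by auto
    show ?thesis
    proof (cases "joined G F (t e) (h e)")
      case j1: True
      have "\<not> acyclic_edges G (F \<union> T)"
      proof
        assume "acyclic_edges G (F \<union> T)"
        moreover have "?F \<subseteq> F \<union> T" using True by auto
        ultimately have "acyclic_edges G ?F" by (rule acyclic_edges_mono)
        then show False using ac j1 by blast
      qed
      then show ?thesis using j j1 True by simp
    next
      case j0: False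
      have "accept (\<iota> ` verts G) (\<lambda>e. \<iota> (t e)) (\<lambda>e. \<iota> (h e)) ?c es ?T \<longleftrightarrow>
        (\<forall>x\<in>verts G. \<forall>y\<in>verts G. joined G (?F \<union> ?T) x y) \<and> acyclic_edges G (?F \<union> ?T)"
      proof (rule Cons.IH)
        show "acyclic_edges G ?F" using ac j0 by blast
        fix x y assume xy: "x \<in> verts G" "y \<in> verts G"
        have "joined G ?F x y \<longleftrightarrow> joined G F x y \<or> (joined G F x (t e) \<and> joined G F (h e) y)
           \<or> (joined G F x (h e) \<and> joined G F (t e) y)"
          by (rule joined_insert[where t = t and h = h, OF ends ends_verts Cons.prems(1) e(1) xy])
        also have "\<dots> \<longleftrightarrow> c (\<iota> x) = c (\<iota> y) \<or> (c (\<iota> x) = c (\<iota> (t e)) \<and> c (\<iota> (h e)) = c (\<iota> y))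
           \<or> (c (\<iota> x) = c (\<iota> (h e)) \<and> c (\<iota> (t e)) = c (\<iota> y))"
          using p[OF xy] p[OF xy(1) te(1)] p[OF xy(1) te(2)] p[OF te(1) xy(2)] p[OF te(2) xy(2)] by simp
        also have "\<dots> \<longleftrightarrow> ?c (\<iota> x) = ?c (\<iota> y)"
          unfolding merge_def by (rule merge_eq)
        finally show "?c (\<iota> x) = ?c (\<iota> y) \<longleftrightarrow> joined G ?F x y" by blast
      qed (use F e(1) es Cons.prems(5) in auto)
      moreover have "accept (\<iota> ` verts G) (\<lambda>e. \<iota> (t e)) (\<lambda>e. \<iota> (h e)) ?c es ?T \<longleftrightarrow>
         accept (\<iota> ` verts G) (\<lambda>e. \<iota> (t e)) (\<lambda>e. \<iota> (h e)) ?c es T"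
        by (rule accept_cong) (use e in auto)
      ultimately show ?thesis unfolding FT using j j0 True by simp
    qed
  qed
qed

lemma joined_empty: "x \<in> verts G \<Longrightarrow> joined G {} x y \<longleftrightarrow> x = y"
  unfolding joined_def by (auto elim: walk.cases intro: walk.Nil)

lemma acyclic_empty: "acyclic_edges G {}"
  unfolding acyclic_edges_def by (auto elim: walk.cases)

lemma psi_eq_sum_spanning_trees:
  fixes G :: "('v, 'e) multigraph" and t h :: "'e \<Rightarrow> 'v" and \<iota> :: "'v \<Rightarrow> 'w" and val :: "'e \<Rightarrow> 'a::comm_ring_1"
  assumes ends: "\<And>e. e \<in> edges G \<Longrightarrow> ends G e = {t e, h e}"
    and ends_verts: "\<And>e. e \<in> edges G \<Longrightarrow> ends G e \<subseteq> verts G"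
    and es: "distinct es" "set es = edges G" and ne: "verts G \<noteq> {}" and inj: "inj \<iota>"
  shows "psi (\<iota> ` verts G) id (map (\<lambda>e. (\<iota> (t e), \<iota> (h e))) es) (rev (map val es)) =
     (\<Sum>T | spanning_tree G T. \<Prod>e\<in>edges G - T. val e)"
proof -
  have acc: "accept (\<iota> ` verts G) (\<lambda>e. \<iota> (t e)) (\<lambda>e. \<iota> (h e)) id es T \<longleftrightarrow> spanning_tree G T" if T: "T \<subseteq> edges G" for T
  proof -
    have "accept (\<iota> ` verts G) (\<lambda>e. \<iota> (t e)) (\<lambda>e. \<iota> (h e)) id es T \<longleftrightarrow>
       (\<forall>x\<in>verts G. \<forall>y\<in>verts G. joined G ({} \<union> T) x y) \<and> acyclic_edges G ({} \<union> T)"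
      by (rule accept_iff_spanning[OF ends ends_verts])
         (use es T joined_empty[of _ G] acyclic_empty inj in \<open>auto simp: inj_eq\<close>)
    then show ?thesis using T ne unfolding spanning_tree_def connected_by_def joined_def by simp
  qed
  have "finite (edges G)" using es(2) by (metis List.finite_set)
  have "(\<Sum>T\<in>Pow (edges G). of_bool (accept (\<iota> ` verts G) (\<lambda>e. \<iota> (t e)) (\<lambda>e. \<iota> (h e)) id es T) * (\<Prod>e\<in>edges G - T. val e))
    = (\<Sum>T\<in>Pow (edges G). if spanning_tree G T then \<Prod>e\<in>edges G - T. val e else 0)"
    by (intro sum.cong refl) (simp add: acc)
  also have "\<dots> = (\<Sum>T\<in>{T \<in> Pow (edges G). spanning_tree G T}. \<Prod>e\<in>edges G - T. val e)"
    by (rule sum.inter_filter[symmetric]) (simp add: \<open>finite (edges G)\<close>)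
  also have "{T \<in> Pow (edges G). spanning_tree G T} = {T. spanning_tree G T}"
    by (auto simp: spanning_tree_def)
  finally show ?thesis unfolding psi_expand[OF es(1)] es(2) .
qed

lemma peval_sum: "peval (\<Sum>i\<in>A. f i) x = (\<Sum>i\<in>A. peval (f i) x)"
  by (induction A rule: infinite_finite_induct) simp_all

lemma peval_prod: "peval (\<Prod>i\<in>A. f i) x = (\<Prod>i\<in>A. peval (f i) x)"
  by (induction A rule: infinite_finite_induct) simp_all

lemma mpoly_eval_of_int_prod:
  "mpoly_eval (of_int :: int \<Rightarrow> 'b::comm_ring_1) f (\<Prod>i\<in>A. g i) = (\<Prod>i\<in>A. mpoly_eval of_int f (g i))"
proof -
  have "mpoly_eval (of_int :: int \<Rightarrow> 'b) f 1 = 1"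
    using mpoly_eval_single[of "of_int :: int \<Rightarrow> 'b" f 0 1] by simp
  then show ?thesis
    by (induction A rule: infinite_finite_induct) (simp_all add: mpoly_eval_mult)
qed

lemma peval_graph_poly:
  "peval (mpoly_eval of_int (\<lambda>e. mvar (idx e)) (graph_poly G)) x =
     (\<Sum>T | spanning_tree G T. \<Prod>e\<in>edges G - T. nth_default 0 x (idx e))"
  by (simp add: graph_poly_def mpoly_eval_sum mpoly_eval_of_int_prod mpoly_eval_mvar peval_sum peval_prod)

section \<open>Orderings of the edges with boundaries of at most three vertices\<close>

text \<open>
  When only one edge \<open>{u, v}\<close> is left there is room for both of its ends.
\<close>

lemma slots_hold:
  assumes S: "slots TYPE('k::field) es {u, v} S" and inf: "infinite (UNIV :: 'w set)"
  shows "\<exists>S' :: 'w set. repr TYPE('k) es S' \<and> u \<in> S' \<and> v \<in> S' \<and> S' \<inter> vset es \<subseteq> {u, v}"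
proof -
  obtain S0 where S0: "slots TYPE('k) es {u, v} S0" and av: "\<And>x. x \<in> S0 \<Longrightarrow> x \<in> {u, v} \<Longrightarrow> x \<in> vset es"
    using slots_avoid[OF S, of "{u, v}"] inf by auto
  have R: "repr TYPE('k) es S0" and SV: "S0 \<inter> vset es = {u, v} \<inter> vset es" using S0 by (auto simp: slots_def)
  have "card (S0 \<inter> vset es) \<le> card {u, v}" unfolding SV by (intro card_mono) auto
  also have "\<dots> \<le> 2" by (simp add: card_insert_if)
  finally obtain a where a: "a \<in> S0" "a \<notin> vset es" using repr_free_slot[OF R] by blast
  define S1 where "S1 = (if u \<in> vset es then S0 else insert u (S0 - {a}))"
  have S1: "repr TYPE('k) es S1" "u \<in> S1" "S1 \<inter> vset es \<subseteq> {u, v}" "v \<in> vset es \<Longrightarrow> v \<in> S1"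
  proof -
    show "repr TYPE('k) es S1"
    proof (cases "u \<in> vset es")
      case False
      then have "u \<notin> vset es \<union> S0" using av by auto
      from repr_retarget[OF R a this] show ?thesis using False by (simp add: S1_def)
    qed (simp add: S1_def R)
    show "u \<in> S1" "S1 \<inter> vset es \<subseteq> {u, v}" "v \<in> vset es \<Longrightarrow> v \<in> S1"
      using SV a by (auto simp: S1_def)
  qed
  show ?thesis
  proof (cases "v \<in> S1")
    case True
    then show ?thesis using S1 by blast
  next
    case False
    then have v: "v \<notin> vset es" using S1(4) by blast
    have "S1 \<inter> (insert u (vset es)) \<subseteq> {u}" using S1(3) False by auto
    then have "card (S1 \<inter> (insert u (vset es))) \<le> card {u}" by (intro card_mono) auto
    then have "card (S1 \<inter> (insert u (vset es))) \<le> 2" by simp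
    then obtain a' where a': "a' \<in> S1" "a' \<notin> insert u (vset es)" using repr_free_slot[OF S1(1)] by blast
    have "repr TYPE('k) es (insert v (S1 - {a'}))"
      by (rule repr_retarget[OF S1(1)]) (use a' v False in auto)
    then show ?thesis using S1 a' v by (intro exI[of _ "insert v (S1 - {a'})"]) auto
  qed
qed

text \<open>
  Both ends of the head edge are marked before it is added. The remaining marked vertices are
  placeholders; identifying them with \<open>u\<close> makes them disappear, so that the graph polynomial is an
  entry of the form of the final state.
\<close>

lemma poly_int_psi:
  assumes S: "slots TYPE('k::field) es {u, v} S" and inf: "infinite (UNIV :: 'w set)"
  shows "poly_int (Suc (length es)) (\<lambda>p :: 'k alg_closure list.
    of_bool (psi (vset ((u, v) # es)) id ((u :: 'w, v) # es) p = 0))"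
proof -
  obtain S1 where S1: "repr TYPE('k) es S1" "u \<in> S1" "v \<in> S1" "S1 \<inter> vset es \<subseteq> {u, v}"
    using slots_hold[OF S inf] by blast
  let ?es = "(u, v) # es"
  show ?thesis
  proof (cases "u = v")
    case True
    have "repr TYPE('k) ?es S1" using repr_loop[OF S1(1), of u] S1(2) True by simp
    from reprE[OF this S1(2)] obtain b d and F :: "'k alg_closure list \<Rightarrow> 'k alg_closure state" where
      F: "S1 = {u, b, d}" "u \<noteq> b" "u \<noteq> d" "b \<noteq> d" "good (length ?es) F"
      "\<forall>p. length p = length ?es \<longrightarrow> represents ?es u b d (F p) p" by metis
    have bd: "b \<notin> vset ?es" "d \<notin> vset ?es" using F(1-4) S1(4) True by auto
    \<comment> \<open>Both other marked vertices are placeholders: the entry \<open>f4\<close> at position \<open>(3, 4)\<close>.\<close>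
    have "poly_int (length ?es) (\<lambda>p. of_bool (om (F p) (emb (Vec 0 0 1 0)) (emb (Vec 0 0 0 1)) = 0))"
      by (rule good_atoms(1)[OF F(5)])
    then show ?thesis unfolding length_Cons
    proof (rule poly_int_cong)
      fix p :: "'k alg_closure list" assume p: "length p = Suc (length es)"
      then have R: "represents ?es u b d (F p) p" using F(6) by simp
      obtain f0 f1 f2 f3 f4 where f: "F p = State f0 f1 f2 f3 f4" by (cases "F p")
      note g = representsD(5)[OF R[unfolded f]]
      have "psi (vset ?es) id ?es p = psi ({u, b, d} \<union> vset ?es) (glue3 b d u) ?es p"
        by (rule psi_transfer[where r = id]) (use bd F in \<open>auto simp: glue3_def\<close>)
      then show "of_bool (om (F p) (emb (Vec 0 0 1 0)) (emb (Vec 0 0 0 1)) = 0) =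
         (of_bool (psi (vset ?es) id ?es p = 0) :: int)"
        unfolding f g by (simp add: emb_Vec)
    qed
  next
    case False
    have "repr TYPE('k) ?es S1" by (rule repr_parallel[OF S1(1-3) False])
    from reprE2[OF this S1(2,3) False] obtain d and F :: "'k alg_closure list \<Rightarrow> 'k alg_closure state" where
      F: "S1 = {u, v, d}" "u \<noteq> d" "v \<noteq> d" "good (length ?es) F"
      "\<forall>p. length p = length ?es \<longrightarrow> represents ?es u v d (F p) p" by metis
    have d: "d \<notin> vset ?es" using F(1-3) S1(4) by auto
    \<comment> \<open>Only \<open>d\<close> is a placeholder, identified with \<open>u\<close>: the entry \<open>f1 + f3\<close> at position \<open>(2, 3)\<close>.\<close>
    have "poly_int (length ?es) (\<lambda>p. of_bool (om (F p) (emb (Vec 0 1 0 0)) (emb (Vec 0 0 1 0)) = 0))"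
      by (rule good_atoms(1)[OF F(4)])
    then show ?thesis unfolding length_Cons
    proof (rule poly_int_cong)
      fix p :: "'k alg_closure list" assume p: "length p = Suc (length es)"
      then have R: "represents ?es u v d (F p) p" using F(5) by simp
      obtain f0 f1 f2 f3 f4 where f: "F p = State f0 f1 f2 f3 f4" by (cases "F p")
      note g = representsD(3)[OF R[unfolded f]]
      have "psi (vset ?es) id ?es p = psi ({u, v, d} \<union> vset ?es) (glue d u) ?es p"
        by (rule psi_transfer[where r = id]) (use d F False in \<open>auto simp: glue_def\<close>)
      then show "of_bool (om (F p) (emb (Vec 0 1 0 0)) (emb (Vec 0 0 1 0)) = 0) =
         (of_bool (psi (vset ?es) id ?es p = 0) :: int)"
        unfolding f g by (simp add: emb_Vec)
    qed
  qed
qed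

text \<open>
  The induction adds the edges from the end of the ordering; \<open>ps\<close> are the edges still to come.
\<close>

lemma slots_exist:
  fixes a b :: "'e \<Rightarrow> 'w"
  assumes inf: "infinite (UNIV :: 'w set)"
    and width: "\<And>ps qs. es = ps @ qs \<Longrightarrow> card ((\<Union>e\<in>set ps. {a e, b e}) \<inter> (\<Union>e\<in>set qs. {a e, b e})) \<le> 3"
  shows "es = ps @ qs \<Longrightarrow> \<exists>S. slots TYPE('k::field) (map (\<lambda>e. (a e, b e)) qs) (\<Union>e\<in>set ps. {a e, b e}) S"
proof (induction qs arbitrary: ps)
  case Nil
  obtain S :: "'w set" where "finite S" "card S = 3" using infinite_arbitrarily_large[OF inf] by blast
  then show ?case unfolding slots_def by (intro exI[of _ S]) (simp add: repr_init)
next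
  case (Cons e qs)
  from Cons.IH[of "ps @ [e]"] Cons.prems obtain S where
    S: "slots TYPE('k) (map (\<lambda>e. (a e, b e)) qs) ((\<Union>e\<in>set ps. {a e, b e}) \<union> {a e, b e}) S"
    by (auto simp: Un_commute)
  have "vset ((a e, b e) # map (\<lambda>e. (a e, b e)) qs) = (\<Union>e\<in>set (e # qs). {a e, b e})"
    by (auto simp: vset_def)
  then have "card ((\<Union>e\<in>set ps. {a e, b e}) \<inter> vset ((a e, b e) # map (\<lambda>e. (a e, b e)) qs)) \<le> 3"
    using width[OF Cons.prems] by simp
  from slots_step[OF S this inf] show ?case by auto
qed

lemma covered_by_edges:
  assumes "connected_graph G" "e \<in> edges G" "x \<in> verts G" "y \<in> ends G e" "y \<in> verts G"
  shows "x \<in> (\<Union>e\<in>edges G. ends G e)"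
proof -
  obtain ws where "walk G (edges G) x ws y"
    using assms unfolding connected_graph_def connected_by_def by blast
  then show ?thesis by cases (use assms in auto)
qed

text \<open>
  The head edge of a list carries the last variable, so the coordinates of the recursion enumerate
  the edges backwards.
\<close>

lemma bij_betw_reversed_enumeration:
  assumes "distinct es" "bij_betw f (set es) {..<n}" "length es = n"
  shows "bij_betw (\<lambda>i. f (es ! (n - 1 - i))) {..<n} {..<n}"
proof -
  have 1: "bij_betw (\<lambda>i. n - 1 - i) {..<n} {..<n}"
  proof (rule bij_betw_byWitness[where f' = "\<lambda>i. n - 1 - i"])
    show "\<forall>a\<in>{..<n}. n - 1 - (n - 1 - a) = a" by auto
    show "\<forall>a\<in>{..<n}. n - 1 - (n - 1 - a) = a" by auto
    show "(\<lambda>i. n - 1 - i) ` {..<n} \<subseteq> {..<n}" "(\<lambda>i. n - 1 - i) ` {..<n} \<subseteq> {..<n}" by auto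
  qed
  have 2: "bij_betw (\<lambda>i. es ! i) {..<n} (set es)"
    by (rule bij_betw_nth) (use assms in auto)
  show ?thesis using bij_betw_trans[OF bij_betw_trans[OF 1 2] assms(2)] unfolding o_def .
qed

lemma rev_map_permuted:
  assumes "length es = n" "length p = n" "\<And>i. i < n \<Longrightarrow> \<sigma> i = idx (es ! (n - 1 - i))"
    "bij_betw \<sigma> {..<n} {..<n}"
  shows "rev (map (\<lambda>e. nth_default 0 (map (\<lambda>j. p ! inv_into {..<n} \<sigma> j) [0..<n]) (idx e)) es) = p"
proof (rule nth_equalityI)
  let ?q = "map (\<lambda>j. p ! inv_into {..<n} \<sigma> j) [0..<n]"
  let ?val = "\<lambda>e. nth_default 0 ?q (idx e)"
  show "length (rev (map ?val es)) = length p" using assms(1,2) by simp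
  fix i assume "i < length (rev (map ?val es))"
  then have i: "i < n" using assms(1) by simp
  have \<sigma>i: "\<sigma> i < n" using assms(4) i by (auto simp: bij_betw_def)
  have "rev (map ?val es) ! i = map ?val es ! (n - Suc i)"
    using i assms(1) rev_nth[of i "map ?val es"] by (simp only: length_map)
  also have "\<dots> = ?val (es ! (n - Suc i))" by (rule nth_map) (use i assms(1) in simp)
  also have "idx (es ! (n - Suc i)) = \<sigma> i" using assms(3)[OF i] by simp
  also have "nth_default 0 ?q (\<sigma> i) = p ! inv_into {..<n} \<sigma> (\<sigma> i)"
    using \<sigma>i by (simp add: nth_default_def)
  also have "inv_into {..<n} \<sigma> (\<sigma> i) = i"
    using bij_betw_inv_into_left[OF assms(4)] i by simp
  finally show "rev (map ?val es) ! i = p ! i" .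
qed

theorem theorem6:
  fixes G :: "('v, 'e) multigraph" and idx :: "'e \<Rightarrow> nat"
  assumes "finite_multigraph G"
    and "connected_graph G"
    and "vertex_width_le G 3"
    and "bij_betw idx (edges G) {..<card (edges G)}"
  shows "\<exists>(d :: nat) (c :: nat \<Rightarrow> int).
    K0_class (graph_hypersurface idx G :: 'k::field variety) =
      (\<Oplus>\<^bsub>K0\<^esub>i\<in>{..d}. [c i] \<cdot>\<^bsub>K0\<^esub> (lefschetz [^]\<^bsub>K0\<^esub> i))"
proof -
  define n where "n = card (edges G)"
  define p where "p = (mpoly_eval of_int (\<lambda>e. mvar (idx e)) (graph_poly G) :: (nat, 'k) mpoly)"
  define Z where "Z = zero_locus n {p}"
  have "\<exists>u v. ends G e = {u, v}" if "e \<in> edges G" for e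
  proof -
    have "card (ends G e) = 1 \<or> card (ends G e) = 2" using assms(1) that by (auto simp: finite_multigraph_def)
    then show ?thesis by (metis card_1_singletonE card_2_iff insert_absorb2)
  qed
  then obtain t h where ends: "\<And>e. e \<in> edges G \<Longrightarrow> ends G e = {t e, h e}" by metis
  have ends_verts: "ends G e \<subseteq> verts G" if "e \<in> edges G" for e
    using assms(1) that by (simp add: finite_multigraph_def)
  have ne: "verts G \<noteq> {}" using assms(2) by (simp add: connected_graph_def connected_by_def)
  obtain es where es: "distinct es" "set es = edges G" and
    width: "\<And>i. i \<le> length es \<Longrightarrow> card ((\<Union>e\<in>set (take i es). ends G e) \<inter> (\<Union>e\<in>set (drop i es). ends G e)) \<le> 3"
    using assms(3) unfolding vertex_width_le_def by blast
  have len: "length es = n" unfolding n_def es(2)[symmetric] by (rule distinct_card[OF es(1), symmetric])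
  have Z: "affine_closed n Z" unfolding affine_closed_def Z_def by blast
  \<comment> \<open>The second summand supplies infinitely many placeholder vertices.\<close>
  let ?a = "\<lambda>e. Inl (t e) :: 'v + nat" and ?b = "\<lambda>e. Inl (h e) :: 'v + nat"
  let ?pairs = "map (\<lambda>e. (?a e, ?b e))"
  have inf: "infinite (UNIV :: ('v + nat) set)" by simp
  define \<sigma> where "\<sigma> i = idx (es ! (n - 1 - i))" for i
  have \<sigma>: "bij_betw \<sigma> {..<n} {..<n}"
    unfolding \<sigma>_def by (rule bij_betw_reversed_enumeration[OF es(1) _ len]) (simp add: es(2) n_def assms(4))
  define g where "g q = map (\<lambda>j. q ! inv_into {..<n} \<sigma> j) [0..<n]" for q :: "'k alg_closure list"
  have psi_value: "psi (Inl ` verts G) id (?pairs es) q = peval p (g q)" if q: "length q = n" for q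
  proof -
    let ?val = "\<lambda>e. nth_default 0 (g q) (idx e)"
    have q_eq: "rev (map ?val es) = q"
      unfolding g_def by (rule rev_map_permuted[OF len q _ \<sigma>]) (simp add: \<sigma>_def)
    have "psi (Inl ` verts G) id (?pairs es) (rev (map ?val es)) =
        (\<Sum>T | spanning_tree G T. \<Prod>e\<in>edges G - T. ?val e)"
      by (rule psi_eq_sum_spanning_trees[OF ends ends_verts es ne inj_Inl])
    also have "\<dots> = peval p (g q)" by (simp only: peval_graph_poly p_def)
    finally show ?thesis unfolding q_eq .
  qed
  have "poly_int n (\<lambda>q :: 'k alg_closure list. of_bool (psi (Inl ` verts G) id (?pairs es) q = 0))"
  proof (cases es)
    case Nil
    then have "n = 0" using len by simp
    then show ?thesis by (simp only: poly_int_zero_dim)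
  next
    case (Cons e fs)
    have U: "(\<Union>e\<in>set xs. {?a e, ?b e}) = Inl ` (\<Union>e\<in>set xs. ends G e)" if xs: "set xs \<subseteq> edges G" for xs
    proof -
      have "{?a e, ?b e} = Inl ` ends G e" if "e \<in> set xs" for e using ends xs that by auto
      then show ?thesis unfolding image_UN by (intro SUP_cong refl)
    qed
    have wd: "card ((\<Union>e\<in>set ps. {?a e, ?b e}) \<inter> (\<Union>e\<in>set qs. {?a e, ?b e})) \<le> 3" if "es = ps @ qs" for ps qs
    proof -
      have sub: "set ps \<subseteq> edges G" "set qs \<subseteq> edges G" using es(2) that by auto
      have "card ((\<Union>e\<in>set ps. ends G e) \<inter> (\<Union>e\<in>set qs. ends G e)) \<le> 3"
        using width[of "length ps"] that by simp
      then show ?thesis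
        unfolding U[OF sub(1)] U[OF sub(2)] image_Int[OF inj_Inl, symmetric] card_image[OF inj_on_subset[OF inj_Inl subset_UNIV]] .
    qed
    have "\<exists>S. slots TYPE('k) (?pairs fs) (\<Union>e\<in>set [e]. {?a e, ?b e}) S"
      by (rule slots_exist[OF inf wd, of es]) (use Cons in simp_all)
    then obtain S where "slots TYPE('k) (?pairs fs) (\<Union>e\<in>set [e]. {?a e, ?b e}) S" by blast
    then have S: "slots TYPE('k) (?pairs fs) {?a e, ?b e} S" by simp
    have Cons': "?pairs es = (?a e, ?b e) # ?pairs fs" using Cons by simp
    have n: "Suc (length (?pairs fs)) = n" using len Cons by simp
    have "vset (?pairs es) = (\<Union>e\<in>set es. {?a e, ?b e})" by (auto simp: vset_def)
    also have "\<dots> = Inl ` (\<Union>e\<in>edges G. ends G e)" using U[of es] es(2) by simp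
    also have "(\<Union>e\<in>edges G. ends G e) = verts G"
    proof
      show "(\<Union>e\<in>edges G. ends G e) \<subseteq> verts G" using ends_verts by blast
      have e: "e \<in> edges G" using es(2) Cons by auto
      have te: "t e \<in> ends G e" "t e \<in> verts G" using ends[OF e] ends_verts[OF e] by auto
      show "verts G \<subseteq> (\<Union>e\<in>edges G. ends G e)"
        using covered_by_edges[OF assms(2) e _ te] by (rule subsetI)
    qed
    finally have "vset (?pairs es) = Inl ` verts G" .
    with poly_int_psi[OF S inf] show ?thesis unfolding n Cons'[symmetric] by (simp only:)
  qed
  then have "poly_int n (\<lambda>q :: 'k alg_closure list. of_bool (g q \<in> Z))"
    by (rule poly_int_cong) (simp add: psi_value zero_locus_def Z_def g_def)
  then have "polyL (cls n Z)" unfolding g_def by (rule polyL_permuted[OF Z \<sigma>])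
  then show ?thesis
    unfolding graph_hypersurface_def Z_def n_def p_def by (intro K0_class_of_polyL) simp_all
qed

end
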